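(* For every $p\in[1,\infty)$, the mapping $\mathfrak Q_p\ni q\mapsto\mathfrak a_q\in\mathfrak A_p$, which sends a potential $q$ to the spectral data of the Dirac operator $T_q$, is bijective.
   Context: Fix $r\in\mathbb N$. $M_r$ is the algebra of complex $r\times r$ matrices, $I$ its unit. Put $\mathfrak Q_p:=L_p((0,1),M_r)$, $p\in[1,\infty)$. Dirac operator. For $q\in\mathfrak Q_p$ let $\vartheta:=\frac1i\begin{pmatrix}I&0\\ 0&-I\end{pmatrix}$, $\mathbf q:=\begin{pmatrix}0&q\\ q^*&0\end{pmatrix}$ and $\mathfrak t_q(y):=\vartheta y'+\mathbf q y$. The self-adjoint operator $T_q$ in $L_2((0,1),\mathbb C^{2r})$ acts by $T_qy=\mathfrak t_q(y)$ on the domain of all $y=(y_1,y_2)^\top$ with $y_1,y_2\in W_1^1((0,1),\mathbb C^r)$ (Sobolev space), $\mathfrak t_q(y)\in L_2((0,1),\mathbb C^{2r})$, $y_1(0)=y_2(0)$, $y_1(1)=y_2(1)$. Its spectrum consists of isolated real eigenvalues of finite multiplicity accumulating only at $\pm\infty$; the pairwise distinct eigenvalues are labeled in increasing order as $\lambda_j(q)$, $j\in\mathbb Z$, with $\lambda_0(q)\le0<\lambda_1(q)$. Norming matrices. Let $a:=\frac1{\sqrt2}(I,\,-I)$ (an $r\times 2r$ matrix). Let $u_q(\cdot,\lambda)\in W_1^1((0,1),M_{2r})$ solve $\vartheta u'+\mathbf q u=\lambda u$, $u(0,\lambda)=I_{2r}$; put $\varphi_q(x,\lambda):=u_q(x,\lambda)\vartheta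 a^*$, $\psi_q(x,\lambda):=u_q(x,\lambda)a^*$, $s_q(\lambda):=a\varphi_q(1,\lambda)$, $c_q(\lambda):=a\psi_q(1,\lambda)$. The Weyl–Titchmarsh function is $m_q(\lambda):=-s_q(\lambda)^{-1}c_q(\lambda)$, a meromorphic function whose set of poles is $\{\lambda_j(q)\}_{j\in\mathbb Z}$. The norming matrices are $\alpha_j(q):=-\operatorname{res}_{\lambda=\lambda_j(q)}m_q(\lambda)$. The spectral data of $T_q$ is the sequence $\mathfrak a_q:=((\lambda_j(q),\alpha_j(q)))_{j\in\mathbb Z}$, and $\mathfrak A_p:=\{\mathfrak a_q\ |\ q\in\mathfrak Q_p\}$. *)

theory Defs
  imports "HOL-Analysis.Analysis" "HOL-Complex_Analysis.Complex_Analysis"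
begin

section \<open>Lebesgue and Sobolev spaces on the unit interval\<close>

abbreviation unit_leb :: "real measure" where
  "unit_leb \<equiv> lebesgue_on {0<..<1}"

text \<open>Functions on the interval are total functions on the reals; their values
  off the interval are irrelevant. For matrix-valued functions the norm is the Frobenius norm,
  which is equivalent to the operator norm, so that the set below is the usual one.\<close>

definition Lp_fun :: "real \<Rightarrow> (real \<Rightarrow> 'a::euclidean_space) set" where
  "Lp_fun p = {f. f \<in> borel_measurable unit_leb \<and> integrable unit_leb (\<lambda>x. norm (f x) powr p)}"

definition Lp_rel :: "real \<Rightarrow> ((real \<Rightarrow> 'a::euclidean_space) \<times> (real \<Rightarrow> 'a)) set" where
  "Lp_rel p = {(f, g). f \<in> Lp_fun p \<and> g \<in> Lp_fun p \<and> (AE x in unit_leb. f x = g x)}"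

definition Lp :: "real \<Rightarrow> (real \<Rightarrow> 'a::euclidean_space) set set" where
  "Lp p = Lp_fun p // Lp_rel p"

definition test_fun :: "(real \<Rightarrow> real) \<Rightarrow> bool" where
  "test_fun \<phi> \<longleftrightarrow> (\<forall>n. (deriv ^^ n) \<phi> differentiable_on UNIV) \<and>
     (\<exists>a b. 0 < a \<and> b < 1 \<and> (\<forall>x. x \<notin> {a..b} \<longrightarrow> \<phi> x = 0))"

definition has_weak_deriv ::
  "(real \<Rightarrow> 'a::euclidean_space) \<Rightarrow> (real \<Rightarrow> 'a) \<Rightarrow> bool" where
  "has_weak_deriv f g \<longleftrightarrow> f \<in> Lp_fun 1 \<and> g \<in> Lp_fun 1 \<and>
     (\<forall>\<phi>. test_fun \<phi> \<longrightarrow>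
        (LINT x|unit_leb. deriv \<phi> x *\<^sub>R f x) = - (LINT x|unit_leb. \<phi> x *\<^sub>R g x))"

text \<open>Every class in the Sobolev space has exactly one representative that is continuous
  on the closed interval; the boundary values refer to this representative, so the
  elements of \<open>W11\<close> are taken to be the continuous representatives.\<close>

definition W11 :: "(real \<Rightarrow> 'a::euclidean_space) set" where
  "W11 = {f. continuous_on {0..1} f \<and> (\<exists>g. has_weak_deriv f g)}"

text \<open>Determined almost everywhere on the interval, and only used up to null sets.\<close>

definition wderiv :: "(real \<Rightarrow> 'a::euclidean_space) \<Rightarrow> real \<Rightarrow> 'a" where
  "wderiv f = (SOME g. has_weak_deriv f g)"


section \<open>The Dirac operator\<close>

definition cmult_mat :: "complex \<Rightarrow> complex^'n^'m \<Rightarrow> complex^'n^'m" where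
  "cmult_mat c A = (\<chi> i j. c * A $ i $ j)"

definition adj :: "complex^'n^'m \<Rightarrow> complex^'m^'n" where
  "adj A = (\<chi> i j. cnj (A $ j $ i))"

definition block_mat :: "complex^'r^'r \<Rightarrow> complex^'r^'r \<Rightarrow> complex^'r^'r \<Rightarrow> complex^'r^'r
    \<Rightarrow> complex^('r::finite+'r)^('r::finite+'r)" where
  "block_mat A B C D = (\<chi> i j. case i of
      Inl k \<Rightarrow> (case j of Inl l \<Rightarrow> A $ k $ l | Inr l \<Rightarrow> B $ k $ l)
    | Inr k \<Rightarrow> (case j of Inl l \<Rightarrow> C $ k $ l | Inr l \<Rightarrow> D $ k $ l))"

definition block_row :: "complex^'r^'r \<Rightarrow> complex^'r^'r \<Rightarrow> complex^('r::finite+'r)^'r" where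
  "block_row A B = (\<chi> i j. case j of Inl l \<Rightarrow> A $ i $ l | Inr l \<Rightarrow> B $ i $ l)"

definition fst_comp :: "complex^('r::finite+'r) \<Rightarrow> complex^'r" where
  "fst_comp v = (\<chi> k. v $ Inl k)"

definition snd_comp :: "complex^('r::finite+'r) \<Rightarrow> complex^'r" where
  "snd_comp v = (\<chi> k. v $ Inr k)"

definition theta :: "complex^('r::finite+'r)^('r::finite+'r)" where
  "theta = cmult_mat (1 / \<i>) (block_mat (mat 1) 0 0 (- mat 1))"

definition bold :: "complex^'r^'r \<Rightarrow> complex^('r::finite+'r)^('r::finite+'r)" where
  "bold A = block_mat 0 A (adj A) 0"

definition dirac_expr :: "(real \<Rightarrow> complex^'r^'r) \<Rightarrow> (real \<Rightarrow> complex^('r::finite+'r))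
    \<Rightarrow> real \<Rightarrow> complex^('r::finite+'r)" where
  "dirac_expr q y x = theta *v wderiv y x + bold (q x) *v y x"

definition dirac_dom :: "(real \<Rightarrow> complex^'r^'r) \<Rightarrow> (real \<Rightarrow> complex^('r::finite+'r)) set" where
  "dirac_dom q = {y. (\<lambda>x. fst_comp (y x)) \<in> W11 \<and> (\<lambda>x. snd_comp (y x)) \<in> W11 \<and>
     dirac_expr q y \<in> Lp_fun 2 \<and>
     fst_comp (y 0) = snd_comp (y 0) \<and> fst_comp (y 1) = snd_comp (y 1)}"

definition eigenvalues :: "(real \<Rightarrow> complex^'r^'r) \<Rightarrow> complex set" where
  "eigenvalues q = {\<mu>. \<exists>y \<in> dirac_dom q. \<not> (AE x in unit_leb. y x = 0) \<and>
     (AE x in unit_leb. dirac_expr q y x = \<mu> *s y x)}"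

definition eigval :: "(real \<Rightarrow> complex^'r^'r) \<Rightarrow> int \<Rightarrow> real" where
  "eigval q = (THE l. strict_mono l \<and> range (\<lambda>j. complex_of_real (l j)) = eigenvalues q \<and>
     l 0 \<le> 0 \<and> 0 < l 1)"


section \<open>Norming matrices and spectral data\<close>

definition amat :: "complex^('r::finite+'r)^'r" where
  "amat = cmult_mat (1 / complex_of_real (sqrt 2)) (block_row (mat 1) (- mat 1))"

definition fund_sol ::
  "(real \<Rightarrow> complex^'r^'r) \<Rightarrow> complex \<Rightarrow> real \<Rightarrow> complex^('r::finite+'r)^('r::finite+'r)" where
  "fund_sol q \<mu> = (SOME u. u \<in> W11 \<and> u 0 = mat 1 \<and>
     (AE x in unit_leb. theta ** wderiv u x + bold (q x) ** u x = cmult_mat \<mu> (u x)))"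

definition phi_sol :: "(real \<Rightarrow> complex^'r^'r) \<Rightarrow> real \<Rightarrow> complex \<Rightarrow> complex^'r^('r::finite+'r)" where
  "phi_sol q x \<mu> = fund_sol q \<mu> x ** theta ** adj amat"

definition psi_sol :: "(real \<Rightarrow> complex^'r^'r) \<Rightarrow> real \<Rightarrow> complex \<Rightarrow> complex^'r^('r::finite+'r)" where
  "psi_sol q x \<mu> = fund_sol q \<mu> x ** adj amat"

definition s_mat :: "(real \<Rightarrow> complex^'r^'r) \<Rightarrow> complex \<Rightarrow> complex^'r^'r" where
  "s_mat q \<mu> = amat ** phi_sol q 1 \<mu>"

definition c_mat :: "(real \<Rightarrow> complex^'r^'r) \<Rightarrow> complex \<Rightarrow> complex^'r^'r" where
  "c_mat q \<mu> = amat ** psi_sol q 1 \<mu>"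

definition weyl :: "(real \<Rightarrow> complex^'r^'r) \<Rightarrow> complex \<Rightarrow> complex^'r^'r" where
  "weyl q \<mu> = - (matrix_inv (s_mat q \<mu>) ** c_mat q \<mu>)"

definition norming :: "(real \<Rightarrow> complex^'r^'r) \<Rightarrow> int \<Rightarrow> complex^'r^'r" where
  "norming q j =
     - (\<chi> k l. residue (\<lambda>\<mu>. weyl q \<mu> $ k $ l) (complex_of_real (eigval q j)))"

definition spectral_data ::
  "(real \<Rightarrow> complex^'r^'r) \<Rightarrow> int \<Rightarrow> real \<times> (complex^'r^'r)" where
  "spectral_data q j = (eigval q j, norming q j)"

lemma spectral_data_respects: "spectral_data respects Lp_rel p"
proof (rule congruentI)
  fix q q' :: "real \<Rightarrow> complex^'r^'r"
  assume "(q, q') \<in> Lp_rel p"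
  then have ae: "AE x in unit_leb. q x = q' x"
    by (simp add: Lp_rel_def)
  have expr: "AE x in unit_leb. dirac_expr q y x = dirac_expr q' y x" for y
    using ae by eventually_elim (simp add: dirac_expr_def)
  have L2: "f \<in> Lp_fun 2" if f: "AE x in unit_leb. f x = g x" "g \<in> Lp_fun 2"
    for f g :: "real \<Rightarrow> complex^('r::finite+'r)"
  proof -
    have AE: "AE x in unit_leb. g x = f x"
      using f(1) by eventually_elim simp
    have m: "f \<in> borel_measurable unit_leb"
    proof -
      have "(\<lambda>x. if x \<in> {0<..<1} then g x else 0) \<in> borel_measurable lebesgue"
        using f(2) by (subst borel_measurable_if) (auto simp: Lp_fun_def)
      moreover have "AE x in lebesgue. (if x \<in> {0<..<1} then g x else 0) =
          (if x \<in> {0<..<1} then f x else 0)"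
        using AE by (subst (asm) AE_restrict_space_iff) (auto elim: eventually_mono)
      ultimately have "(\<lambda>x. if x \<in> {0<..<1} then f x else 0) \<in> borel_measurable lebesgue"
        by (rule borel_measurable_AE)
      then show ?thesis
        by (subst (asm) borel_measurable_if) auto
    qed
    have "integrable unit_leb (\<lambda>x. norm (f x) powr 2)"
    proof (rule integrable_cong_AE_imp)
      show "integrable unit_leb (\<lambda>x. norm (g x) powr 2)"
        using f(2) by (simp add: Lp_fun_def)
      show "AE x in unit_leb. norm (g x) powr 2 = norm (f x) powr 2"
        using AE by eventually_elim simp
      show "(\<lambda>x. norm (f x) powr 2) \<in> borel_measurable unit_leb"
        using m by measurable
    qed
    with m show ?thesis
      by (simp add: Lp_fun_def)
  qed
  have expr': "AE x in unit_leb. dirac_expr q' y x = dirac_expr q y x" for y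
    using expr[of y] by eventually_elim simp
  have dom: "dirac_dom q = dirac_dom q'"
    using L2[OF expr] L2[OF expr'] by (auto simp: dirac_dom_def)
  have "(AE x in unit_leb. dirac_expr q y x = \<mu> *s y x) \<longleftrightarrow>
        (AE x in unit_leb. dirac_expr q' y x = \<mu> *s y x)" for y \<mu>
    by (rule eventually_subst) (use expr[of y] in eventually_elim, simp)
  then have ev: "eigval q = eigval q'"
    by (simp add: eigval_def eigenvalues_def dom)
  have "(AE x in unit_leb. theta ** wderiv u x + bold (q x) ** u x = cmult_mat \<mu> (u x)) \<longleftrightarrow>
        (AE x in unit_leb. theta ** wderiv u x + bold (q' x) ** u x = cmult_mat \<mu> (u x))"
    for u :: "real \<Rightarrow> complex^('r+'r)^('r+'r)" and \<mu>
    by (rule eventually_subst) (use ae in eventually_elim, simp)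
  then have "fund_sol q = fund_sol q'"
    by (simp add: fund_sol_def fun_eq_iff)
  then have "weyl q = weyl q'"
    by (simp add: weyl_def s_mat_def c_mat_def phi_sol_def psi_sol_def fun_eq_iff)
  with ev show "spectral_data q = spectral_data q'"
    by (simp add: spectral_data_def norming_def fun_eq_iff)
qed

text \<open>The map induced by \<open>spectral_data\<close> on classes modulo equality almost everywhere; the
  image of a class is a singleton by the preceding lemma.\<close>

definition spectral_map ::
  "(real \<Rightarrow> complex^'r^'r) set \<Rightarrow> int \<Rightarrow> real \<times> (complex^'r^'r)" where
  "spectral_map Q = the_elem (spectral_data ` Q)"

definition Ap :: "real \<Rightarrow> (int \<Rightarrow> real \<times> (complex^'r^'r)) set" where
  "Ap p = {spectral_data q | q. q \<in> Lp_fun p}"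

end

theory Submission
  imports Defs
begin

text \<open>Write \<open>U\<close> for the fundamental solution, and \<open>\<phi>\<close> for the solution with \<open>a \<phi>(0) = 0\<close>. Variation of constants, Gronwall's
  inequality and a Riemann--Lebesgue lemma that is uniform in the direction of \<open>\<kappa>\<close> show that \<open>U\<close> differs from
  the free solution by \<open>o(exp (\<bar>Im \<kappa>\<bar> x))\<close> as \<open>\<kappa> \<rightarrow> \<infinity>\<close>. Hence the spectrum is unbounded in both
  directions, and the Weyl function satisfies \<open>m(\<kappa>) = - cot \<kappa> + o(1)\<close> on the boundaries of the squares
  \<open>\<bar>Re \<kappa>\<bar>, \<bar>Im \<kappa>\<bar> \<le> \<pi> n + \<pi>/2\<close>.

  Suppose that two potentials have the same spectral data. The poles of their Weyl functions are simple,
  so the difference of the Weyl functions has only removable singularities; being small on the squares, it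
  vanishes by the maximum principle. The Weyl solution \<open>\<chi> = \<psi> + \<phi> m\<close> decays like
  \<open>exp (- \<bar>Im \<kappa>\<bar> x)\<close> where \<open>\<phi>\<close> grows like \<open>exp (\<bar>Im \<kappa>\<bar> x)\<close>. Expressing the entire
  function \<open>U\<^sub>1(x, \<kappa>) U\<^sub>2(x, \<kappa>)\<^sup>-\<^sup>1\<close> by \<open>\<phi>\<close> and \<open>\<chi>\<close> shows that it is bounded, hence constant
  in \<open>\<kappa>\<close>, and the asymptotics along the real axis identify it as the identity. So \<open>U\<^sub>1 = U\<^sub>2\<close>, and
  the potentials agree almost everywhere.\<close>

section \<open>Integrable functions on the unit interval\<close>

text \<open>Surjectivity is immediate, since \<open>Ap p\<close> is by definition the image of
  \<open>Lp_fun p\<close>; and as \<open>Lp_fun p\<close> lies in \<open>L1\<close> for p at least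
  1, injectivity is a statement about integrable potentials. Integrability is the obstacle that
  shapes the proof: coefficients have no pointwise meaning and asymptotic remainders have no rate.
  So differential equations are read as integral equations (\<open>ac_deriv\<close>), to which the
  weak derivatives of the definitions are translated by the du Bois-Reymond lemma, and every
  estimate works with a bare o(1).

  A second obstacle sits in the definitions of the data. \<open>eigval\<close> is a definite
  description, which says something only once the spectrum is known to be locally finite and
  unbounded in both directions. \<open>norming\<close> is a residue, which fixes the singular part
  of the Weyl function only at a simple pole; simplicity comes from self-adjointness, in the form of
  a pairing identity between two solutions.\<close>

abbreviation L1 :: "(real \<Rightarrow> 'a::euclidean_space) \<Rightarrow> bool" where
  "L1 f \<equiv> f absolutely_integrable_on {0..1}"

lemma L1_continuous: "continuous_on {0..1} f \<Longrightarrow> L1 f"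
  by (rule absolutely_integrable_continuous_real)

lemma L1_measurable: "L1 f \<Longrightarrow> f \<in> borel_measurable (lebesgue_on {0..1})"
  by (rule absolutely_integrable_imp_borel_measurable) auto

lemma L1_integrable: "L1 f \<Longrightarrow> x \<in> {0..1} \<Longrightarrow> f integrable_on {0..x}"
  by (rule set_lebesgue_integral_eq_integral(1)[OF absolutely_integrable_on_subinterval]) auto

lemma L1_norm: "L1 f \<Longrightarrow> L1 (\<lambda>x. norm (f x))"
  using absolutely_integrable_norm[where f = f] by (simp add: o_def)

lemma L1_integrable_01: "L1 f \<Longrightarrow> f integrable_on {0..1}"
  using L1_integrable[of f 1] by simp

lemma L1_norm_diff: "L1 f \<Longrightarrow> L1 g \<Longrightarrow> (\<lambda>x. norm (f x - g x)) integrable_on {0..1}"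
  by (intro L1_integrable_01 L1_norm set_integral_diff(1))

lemma L1_bilinear_left:
  fixes B :: "'a::euclidean_space \<Rightarrow> 'b::euclidean_space \<Rightarrow> 'c::euclidean_space"
  assumes "bounded_bilinear B" "continuous_on {0..1} f" "L1 g"
  shows "L1 (\<lambda>x. B (f x) (g x))"
proof (rule absolutely_integrable_bounded_measurable_product[where h = B])
  show "bilinear B" by (rule bilinear_conv_bounded_bilinear[THEN iffD2, OF assms(1)])
  show "f \<in> borel_measurable (lebesgue_on {0..1})"
    by (rule L1_measurable[OF L1_continuous[OF assms(2)]])
  show "bounded (f ` {0..1})"
    by (rule compact_imp_bounded[OF compact_continuous_image[OF assms(2)]]) simp
qed (use assms in auto)

lemma L1_bilinear_right:
  fixes B :: "'a::euclidean_space \<Rightarrow> 'b::euclidean_space \<Rightarrow> 'c::euclidean_space"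
  assumes "bounded_bilinear B" "continuous_on {0..1} f" "L1 g"
  shows "L1 (\<lambda>x. B (g x) (f x))"
  using L1_bilinear_left[OF bounded_bilinear.flip[OF assms(1)] assms(2,3)] .

lemma L1_linear:
  fixes h :: "'a::euclidean_space \<Rightarrow> 'b::euclidean_space"
  assumes "bounded_linear h" "L1 f"
  shows "L1 (\<lambda>x. h (f x))"
  using absolutely_integrable_linear[OF assms(2,1)] by (simp add: o_def)

lemma L1_integral_bound:
  assumes "L1 f" "L1 g" "x \<in> {0..1}" "\<And>t. t \<in> {0..x} \<Longrightarrow> norm (f t) \<le> g t"
  shows "norm (integral {0..x} f) \<le> integral {0..x} g"
  by (rule integral_norm_bound_integral) (use assms L1_integrable[OF assms(1)] L1_integrable[OF assms(2)] in auto)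

lemma L1_integral_mono_set:
  fixes g :: "real \<Rightarrow> real"
  assumes "L1 g" "\<And>t. 0 \<le> g t" "0 \<le> x" "x \<le> y" "y \<le> 1"
  shows "integral {0..x} g \<le> integral {0..y} g"
  by (rule integral_subset_le) (use assms L1_integrable[OF assms(1)] in auto)

lemma L1_integral_norm_le:
  assumes "L1 f" "x \<in> {0..1}"
  shows "norm (integral {0..x} f) \<le> integral {0..1} (\<lambda>t. norm (f t))"
proof -
  have "norm (integral {0..x} f) \<le> integral {0..x} (\<lambda>t. norm (f t))"
    by (rule L1_integral_bound) (use assms L1_norm in auto)
  also have "\<dots> \<le> integral {0..1} (\<lambda>t. norm (f t))"
    by (rule L1_integral_mono_set) (use assms L1_norm in auto)
  finally show ?thesis .
qed

text \<open>The metric projection \<open>?T n\<close> onto the ball of radius n truncates f without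
  moving 0 or increasing distances, so f is close in mean to a bounded function. Measurability
  supplies continuous functions converging almost everywhere, but without a majorant; truncating
  these at the same radius provides one, so dominated convergence applies twice.\<close>

lemma L1_approx_continuous:
  fixes f :: "real \<Rightarrow> 'a::euclidean_space"
  assumes "L1 f" "e > 0"
  obtains g where "continuous_on UNIV g" "integral {0..1} (\<lambda>x. norm (f x - g x)) < e"
proof -
  let ?T = "\<lambda>n::nat. closest_point (cball (0::'a) (real n))"
  have T0: "?T n 0 = 0" for n by (rule closest_point_self) auto
  have lip: "dist (?T n x) (?T n y) \<le> dist x y" for n x y
    by (rule closest_point_lipschitz) auto
  have Tle: "norm (?T n x) \<le> norm x" for n x using lip[of n x 0] T0 by simp
  have TM: "norm (?T n x) \<le> real n" for n x
    using closest_point_in_set[of "cball (0::'a) (real n)" x] by simp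
  have Tc: "continuous_on S (?T n)" for S n by (rule continuous_on_closest_point) auto
  have Tself: "?T n x = x" if "norm x \<le> real n" for n x
    by (rule closest_point_self) (use that in auto)
  have L1T: "L1 (\<lambda>x. ?T n (f x))" for n
  proof (rule measurable_bounded_by_integrable_imp_absolutely_integrable)
    show "(\<lambda>x. ?T n (f x)) \<in> borel_measurable (lebesgue_on {0..1})"
      using borel_measurable_continuous_on[OF Tc L1_measurable[OF assms(1)]] by simp
    show "(\<lambda>x. norm (f x)) integrable_on {0..1}"
      using L1_integrable[OF L1_norm[OF assms(1)], of 1] by simp
  qed (use Tle in auto)
  have "(\<lambda>n. integral {0..1} (\<lambda>x. norm (f x - ?T n (f x)))) \<longlonglongrightarrow> integral {0..1} (\<lambda>x::real. 0::real)"
  proof (rule dominated_convergence(2))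
    show "(\<lambda>x. norm (f x - ?T n (f x))) integrable_on {0..1}" for n
      by (rule L1_norm_diff[OF assms(1) L1T])
    show "(\<lambda>x. 2 * norm (f x)) integrable_on {0..1}"
      using L1_integrable[OF L1_norm[OF assms(1)], of 1] by (simp add: integrable_on_cmult_left)
    show "norm (norm (f x - ?T n (f x))) \<le> 2 * norm (f x)" for n x
      using norm_triangle_ineq4[of "f x" "?T n (f x)"] Tle[of n "f x"] by simp
    show "(\<lambda>n. norm (f x - ?T n (f x))) \<longlonglongrightarrow> 0" for x
    proof (rule tendsto_eventually)
      have "\<forall>\<^sub>F n in sequentially. norm (f x) \<le> real n"
        by (meson eventually_at_top_linorder nat_ceiling_le_eq)
      then show "\<forall>\<^sub>F n in sequentially. norm (f x - ?T n (f x)) = 0"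
        by eventually_elim (simp add: Tself)
    qed
  qed
  then have "\<forall>\<^sub>F n in sequentially. integral {0..1} (\<lambda>x. norm (f x - ?T n (f x))) < e/2"
    using assms(2) by (intro order_tendstoD(2)) auto
  then obtain M where M: "integral {0..1} (\<lambda>x. norm (f x - ?T M (f x))) < e/2"
    by (auto simp: eventually_sequentially)
  have "f measurable_on {0..1}"
    using L1_measurable[OF assms(1)] by (simp add: measurable_on_iff_borel_measurable)
  then obtain N g where N: "negligible N" "\<And>n. continuous_on UNIV (g n)"
     "\<And>x. x \<notin> N \<Longrightarrow> (\<lambda>n. g n x) \<longlonglongrightarrow> (if x \<in> {0..1} then f x else 0)"
    unfolding measurable_on_def by (metis (full_types))
  have cT: "continuous_on S (\<lambda>x. ?T M (g n x))" for n S
    by (rule continuous_on_compose2[OF Tc[of UNIV] continuous_on_subset[OF N(2)]]) auto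
  have L1gT: "L1 (\<lambda>x. ?T M (g n x))" for n by (rule L1_continuous[OF cT])
  have i0: "integral {0..1} (\<lambda>x. norm (?T M (f x) - ?T M (g n x))) =
            integral {0..1} (\<lambda>x. if x \<in> N then 0 else norm (?T M (f x) - ?T M (g n x)))" for n
    by (rule integral_spike[OF N(1)]) auto
  have "(\<lambda>n. integral {0..1} (\<lambda>x. if x \<in> N then 0 else norm (?T M (f x) - ?T M (g n x))))
     \<longlonglongrightarrow> integral {0..1} (\<lambda>x::real. 0::real)"
  proof (rule dominated_convergence(2))
    show "(\<lambda>x. if x \<in> N then 0 else norm (?T M (f x) - ?T M (g n x))) integrable_on {0..1}" for n
    proof (rule integrable_spike[OF _ N(1)])
      show "(\<lambda>x. norm (?T M (f x) - ?T M (g n x))) integrable_on {0..1}"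
        by (rule L1_norm_diff[OF L1T L1gT])
    qed auto
    show "(\<lambda>x::real. 2 * real M) integrable_on {0..1}" by (rule integrable_const_ivl)
    show "norm (if x \<in> N then 0 else norm (?T M (f x) - ?T M (g n x))) \<le> 2 * real M" for n x
      using norm_triangle_ineq4[of "?T M (f x)" "?T M (g n x)"] TM[of M "f x"] TM[of M "g n x"] by auto
    show "(\<lambda>n. if x \<in> N then 0 else norm (?T M (f x) - ?T M (g n x))) \<longlonglongrightarrow> 0" if "x \<in> {0..1}" for x
    proof (cases "x \<in> N")
      case False
      have "(\<lambda>n. ?T M (g n x)) \<longlonglongrightarrow> ?T M (f x)"
        by (rule continuous_on_tendsto_compose[OF Tc[of UNIV]]) (use N(3)[OF False] that in auto)
      then have "(\<lambda>n. norm (?T M (f x) - ?T M (g n x))) \<longlonglongrightarrow> norm (?T M (f x) - ?T M (f x))"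
        by (intro tendsto_intros)
      with False show ?thesis by simp
    qed simp
  qed
  then have "\<forall>\<^sub>F n in sequentially. integral {0..1} (\<lambda>x. norm (?T M (f x) - ?T M (g n x))) < e/2"
    unfolding i0 using assms(2) by (intro order_tendstoD(2)) auto
  then obtain n where n: "integral {0..1} (\<lambda>x. norm (?T M (f x) - ?T M (g n x))) < e/2"
    by (auto simp: eventually_sequentially)
  have "integral {0..1} (\<lambda>x. norm (f x - ?T M (g n x))) \<le>
        integral {0..1} (\<lambda>x. norm (f x - ?T M (f x)) + norm (?T M (f x) - ?T M (g n x)))"
  proof (rule integral_le)
    show "norm (f x - ?T M (g n x)) \<le> norm (f x - ?T M (f x)) + norm (?T M (f x) - ?T M (g n x))" for x
      using norm_triangle_ineq[of "f x - ?T M (f x)" "?T M (f x) - ?T M (g n x)"] by simp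
  qed (intro integrable_add L1_norm_diff assms(1) L1T L1gT)+
  also have "\<dots> = integral {0..1} (\<lambda>x. norm (f x - ?T M (f x))) +
     integral {0..1} (\<lambda>x. norm (?T M (f x) - ?T M (g n x)))"
    by (intro integral_add L1_norm_diff assms(1) L1T L1gT)
  also have "\<dots> < e" using M n by simp
  finally show ?thesis using that[OF cT] by blast
qed

text \<open>The Riemann-Lebesgue estimate integrates by parts, which calls for an approximant with a
  continuous derivative; a polynomial from the Weierstrass theorem serves.\<close>

lemma L1_approx_C1:
  fixes f :: "real \<Rightarrow> 'a::euclidean_space"
  assumes "L1 f" "e > 0"
  obtains p p' where "\<And>x. (p has_vector_derivative p' x) (at x)" "continuous_on UNIV p'"
     "integral {0..1} (\<lambda>x. norm (f x - p x)) < e"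
proof -
  obtain g where g: "continuous_on UNIV g" "integral {0..1} (\<lambda>x. norm (f x - g x)) < e/2"
    using L1_approx_continuous[OF assms(1), of "e/2"] assms(2) by auto
  obtain p where p: "polynomial_function p" "\<And>x. x \<in> {0..1} \<Longrightarrow> norm (g x - p x) < e/2"
    using Stone_Weierstrass_polynomial_function[of "{0..1}" g "e/2"]
      continuous_on_subset[OF g(1), of "{0..1}"] assms(2) by auto
  obtain p' where p': "polynomial_function p'" "\<And>x. (p has_vector_derivative p' x) (at x)"
    using has_vector_derivative_polynomial_function[OF p(1)] by metis
  have L: "L1 g" "L1 p"
    using continuous_on_subset[OF g(1)] continuous_on_polymonial_function[OF p(1)]
    by (auto intro!: L1_continuous)
  have "integral {0..1} (\<lambda>x. norm (f x - p x)) \<le> integral {0..1} (\<lambda>x. norm (f x - g x) + e/2)"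
  proof (rule integral_le)
    show "norm (f x - p x) \<le> norm (f x - g x) + e/2" if "x \<in> {0..1}" for x
      using norm_triangle_ineq[of "f x - g x" "g x - p x"] p(2)[OF that] by simp
  qed (intro integrable_add L1_norm_diff assms(1) L integrable_const_ivl)+
  also have "\<dots> = integral {0..1} (\<lambda>x. norm (f x - g x)) + integral {0..1} (\<lambda>x::real. e/2)"
    by (intro integral_add L1_norm_diff assms(1) L integrable_const_ivl)
  also have "\<dots> < e" using g(2) by simp
  finally show ?thesis by (rule that[OF p'(2) continuous_on_polymonial_function[OF p'(1)]])
qed

text \<open>All integrals of \<open>f\<close> over subintervals vanish, so Henstock's lemma bounds the Riemann sums of
  \<open>norm (f x)\<close>.\<close>

lemma L1_zero_integrals:
  fixes f :: "real \<Rightarrow> 'a::euclidean_space"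
  assumes "L1 f" "\<And>x. x \<in> {0..1} \<Longrightarrow> integral {0..x} f = 0"
  shows "negligible {x \<in> {0..1}. f x \<noteq> 0}"
proof -
  have int: "f integrable_on {0..1}" using L1_integrable[OF assms(1), of 1] by simp
  have z: "integral {a..b} f = 0" if "0 \<le> a" "a \<le> b" "b \<le> 1" for a b
  proof -
    have "f integrable_on {0..b}" by (rule L1_integrable[OF assms(1)]) (use that in simp)
    then have "integral {0..a} f + integral {a..b} f = integral {0..b} f"
      by (rule Henstock_Kurzweil_Integration.integral_combine[OF that(1,2)])
    then show ?thesis using assms(2)[of a] assms(2)[of b] that by simp
  qed
  have "((\<lambda>x. norm (f x)) has_integral 0) (cbox 0 1)"
    unfolding has_integral
  proof (intro allI impI)
    fix e :: real assume e: "e > 0"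
    obtain \<gamma> where \<gamma>: "gauge \<gamma>" "\<And>p. \<lbrakk>p tagged_partial_division_of (cbox 0 1); \<gamma> fine p\<rbrakk> \<Longrightarrow>
             sum (\<lambda>(x,k). norm(Henstock_Kurzweil_Integration.content k *\<^sub>R f x - integral k f)) p < e"
      using Henstock_lemma[of f 0 1 e] int e by (auto simp: box_real)
    have "norm ((\<Sum>(x, k)\<in>\<D>. Henstock_Kurzweil_Integration.content k *\<^sub>R norm (f x)) - 0) < e"
      if D: "\<D> tagged_division_of cbox 0 1" "\<gamma> fine \<D>" for \<D>
    proof -
      have "(\<Sum>(x, k)\<in>\<D>. Henstock_Kurzweil_Integration.content k *\<^sub>R norm (f x)) = sum (\<lambda>(x,k). norm(Henstock_Kurzweil_Integration.content k *\<^sub>R f x - integral k f)) \<D>"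
      proof (rule sum.cong, goal_cases)
        case (2 y)
        then obtain x K where y: "y = (x,K)" "(x,K) \<in> \<D>" by (cases y) auto
        obtain a b where ab: "K = cbox a b" "K \<subseteq> cbox 0 1" "K \<noteq> {}"
          using tagged_division_ofD(2-4)[OF D(1) y(2)] by blast
        then have "integral K f = 0" using z[of a b] by (auto simp: box_real)
        then show ?case by (simp add: y(1))
      qed simp
      also have "\<dots> < e"
        by (rule \<gamma>(2)) (use D in \<open>auto simp: tagged_division_of_def\<close>)
      moreover have "0 \<le> (\<Sum>(x, k)\<in>\<D>. Henstock_Kurzweil_Integration.content k *\<^sub>R norm (f x))" by (auto intro!: sum_nonneg)
      ultimately show ?thesis by simp
    qed
    then show "\<exists>\<gamma>. gauge \<gamma> \<and> (\<forall>\<D>. \<D> tagged_division_of cbox 0 1 \<and> \<gamma> fine \<D> \<longrightarrow>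
        norm ((\<Sum>(x, k)\<in>\<D>. Henstock_Kurzweil_Integration.content k *\<^sub>R norm (f x)) - 0) < e)"
      by (intro exI[of _ \<gamma>] conjI \<gamma>(1) allI impI) auto
  qed
  then have "((\<lambda>x. norm (f x)) has_integral 0) {0..1}" by (simp add: box_real)
  then have "integral\<^sup>L (lebesgue_on {0..1}) (\<lambda>x. norm (f x)) = 0"
    using lebesgue_integral_eq_integral[of "{0..1}" "\<lambda>x. norm (f x)"] L1_norm[OF assms(1)]
    by (simp add: integral_unique set_integrable_def integrable_restrict_space)
  then have "AE x in lebesgue_on {0..1}. norm (f x) = 0"
    using L1_norm[OF assms(1)]
    by (subst (asm) integral_nonneg_eq_0_iff_AE) (auto simp: set_integrable_def integrable_restrict_space)
  then have "AE x in lebesgue. x \<in> {0..1} \<longrightarrow> f x = 0"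
    by (subst (asm) AE_restrict_space_iff) auto
  then have "{x. \<not> (x \<in> {0..1} \<longrightarrow> f x = 0)} \<in> null_sets lebesgue"
    by (simp add: completion.AE_iff_null_sets)
  moreover have "{x. \<not> (x \<in> {0..1} \<longrightarrow> f x = 0)} = {x \<in> {0..1}. f x \<noteq> 0}" by auto
  ultimately show ?thesis by (simp only: negligible_iff_null_sets)
qed

section \<open>Primitives of integrable functions\<close>

text \<open>Absolute continuity in integrated form. The density is a separate argument because it is
  determined only up to null sets.\<close>

definition ac_deriv :: "(real \<Rightarrow> 'a::euclidean_space) \<Rightarrow> (real \<Rightarrow> 'a) \<Rightarrow> bool" where
  "ac_deriv f g \<longleftrightarrow> L1 g \<and> (\<forall>x\<in>{0..1}. f x = f 0 + integral {0..x} g)"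

lemma ac_derivI:
  assumes "L1 g" "\<And>x. x \<in> {0..1} \<Longrightarrow> f x = f 0 + integral {0..x} g"
  shows "ac_deriv f g"
  unfolding ac_deriv_def by (intro conjI ballI assms)

lemma ac_deriv_L1: "ac_deriv f g \<Longrightarrow> L1 g"
  unfolding ac_deriv_def by (rule conjunct1)

lemma ac_deriv_eq: "ac_deriv f g \<Longrightarrow> x \<in> {0..1} \<Longrightarrow> f x = f 0 + integral {0..x} g"
  unfolding ac_deriv_def by (rule bspec[OF conjunct2])

lemma ac_deriv_continuous:
  assumes "ac_deriv f g" shows "continuous_on {0..1} f"
proof -
  have "continuous_on {0..1} (\<lambda>x. f 0 + integral {0..x} g)"
    by (intro continuous_intros indefinite_integral_continuous_1 L1_integrable_01 ac_deriv_L1[OF assms])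
  then show ?thesis
    by (rule continuous_on_eq) (rule ac_deriv_eq[OF assms, symmetric])
qed

lemma ac_deriv_primitive: "L1 g \<Longrightarrow> ac_deriv (\<lambda>x. c + integral {0..x} g) g"
  by (auto simp: ac_deriv_def)

lemma ac_deriv_cong:
  assumes "ac_deriv f g" "\<And>x. x \<in> {0..1} \<Longrightarrow> f x = f' x" "\<And>x. x \<in> {0..1} \<Longrightarrow> g x = g' x"
  shows "ac_deriv f' g'"
proof (rule ac_derivI)
  show "L1 g'" using ac_deriv_L1[OF assms(1)] assms(3)
    by (metis Diff_iff absolutely_integrable_spike negligible_empty)
  show "f' x = f' 0 + integral {0..x} g'" if "x \<in> {0..1}" for x
  proof -
    have "integral {0..x} g = integral {0..x} g'"
      by (rule integral_cong) (use assms(3) that in auto)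
    then show ?thesis using ac_deriv_eq[OF assms(1) that] assms(2)[OF that] assms(2)[of 0] by simp
  qed
qed

lemma ac_deriv_spike:
  assumes "ac_deriv f g" "negligible N" "\<And>x. x \<in> {0..1} - N \<Longrightarrow> g' x = g x"
  shows "ac_deriv f g'"
proof (rule ac_derivI)
  show "L1 g'" by (rule absolutely_integrable_spike[OF ac_deriv_L1[OF assms(1)] assms(2,3)])
  show "f x = f 0 + integral {0..x} g'" if "x \<in> {0..1}" for x
  proof -
    have "integral {0..x} g' = integral {0..x} g"
      by (rule integral_spike[OF assms(2)]) (use assms(3) that in force)
    then show ?thesis using ac_deriv_eq[OF assms(1) that] by simp
  qed
qed

lemma ac_deriv_add:
  assumes "ac_deriv f g" "ac_deriv f' g'"
  shows "ac_deriv (\<lambda>x. f x + f' x) (\<lambda>x. g x + g' x)"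
proof (rule ac_derivI)
  show "L1 (\<lambda>x. g x + g' x)" using assms by (intro set_integral_add(1) ac_deriv_L1)
  show "f x + f' x = f 0 + f' 0 + integral {0..x} (\<lambda>x. g x + g' x)" if "x \<in> {0..1}" for x
    using that assms[THEN ac_deriv_eq, OF that] assms[THEN ac_deriv_L1, THEN L1_integrable, OF that]
    by (simp add: integral_add)
qed

lemma ac_deriv_linear:
  fixes h :: "'a::euclidean_space \<Rightarrow> 'b::euclidean_space"
  assumes "bounded_linear h" "ac_deriv f g"
  shows "ac_deriv (\<lambda>x. h (f x)) (\<lambda>x. h (g x))"
proof (rule ac_derivI)
  show "L1 (\<lambda>x. h (g x))" by (rule L1_linear[OF assms(1) ac_deriv_L1[OF assms(2)]])
  show "h (f x) = h (f 0) + integral {0..x} (\<lambda>x. h (g x))" if "x \<in> {0..1}" for x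
  proof -
    have "integral {0..x} (h \<circ> g) = h (integral {0..x} g)"
      by (rule integral_linear[OF L1_integrable[OF ac_deriv_L1[OF assms(2)] that] assms(1)])
    then have e: "integral {0..x} (\<lambda>x. h (g x)) = h (integral {0..x} g)" by (simp add: o_def)
    show ?thesis
      unfolding e by (subst ac_deriv_eq[OF assms(2) that]) (rule linear_add[OF bounded_linear.linear[OF assms(1)]])
  qed
qed

lemma ac_deriv_diff:
  assumes "ac_deriv f g" "ac_deriv f' g'"
  shows "ac_deriv (\<lambda>x. f x - f' x) (\<lambda>x. g x - g' x)"
  using ac_deriv_add[OF assms(1) ac_deriv_linear[OF bounded_linear_minus[OF bounded_linear_ident] assms(2)]]
  by simp

lemma ac_deriv_const: "ac_deriv (\<lambda>x. c) (\<lambda>x. 0)"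
  by (rule ac_derivI) auto

lemma ac_deriv_C1:
  assumes "\<And>x. x \<in> {0..1} \<Longrightarrow> (f has_vector_derivative g x) (at x within {0..1})" "continuous_on {0..1} g"
  shows "ac_deriv f g"
proof (rule ac_derivI)
  show "L1 g" by (rule L1_continuous[OF assms(2)])
  show "f x = f 0 + integral {0..x} g" if "x \<in> {0..1}" for x
  proof -
    have "(g has_integral (f x - f 0)) {0..x}"
      by (rule fundamental_theorem_of_calculus)
         (use that in \<open>auto intro!: has_vector_derivative_within_subset[OF assms(1)]\<close>)
    then show ?thesis by (simp add: integral_unique)
  qed
qed

text \<open>Serves twice: to identify the arbitrarily chosen \<open>wderiv\<close> with the
  right-hand side of an equation, and at the very end to read the potential off a solution shared by
  two systems.\<close>

lemma ac_deriv_AE_unique: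
  assumes "ac_deriv f g" "ac_deriv f g'"
  shows "negligible {x \<in> {0..1}. g x \<noteq> g' x}"
proof -
  have d: "ac_deriv (\<lambda>x. f x - f x) (\<lambda>x. g x - g' x)" by (rule ac_deriv_diff[OF assms])
  have "negligible {x \<in> {0..1}. g x - g' x \<noteq> 0}"
    by (rule L1_zero_integrals[OF ac_deriv_L1[OF d]]) (drule ac_deriv_eq[OF d], simp)
  then show ?thesis by simp
qed

section \<open>Reflection of the unit interval\<close>

lemma has_integral_reflect_unit:
  fixes f :: "real \<Rightarrow> 'a::banach"
  assumes "(f has_integral i) {a..b}"
  shows "((\<lambda>x. f (1 - x)) has_integral i) {1 - b..1 - a}"
proof -
  have *: "(\<lambda>x::real. 1 - x) ` {a..b} = {1 - b..1 - a}" by (rule image_diff_atLeastAtMost)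
  show ?thesis
    using has_integral_affinity[of f i a b "-1" 1] assms by (simp add: box_real *)
qed

lemma L1_reflect:
  assumes "L1 f" shows "L1 (\<lambda>x. f (1 - x))"
proof -
  have "f integrable_on {0..1}" "(\<lambda>x. norm (f x)) integrable_on {0..1}"
    using assms by (auto simp: L1_integrable_01 L1_norm)
  then show ?thesis
    using has_integral_reflect_unit[of f _ 0 1] has_integral_reflect_unit[of "\<lambda>x. norm (f x)" _ 0 1]
    unfolding absolutely_integrable_on_def integrable_on_def by auto
qed

text \<open>Estimates for initial value problems run from 0 to the right; the reflection lets them
  start at 1, where the Weyl solution satisfies its boundary condition.\<close>

lemma ac_deriv_reflect:
  assumes "ac_deriv f g"
  shows "ac_deriv (\<lambda>x. f (1 - x)) (\<lambda>x. - g (1 - x))"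
proof (rule ac_derivI)
  show "L1 (\<lambda>x. - g (1 - x))"
    by (intro L1_linear[OF bounded_linear_minus[OF bounded_linear_ident]] L1_reflect ac_deriv_L1[OF assms])
  show "f (1 - x) = f (1 - 0) + integral {0..x} (\<lambda>x. - g (1 - x))" if x: "x \<in> {0..1}" for x
  proof -
    have i1: "g integrable_on {0..1}" by (rule L1_integrable_01[OF ac_deriv_L1[OF assms]])
    then have i: "g integrable_on {1 - x..1}" by (rule integrable_on_subinterval) (use x in auto)
    have "((\<lambda>x. g (1 - x)) has_integral integral {1 - x..1} g) {1 - 1..1 - (1 - x)}"
      by (rule has_integral_reflect_unit[OF integrable_integral[OF i]])
    then have "integral {0..x} (\<lambda>x. g (1 - x)) = integral {1 - x..1} g" by (simp add: integral_unique)
    moreover have "integral {0..1 - x} g + integral {1 - x..1} g = integral {0..1} g"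
      by (rule Henstock_Kurzweil_Integration.integral_combine[OF _ _ i1]) (use x in auto)
    ultimately show ?thesis
      using ac_deriv_eq[OF assms, of 1] ac_deriv_eq[OF assms, of "1 - x"] x
      by (simp add: algebra_simps)
  qed
qed

text \<open>The product rule is classical for continuous densities; both sides depend continuously on the
  density in \<open>L\<^sub>1\<close>, so it can be extended to integrable densities one factor at a time.\<close>

lemma integral_product_density:
  fixes B :: "'a::euclidean_space \<Rightarrow> 'b::euclidean_space \<Rightarrow> 'c::euclidean_space"
  assumes B: "bounded_bilinear B" and H: "ac_deriv H h" and f: "L1 f" and x: "x \<in> {0..1}"
    and cont: "\<And>g. continuous_on UNIV g \<Longrightarrow> B (integral {0..x} g) (H x) =
           integral {0..x} (\<lambda>t. B (integral {0..t} g) (h t) + B (g t) (H t))"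
  shows "B (integral {0..x} f) (H x) = integral {0..x} (\<lambda>t. B (integral {0..t} f) (h t) + B (f t) (H t))"
proof -
  interpret B: bounded_bilinear B by (rule B)
  let ?T = "\<lambda>f. B (integral {0..x} f) (H x) - integral {0..x} (\<lambda>t. B (integral {0..t} f) (h t) + B (f t) (H t))"
  obtain K where K: "K > 0" "\<And>a b. norm (B a b) \<le> norm a * norm b * K" using B.pos_bounded by blast
  have "bounded (H ` {0..1})"
    by (rule compact_imp_bounded[OF compact_continuous_image[OF ac_deriv_continuous[OF H]]]) simp
  then obtain M where M: "M > 0" "\<And>t. t \<in> {0..1} \<Longrightarrow> norm (H t) \<le> M"
    unfolding bounded_pos by auto
  have h: "L1 h" by (rule ac_deriv_L1[OF H])
  have Hc: "continuous_on {0..1} H" by (rule ac_deriv_continuous[OF H])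
  \<comment> \<open>The summands come from the boundary term, from h against the primitive of f, and
    from f against the bounded H. They show that \<open>?T\<close> is bounded in mean norm; it
    vanishes on continuous densities, which are dense.\<close>
  define C where "C = K * M + K * integral {0..1} (\<lambda>t. norm (h t)) + K * M"
  have prim: "continuous_on {0..1} (\<lambda>x. integral {0..x} f)" if "L1 f" for f :: "real \<Rightarrow> 'a"
    by (rule indefinite_integral_continuous_1[OF L1_integrable_01[OF that]])
  have L1s: "L1 (\<lambda>t. B (integral {0..t} f) (h t) + B (f t) (H t))" if "L1 f" for f
    by (intro set_integral_add(1) L1_bilinear_left[OF B prim h] L1_bilinear_right[OF B Hc] that)
  have bound: "norm (?T f) \<le> C * integral {0..1} (\<lambda>t. norm (f t))" if f: "L1 f" for f
  proof -
    let ?n = "integral {0..1} (\<lambda>t. norm (f t))"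
    have n0: "0 \<le> ?n" by (rule integral_nonneg[OF L1_integrable_01[OF L1_norm[OF f]]]) simp
    have 1: "norm (B (integral {0..x} f) (H x)) \<le> ?n * M * K"
      by (rule order_trans[OF K(2)])
         (use L1_integral_norm_le[OF f x] M(2)[OF x] n0 K(1) M(1) in \<open>auto intro!: mult_mono\<close>)
    have "norm (integral {0..x} (\<lambda>t. B (integral {0..t} f) (h t) + B (f t) (H t))) \<le>
       integral {0..x} (\<lambda>t. (?n * K) * norm (h t) + (M * K) * norm (f t))"
    proof (rule L1_integral_bound[OF L1s[OF f] _ x])
      show "L1 (\<lambda>t. (?n * K) * norm (h t) + (M * K) * norm (f t))"
        by (intro set_integral_add(1) L1_linear[OF bounded_linear_mult_right] L1_norm f h)
      show "norm (B (integral {0..t} f) (h t) + B (f t) (H t)) \<le> (?n * K) * norm (h t) + (M * K) * norm (f t)"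
        if t: "t \<in> {0..x}" for t
      proof -
        have t': "t \<in> {0..1}" using t x by auto
        have "norm (B (integral {0..t} f) (h t)) \<le> ?n * norm (h t) * K"
          by (rule order_trans[OF K(2)])
             (use L1_integral_norm_le[OF f t'] n0 K(1) in \<open>auto intro!: mult_mono\<close>)
        moreover have "norm (B (f t) (H t)) \<le> norm (f t) * M * K"
          by (rule order_trans[OF K(2)])
             (use M(2)[OF t'] M(1) n0 K(1) in \<open>auto intro!: mult_mono\<close>)
        ultimately show ?thesis
          using norm_triangle_ineq[of "B (integral {0..t} f) (h t)" "B (f t) (H t)"] by (simp add: mult_ac)
      qed
    qed
    also have "\<dots> \<le> integral {0..1} (\<lambda>t. (?n * K) * norm (h t) + (M * K) * norm (f t))"
    proof (rule L1_integral_mono_set)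
      show "L1 (\<lambda>t. (?n * K) * norm (h t) + (M * K) * norm (f t))"
        by (intro set_integral_add(1) L1_linear[OF bounded_linear_mult_right] L1_norm f h)
    qed (use x n0 K(1) M(1) in auto)
    also have "\<dots> = (?n * K) * integral {0..1} (\<lambda>t. norm (h t)) + (M * K) * ?n"
      using integral_add[OF L1_integrable_01[OF L1_linear[OF bounded_linear_mult_right L1_norm[OF h]]]
          L1_integrable_01[OF L1_linear[OF bounded_linear_mult_right L1_norm[OF f]]]]
      by simp
    finally show ?thesis
      using 1 norm_triangle_ineq4[of "B (integral {0..x} f) (H x)" "integral {0..x} (\<lambda>t. B (integral {0..t} f) (h t) + B (f t) (H t))"]
      by (simp add: C_def algebra_simps)
  qed
  have Tdiff: "?T (\<lambda>t. f t - g t) = ?T f - ?T g" if f: "L1 f" and g: "L1 g" for f g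
  proof -
    have i: "integral {0..t} (\<lambda>t. f t - g t) = integral {0..t} f - integral {0..t} g" if "t \<in> {0..1}" for t
      by (rule integral_diff[OF L1_integrable[OF f that] L1_integrable[OF g that]])
    have "integral {0..x} (\<lambda>t. B (integral {0..t} (\<lambda>t. f t - g t)) (h t) + B (f t - g t) (H t)) =
          integral {0..x} (\<lambda>t. (B (integral {0..t} f) (h t) + B (f t) (H t)) - (B (integral {0..t} g) (h t) + B (g t) (H t)))"
      by (rule integral_cong) (use i x in \<open>auto simp: B.diff_left\<close>)
    also have "\<dots> = integral {0..x} (\<lambda>t. B (integral {0..t} f) (h t) + B (f t) (H t)) -
       integral {0..x} (\<lambda>t. B (integral {0..t} g) (h t) + B (g t) (H t))"
      by (rule integral_diff) (use L1_integrable[OF L1s x] f g in auto)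
    finally show ?thesis using i[OF x] by (simp add: B.diff_left)
  qed
  have C0: "C \<ge> 0"
    unfolding C_def using K(1) M(1) integral_nonneg[OF L1_integrable_01[OF L1_norm[OF h]]] by simp
  have "norm (?T f) \<le> e" if e: "e > 0" for e
  proof -
    obtain g where g: "continuous_on UNIV g" "integral {0..1} (\<lambda>x. norm (f x - g x)) < e / (C + 1)"
      using L1_approx_continuous[OF f, of "e / (C + 1)"] e C0 by auto
    have Lg: "L1 g" by (rule L1_continuous[OF continuous_on_subset[OF g(1)]]) simp
    have Tg: "?T g = 0" using cont[OF g(1)] by simp
    have "norm (?T f) = norm (?T (\<lambda>t. f t - g t))" unfolding Tdiff[OF f Lg] Tg by simp
    also have "\<dots> \<le> C * integral {0..1} (\<lambda>t. norm (f t - g t))"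
      by (rule bound[OF set_integral_diff(1)[OF f Lg]])
    also have "\<dots> \<le> C * (e / (C + 1))" by (rule mult_left_mono) (use g(2) C0 in auto)
    also have "\<dots> \<le> e" using C0 e by (simp add: field_simps)
    finally show ?thesis .
  qed
  then have "norm (?T f) \<le> 0" by (rule field_le_epsilon) simp
  then show ?thesis by simp
qed

lemma has_vector_derivative_integral_UNIV:
  fixes g :: "real \<Rightarrow> 'a::banach"
  assumes "continuous_on UNIV g" "x \<in> {0..1}"
  shows "((\<lambda>x. integral {0..x} g) has_vector_derivative g x) (at x within {0..1})"
  by (intro integral_has_vector_derivative continuous_on_subset[OF assms(1)] assms(2)) simp

lemma ac_deriv_bilinear:
  fixes B :: "'a::euclidean_space \<Rightarrow> 'b::euclidean_space \<Rightarrow> 'c::euclidean_space"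
  assumes B: "bounded_bilinear B" and F: "ac_deriv F f" and H: "ac_deriv H h"
  shows "ac_deriv (\<lambda>x. B (F x) (H x)) (\<lambda>x. B (F x) (h x) + B (f x) (H x))"
proof -
  interpret B: bounded_bilinear B by (rule B)
  have f: "L1 f" and h: "L1 h" using F H by (auto dest: ac_deriv_L1)
  have cc: "B (integral {0..x} f') (integral {0..x} h') =
      integral {0..x} (\<lambda>t. B (integral {0..t} f') (h' t) + B (f' t) (integral {0..t} h'))"
    if fh: "continuous_on UNIV f'" "continuous_on UNIV h'" and x: "x \<in> {0..1}" for f' h' and x :: real
  proof -
    have c: "continuous_on {0..1} f'" "continuous_on {0..1} h'"
      by (rule continuous_on_subset[OF fh(1)], simp, rule continuous_on_subset[OF fh(2)], simp)
    have "ac_deriv (\<lambda>x. B (integral {0..x} f') (integral {0..x} h'))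
      (\<lambda>t. B (integral {0..t} f') (h' t) + B (f' t) (integral {0..t} h'))"
    proof (rule ac_deriv_C1)
      fix x :: real assume "x \<in> {0..1}"
      then show "((\<lambda>x. B (integral {0..x} f') (integral {0..x} h')) has_vector_derivative
          B (integral {0..x} f') (h' x) + B (f' x) (integral {0..x} h')) (at x within {0..1})"
        by (intro B.has_vector_derivative has_vector_derivative_integral_UNIV fh)
    next
      show "continuous_on {0..1} (\<lambda>t. B (integral {0..t} f') (h' t) + B (f' t) (integral {0..t} h'))"
        by (intro continuous_intros B.continuous_on indefinite_integral_continuous_1 L1_integrable_01 L1_continuous c)
    qed
    from ac_deriv_eq[OF this x] show ?thesis by (simp add: B.zero_left)
  qed
  have prim0: "ac_deriv (\<lambda>x. integral {0..x} g) g" if "L1 g" for g :: "real \<Rightarrow> 'd::euclidean_space"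
    using ac_deriv_primitive[OF that, of 0] by simp
  have fc: "B (integral {0..x} f) (integral {0..x} h') =
      integral {0..x} (\<lambda>t. B (integral {0..t} f) (h' t) + B (f t) (integral {0..t} h'))"
    if h': "continuous_on UNIV h'" and x: "x \<in> {0..1}" for h' and x :: real
  proof (rule integral_product_density[OF B prim0 f x])
    show "L1 h'" by (rule L1_continuous[OF continuous_on_subset[OF h']]) simp
  qed (rule cc[OF _ h' x])
  \<comment> \<open>Swapping the arguments of B lets the same density lemma extend the second
    factor.\<close>
  have main: "B (integral {0..x} f) (integral {0..x} h) =
      integral {0..x} (\<lambda>t. B (integral {0..t} f) (h t) + B (f t) (integral {0..t} h))"
    if x: "x \<in> {0..1}" for x
    using integral_product_density[OF bounded_bilinear.flip[OF B] prim0[OF f] h x] fc x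
    by (simp add: add.commute)
  \<comment> \<open>So far the primitives vanish at 0; with initial values the product expands into
    the four terms treated in 1 to 4.\<close>
  have 1: "ac_deriv (\<lambda>x. B (integral {0..x} f) (integral {0..x} h))
      (\<lambda>t. B (integral {0..t} f) (h t) + B (f t) (integral {0..t} h))"
  proof (rule ac_derivI)
    show "L1 (\<lambda>t. B (integral {0..t} f) (h t) + B (f t) (integral {0..t} h))"
      by (intro set_integral_add(1) L1_bilinear_left[OF B] L1_bilinear_right[OF B]
          indefinite_integral_continuous_1 L1_integrable_01 f h)
  qed (use main in \<open>simp add: B.zero_left\<close>)
  have 2: "ac_deriv (\<lambda>x. B (F 0) (integral {0..x} h)) (\<lambda>x. B (F 0) (h x))"
    by (rule ac_deriv_linear[OF B.bounded_linear_right prim0[OF h]])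
  have 3: "ac_deriv (\<lambda>x. B (integral {0..x} f) (H 0)) (\<lambda>x. B (f x) (H 0))"
    by (rule ac_deriv_linear[OF B.bounded_linear_left prim0[OF f]])
  have 4: "ac_deriv (\<lambda>x. B (F 0) (H 0)) (\<lambda>x. 0)" by (rule ac_deriv_const)
  show ?thesis
  proof (rule ac_deriv_cong[OF ac_deriv_add[OF ac_deriv_add[OF 1 2] ac_deriv_add[OF 3 4]]])
    fix x :: real assume x: "x \<in> {0..1}"
    show "B (integral {0..x} f) (integral {0..x} h) + B (F 0) (integral {0..x} h) +
         (B (integral {0..x} f) (H 0) + B (F 0) (H 0)) = B (F x) (H x)"
      unfolding ac_deriv_eq[OF F x] ac_deriv_eq[OF H x]
      by (simp add: B.add_left B.add_right algebra_simps)
    show "B (integral {0..x} f) (h x) + B (f x) (integral {0..x} h) + B (F 0) (h x) +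
         (B (f x) (H 0) + 0) = B (F x) (h x) + B (f x) (H x)"
      unfolding ac_deriv_eq[OF F x] ac_deriv_eq[OF H x]
      by (simp add: B.add_left B.add_right algebra_simps)
  qed
qed

text \<open>The terms of the exponential series arise from one another by integration against k.
  They bound both the Picard iterates and the iterated Gronwall inequality.\<close>

lemma ac_deriv_power:
  fixes K :: "real \<Rightarrow> real"
  assumes K: "ac_deriv K k"
  shows "ac_deriv (\<lambda>x. K x ^ Suc n / fact (Suc n)) (\<lambda>x. k x * (K x ^ n / fact n))"
proof (induction n)
  case 0
  then show ?case using K by simp
next
  case (Suc n)
  let ?p = "\<lambda>x. K x ^ n / fact n"
  have f1: "K x ^ Suc m / fact (Suc m) = K x * (K x ^ m / fact m) / real (Suc m)" for x m
    by (simp add: field_simps)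
  have "ac_deriv (\<lambda>x. K x * (K x ^ Suc n / fact (Suc n)))
     (\<lambda>x. K x * (k x * ?p x) + k x * (K x ^ Suc n / fact (Suc n)))"
    by (rule ac_deriv_bilinear[OF bounded_bilinear_mult K Suc])
  from ac_deriv_linear[OF bounded_linear_mult_right[of "1 / real (Suc (Suc n))"] this]
  show ?case
  proof (rule ac_deriv_cong)
    show "1 / real (Suc (Suc n)) * (K x * (K x ^ Suc n / fact (Suc n))) = K x ^ Suc (Suc n) / fact (Suc (Suc n))" for x
      by (simp only: f1[of x "Suc n"]) simp
    have "K x * (k x * ?p x) + k x * (K x * ?p x / real (Suc n)) =
      real (Suc (Suc n)) * (k x * (K x * ?p x / real (Suc n)))" for x
      by (simp add: divide_simps) (simp add: algebra_simps)
    then show "1 / real (Suc (Suc n)) * (K x * (k x * ?p x) + k x * (K x ^ Suc n / fact (Suc n))) =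
        k x * (K x ^ Suc n / fact (Suc n))" for x
      unfolding f1 by simp
  qed
qed

text \<open>Inserting the inequality into itself n times produces a partial sum of the exponential
  series and a remainder \<open>M * (?K x ^ n / fact n)\<close>, where M bounds w; the remainder
  tends to 0. This suits a kernel k that is merely integrable.\<close>

lemma gronwall:
  fixes w k :: "real \<Rightarrow> real"
  assumes w: "continuous_on {0..1} w" and k: "L1 k" "\<And>t. 0 \<le> k t" and c: "0 \<le> c"
    and le: "\<And>x. x \<in> {0..1} \<Longrightarrow> w x \<le> c + integral {0..x} (\<lambda>t. k t * w t)"
    and x: "x \<in> {0..1}"
  shows "w x \<le> c * exp (integral {0..x} k)"
proof -
  let ?K = "\<lambda>x. integral {0..x} k"
  have K: "ac_deriv ?K k" using ac_deriv_primitive[OF k(1), of 0] by simp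
  have "bounded (w ` {0..1})"
    by (rule compact_imp_bounded[OF compact_continuous_image[OF w]]) simp
  then obtain M where M: "M > 0" "\<And>t. t \<in> {0..1} \<Longrightarrow> norm (w t) \<le> M"
    unfolding bounded_pos by auto
  have b: "w x \<le> c * (\<Sum>j<n. ?K x ^ j / fact j) + M * (?K x ^ n / fact n)" if "x \<in> {0..1}" for n x
    using that
  proof (induction n arbitrary: x)
    case 0
    then show ?case using M(2)[OF 0] by (simp add: abs_le_iff)
  next
    case (Suc n)
    let ?g = "\<lambda>t. (\<Sum>j<n. c * (k t * (?K t ^ j / fact j))) + M * (k t * (?K t ^ n / fact n))"
    have ac: "ac_deriv (\<lambda>x. (\<Sum>j<m. c * (?K x ^ Suc j / fact (Suc j)))) (\<lambda>t. (\<Sum>j<m. c * (k t * (?K t ^ j / fact j))))" for m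
    proof (induction m)
      case (Suc m)
      show ?case
        using ac_deriv_add[OF Suc ac_deriv_linear[OF bounded_linear_mult_right ac_deriv_power[OF K]]] by simp
    qed (simp add: ac_deriv_const)
    have ac2: "ac_deriv (\<lambda>x. (\<Sum>j<n. c * (?K x ^ Suc j / fact (Suc j))) + M * (?K x ^ Suc n / fact (Suc n))) ?g"
      by (rule ac_deriv_add[OF ac ac_deriv_linear[OF bounded_linear_mult_right ac_deriv_power[OF K]]])
    have "integral {0..x} (\<lambda>t. k t * w t) \<le> integral {0..x} ?g"
    proof (rule integral_le)
      show "(\<lambda>t. k t * w t) integrable_on {0..x}"
        by (rule L1_integrable[OF L1_bilinear_right[OF bounded_bilinear_mult w k(1)] Suc.prems])
      show "?g integrable_on {0..x}" by (rule L1_integrable[OF ac_deriv_L1[OF ac2] Suc.prems])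
      fix t assume "t \<in> {0..x}"
      then have "t \<in> {0..1}" using Suc.prems by auto
      from mult_left_mono[OF Suc.IH[OF this] k(2)[of t]]
      show "k t * w t \<le> ?g t" by (simp add: algebra_simps sum_distrib_left sum_distrib_right)
    qed
    also have "\<dots> = (\<Sum>j<n. c * (?K x ^ Suc j / fact (Suc j))) + M * (?K x ^ Suc n / fact (Suc n))"
      using ac_deriv_eq[OF ac2 Suc.prems] by simp
    finally have "w x \<le> (c + (\<Sum>j<n. c * (?K x ^ Suc j / fact (Suc j)))) + M * (?K x ^ Suc n / fact (Suc n))"
      using le[OF Suc.prems] by linarith
    also have "c + (\<Sum>j<n. c * (?K x ^ Suc j / fact (Suc j))) = c * (\<Sum>j<Suc n. ?K x ^ j / fact j)"
      by (simp only: sum.lessThan_Suc_shift) (simp add: sum_distrib_left distrib_left del: power_Suc fact_Suc)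
    finally show ?case .
  qed
  have s: "(\<lambda>n. ?K x ^ n / fact n) sums exp (?K x)"
    using exp_converges[of "?K x"] by (simp add: field_simps)
  have "(\<lambda>n. c * (\<Sum>j<n. ?K x ^ j / fact j) + M * (?K x ^ n / fact n)) \<longlonglongrightarrow> c * exp (?K x) + M * 0"
    by (intro tendsto_intros summable_LIMSEQ_zero[OF sums_summable[OF s]] s[unfolded sums_def])
  then show ?thesis using b[OF x] by (intro LIMSEQ_le_const) (auto simp: add.commute)
qed

section \<open>Weak derivatives\<close>

definition flat :: "real poly \<Rightarrow> real \<Rightarrow> real" where
  "flat p x = (if x > 0 then poly p (1 / x) * exp (- (1 / x)) else 0)"

lemma poly_times_exp_tendsto_0: "((\<lambda>t. poly p t * exp (- t)) \<longlongrightarrow> (0::real)) at_top"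
proof -
  have "((\<lambda>t. \<Sum>i\<le>degree p. coeff p i * (t ^ i / exp t)) \<longlongrightarrow> (\<Sum>i\<le>degree p. coeff p i * 0)) at_top"
    by (intro tendsto_intros tendsto_power_div_exp_0)
  moreover have "(\<lambda>t. \<Sum>i\<le>degree p. coeff p i * (t ^ i / exp t)) = (\<lambda>t. poly p t * exp (- t))"
    by (simp add: poly_altdef exp_minus sum_distrib_right sum_divide_distrib divide_inverse mult.assoc)
  ultimately show ?thesis by simp
qed

text \<open>In the variable t = 1/x differentiation by x is -t^2 times differentiation by t, which
  sends p(t) exp(-t) to (p - p') t^2 exp(-t); \<open>[:0, 0, 1:]\<close> is the polynomial t^2. At 0
  the difference quotient is t p(t) exp(-t), where \<open>pCons 0 p\<close> is t p(t), and it tends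
  to 0.\<close>

lemma flat_has_derivative:
  "(flat p has_real_derivative flat ((p - pderiv p) * [:0, 0, 1:]) x) (at x)"
proof -
  consider "x > 0" | "x < 0" | "x = 0" by linarith
  then show ?thesis
  proof cases
    case 1
    have "((\<lambda>x. poly p (1 / x) * exp (- (1 / x))) has_real_derivative
        flat ((p - pderiv p) * [:0, 0, 1:]) x) (at x)"
      using 1 by (auto intro!: derivative_eq_intros simp: flat_def divide_simps) (simp add: algebra_simps power2_eq_square)
    moreover have "\<forall>\<^sub>F y in nhds x. flat p y = poly p (1 / y) * exp (- (1 / y))"
      using eventually_nhds_in_open[of "{0<..}" x] 1 by (auto elim!: eventually_mono simp: flat_def)
    ultimately show ?thesis by (subst DERIV_cong_ev[OF refl _ refl])
  next
    case 2
    have "((\<lambda>x. 0) has_real_derivative flat ((p - pderiv p) * [:0, 0, 1:]) x) (at x)"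
      using 2 by (simp add: flat_def)
    moreover have "\<forall>\<^sub>F y in nhds x. flat p y = 0"
      using eventually_nhds_in_open[of "{..<0}" x] 2 by (auto elim!: eventually_mono simp: flat_def)
    ultimately show ?thesis by (subst DERIV_cong_ev[OF refl _ refl])
  next
    case 3
    have "((\<lambda>h. poly (pCons 0 p) (inverse h) * exp (- inverse h)) \<longlongrightarrow> 0) (at_right (0::real))"
      by (rule filterlim_compose[OF poly_times_exp_tendsto_0 filterlim_inverse_at_top_right])
    then have "((\<lambda>h. flat p h / h) \<longlongrightarrow> 0) (at_right 0)"
      by (rule Lim_transform_eventually)
         (auto simp: eventually_at_filter flat_def divide_simps)
    moreover have "((\<lambda>h. flat p h / h) \<longlongrightarrow> 0) (at_left 0)"
      by (rule tendsto_eventually) (auto simp: eventually_at_filter flat_def)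
    ultimately have "((\<lambda>h. flat p h / h) \<longlongrightarrow> 0) (at 0)"
      by (simp add: filterlim_split_at)
    then show ?thesis unfolding 3 DERIV_def by (simp add: flat_def)
  qed
qed

inductive bump_span :: "(real \<Rightarrow> real) \<Rightarrow> bool" where
  base: "bump_span (\<lambda>x. flat p (x - a) * flat r (b - x))"
| add: "bump_span f \<Longrightarrow> bump_span g \<Longrightarrow> bump_span (\<lambda>x. f x + g x)"

lemma flat_minus: "flat (- p) x = - flat p x"
  by (simp add: flat_def)

lemma bump_span_derivative:
  assumes "bump_span f"
  shows "\<exists>f'. bump_span f' \<and> (\<forall>x. (f has_real_derivative f' x) (at x))"
  using assms
proof induction
  case (base p a r b)
  let ?p = "(p - pderiv p) * [:0, 0, 1:]" and ?r = "(r - pderiv r) * [:0, 0, 1:]"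
  have "bump_span (\<lambda>x. flat ?p (x - a) * flat r (b - x) + flat p (x - a) * flat (- ?r) (b - x))"
    by (intro bump_span.intros)
  moreover have "((\<lambda>x. flat p (x - a) * flat r (b - x)) has_real_derivative
      flat ?p (x - a) * flat r (b - x) + flat p (x - a) * flat (- ?r) (b - x)) (at x)" for x
  proof -
    have "((\<lambda>x. flat p (x - a)) has_real_derivative flat ?p (x - a) * 1) (at x)"
      by (rule DERIV_chain2[OF flat_has_derivative]) (auto intro!: derivative_eq_intros)
    moreover have "((\<lambda>x. flat r (b - x)) has_real_derivative flat ?r (b - x) * (-1)) (at x)"
      by (rule DERIV_chain2[OF flat_has_derivative]) (auto intro!: derivative_eq_intros)
    ultimately show ?thesis
      by (auto intro!: derivative_eq_intros simp only: flat_minus) (simp add: algebra_simps)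
  qed
  ultimately show ?case by blast
next
  case (add f g)
  then obtain f' g' where "bump_span f'" "bump_span g'" "\<And>x. (f has_real_derivative f' x) (at x)"
    "\<And>x. (g has_real_derivative g' x) (at x)" by blast
  then show ?case
    by (intro exI[of _ "\<lambda>x. f' x + g' x"] conjI allI bump_span.add DERIV_add)
qed

lemma bump_span_smooth:
  assumes "bump_span f"
  shows "bump_span ((deriv ^^ n) f) \<and> (deriv ^^ n) f differentiable_on UNIV"
proof -
  have *: "bump_span (deriv f) \<and> f differentiable_on UNIV" if "bump_span f" for f
  proof -
    obtain f' where f': "bump_span f'" "\<And>x. (f has_real_derivative f' x) (at x)"
      using bump_span_derivative[OF \<open>bump_span f\<close>] by blast
    have "deriv f = f'" using f'(2) by (auto intro: DERIV_imp_deriv)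
    moreover have "f differentiable_on UNIV"
      using f'(2) by (auto simp: differentiable_on_def real_differentiable_def)
    ultimately show ?thesis using f'(1) by simp
  qed
  show ?thesis
  proof (induction n)
    case 0
    then show ?case using assms * by simp
  next
    case (Suc n)
    then show ?case using *[of "(deriv ^^ n) f"] *[of "deriv ((deriv ^^ n) f)"] by simp
  qed
qed

definition bump :: "real \<Rightarrow> real \<Rightarrow> real" where
  "bump e x = flat 1 x * flat 1 (e - x)"

lemma bump_nonneg: "0 \<le> bump e x" by (simp add: bump_def flat_def)

lemma bump_pos: "0 < x \<Longrightarrow> x < e \<Longrightarrow> 0 < bump e x" by (simp add: bump_def flat_def)

lemma bump_eq_0: "x \<le> 0 \<or> x \<ge> e \<Longrightarrow> bump e x = 0" by (auto simp: bump_def flat_def)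

lemma flat_continuous: "continuous_on S (flat p)"
  by (meson DERIV_isCont continuous_at_imp_continuous_on flat_has_derivative)

lemma bump_continuous: "continuous_on S (bump e)"
  unfolding bump_def
  by (intro continuous_intros continuous_on_compose2[OF flat_continuous[of UNIV]]) auto

text \<open>The lower limit is a point to the left of the support, so that 0 lies inside the
  interval on which the primitive is differentiated.\<close>

definition bump_int :: "real \<Rightarrow> real \<Rightarrow> real" where
  "bump_int e x = integral {-1..x} (bump e)"

lemma bump_integral_0: "x \<le> 0 \<Longrightarrow> bump_int e x = 0"
  unfolding bump_int_def by (rule integral_unique[OF has_integral_is_0]) (simp add: bump_eq_0)

lemma bump_int_const:
  assumes "x \<ge> e" "e > 0" shows "bump_int e x = bump_int e e"
proof -
  have "integral {-1..e} (bump e) + integral {e..x} (bump e) = integral {-1..x} (bump e)"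
    by (rule Henstock_Kurzweil_Integration.integral_combine)
       (use assms in \<open>auto intro!: integrable_continuous_real bump_continuous\<close>)
  moreover have "integral {e..x} (bump e) = 0" by (rule integral_unique[OF has_integral_is_0]) (simp add: bump_eq_0)
  ultimately show ?thesis by (simp add: bump_int_def)
qed

lemma bump_int_pos: assumes "e > 0" shows "bump_int e e > 0"
proof -
  have ge: "0 \<le> bump_int e e" unfolding bump_int_def
    by (intro integral_nonneg integrable_continuous_real bump_continuous bump_nonneg)
  have "bump_int e e \<noteq> 0"
  proof
    assume "bump_int e e = 0"
    then have "\<forall>x\<in>{-1..e}. bump e x = 0"
      unfolding bump_int_def using assms
      by (subst (asm) integral_eq_0_iff) (auto intro!: bump_continuous bump_nonneg)
    then show False using bump_pos[of "e/2" e] assms by auto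
  qed
  then show ?thesis using ge by simp
qed

lemma bump_int_derivative: "(bump_int e has_real_derivative bump e x) (at x)"
proof (cases "x < 0")
  case True
  have "\<forall>\<^sub>F y in nhds x. bump_int e y = 0"
    using eventually_nhds_in_open[of "{..<0}" x] True by (auto elim!: eventually_mono simp: bump_integral_0)
  moreover have "((\<lambda>x. 0) has_real_derivative bump e x) (at x)" using True by (simp add: bump_eq_0)
  ultimately show ?thesis by (subst DERIV_cong_ev[OF refl _ refl])
next
  case False
  have "((\<lambda>y. integral {-1..y} (bump e)) has_vector_derivative bump e x) (at x within {-1..x+1})"
    by (rule integral_has_vector_derivative) (use False in \<open>auto intro!: bump_continuous\<close>)
  then have "((\<lambda>y. integral {-1..y} (bump e)) has_vector_derivative bump e x) (at x)"
    using False at_within_interior[of x "{-1..x+1}"] by simp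
  then show ?thesis by (simp add: has_real_derivative_iff_has_vector_derivative bump_int_def[abs_def])
qed

text \<open>Two translates of one bump have equal mass, so the primitive of their difference returns
  to 0 to the right of both. Such test functions compare the averages of a function near two
  points.\<close>

lemma test_fun_bump_diff:
  assumes "0 < a" "a < b" "e > 0" "b + e < 1"
  shows "test_fun (\<lambda>x. bump_int e (x - a) - bump_int e (x - b))" (is "test_fun ?\<phi>")
    and "deriv (\<lambda>x. bump_int e (x - a) - bump_int e (x - b)) = (\<lambda>x. bump e (x - a) - bump e (x - b))"
proof -
  have d1: "((\<lambda>x. bump_int e (x - c)) has_real_derivative bump e (x - c) * 1) (at x)" for c x
    by (rule DERIV_chain2[OF bump_int_derivative]) (auto intro!: derivative_eq_intros)
  have d: "(?\<phi> has_real_derivative bump e (x - a) - bump e (x - b)) (at x)" for x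
    using DERIV_diff[OF d1 d1] by simp
  then show der: "deriv ?\<phi> = (\<lambda>x. bump e (x - a) - bump e (x - b))"
    by (auto intro: DERIV_imp_deriv)
  have "bump_span (\<lambda>x. flat 1 (x - a) * flat 1 ((a + e) - x) + flat (- 1) (x - b) * flat 1 ((b + e) - x))"
    by (intro bump_span.intros)
  also have "(\<lambda>x. flat 1 (x - a) * flat 1 ((a + e) - x) + flat (- 1) (x - b) * flat 1 ((b + e) - x)) =
     deriv ?\<phi>" unfolding der bump_def flat_minus by (auto simp: algebra_simps)
  finally have bs: "bump_span (deriv ?\<phi>)" .
  have "(deriv ^^ n) ?\<phi> differentiable_on UNIV" for n
  proof (cases n)
    case 0
    show ?thesis
      using d unfolding 0 differentiable_on_def real_differentiable_def by (auto intro: has_field_derivative_at_within)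
  next
    case (Suc m)
    have "(deriv ^^ Suc m) ?\<phi> = (deriv ^^ m) (deriv ?\<phi>)" by (simp only: funpow_Suc_right o_apply)
    then show ?thesis using bump_span_smooth[OF bs, of m] Suc by simp
  qed
  moreover have "?\<phi> x = 0" if "x \<notin> {a..b + e}" for x
  proof (cases "x < a")
    case True
    then show ?thesis using assms by (simp add: bump_integral_0)
  next
    case False
    then have "x > b + e" using that by auto
    then show ?thesis using assms bump_int_const[of e "x - a"] bump_int_const[of e "x - b"] by simp
  qed
  ultimately show "test_fun ?\<phi>"
    unfolding test_fun_def using assms by blast
qed

text \<open>An approximate identity left unnormalised: its mass \<open>bump_int e e\<close> is
  carried along until two points are compared.\<close>

lemma bump_concentrates:
  fixes h :: "real \<Rightarrow> 'a::euclidean_space"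
  assumes h: "continuous_on {0..1} h" and a: "0 < a" "a + e < 1" "e > 0"
    and d: "\<And>x. x \<in> {a..a+e} \<Longrightarrow> norm (h x - h a) \<le> d"
  shows "norm (integral {0..1} (\<lambda>x. bump e (x - a) *\<^sub>R h x) - bump_int e e *\<^sub>R h a) \<le> d * bump_int e e"
proof -
  have c: "continuous_on {0..1} (\<lambda>x. bump e (x - a))"
    by (intro continuous_on_compose2[OF bump_continuous[of UNIV]] continuous_intros) auto
  have "((\<lambda>x. bump e (x - a)) has_integral (bump_int e (1 - a) - bump_int e (0 - a))) {0..1}"
  proof (rule fundamental_theorem_of_calculus)
    fix x :: real
    have "((\<lambda>x. bump_int e (x - a)) has_real_derivative bump e (x - a) * 1) (at x)"
      by (rule DERIV_chain2[OF bump_int_derivative]) (auto intro!: derivative_eq_intros)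
    then show "((\<lambda>x. bump_int e (x - a)) has_vector_derivative bump e (x - a)) (at x within {0..1})"
      by (simp add: has_real_derivative_iff_has_vector_derivative has_vector_derivative_at_within)
  qed simp
  then have I: "((\<lambda>x. bump e (x - a)) has_integral bump_int e e) {0..1}"
    using a bump_int_const[of e "1 - a"] by (simp add: bump_integral_0)
  have i1: "((\<lambda>x. bump e (x - a) *\<^sub>R h a) has_integral bump_int e e *\<^sub>R h a) {0..1}"
    by (rule has_integral_scaleR_left[OF I])
  have i2: "(\<lambda>x. bump e (x - a) *\<^sub>R h x) integrable_on {0..1}"
    by (intro integrable_continuous_real continuous_intros c h)
  have "integral {0..1} (\<lambda>x. bump e (x - a) *\<^sub>R h x) - bump_int e e *\<^sub>R h a =
     integral {0..1} (\<lambda>x. bump e (x - a) *\<^sub>R h x - bump e (x - a) *\<^sub>R h a)"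
    using integral_diff[OF i2 has_integral_integrable[OF i1]] integral_unique[OF i1] by simp
  also have "norm \<dots> \<le> integral {0..1} (\<lambda>x. d * bump e (x - a))"
  proof (rule integral_norm_bound_integral)
    show "(\<lambda>x. bump e (x - a) *\<^sub>R h x - bump e (x - a) *\<^sub>R h a) integrable_on {0..1}"
      by (rule integrable_diff[OF i2 has_integral_integrable[OF i1]])
    show "(\<lambda>x. d * bump e (x - a)) integrable_on {0..1}"
      using has_integral_integrable[OF has_integral_mult_right[OF I]] .
    show "norm (bump e (x - a) *\<^sub>R h x - bump e (x - a) *\<^sub>R h a) \<le> d * bump e (x - a)" for x
    proof (cases "x \<in> {a..a+e}")
      case True
      then show ?thesis using d[OF True] bump_nonneg[of e "x - a"]
        by (simp flip: scaleR_diff_right add: mult.commute[of d] mult_left_mono)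
    next
      case False
      then have "bump e (x - a) = 0" by (intro bump_eq_0) auto
      then show ?thesis by simp
    qed
  qed
  also have "\<dots> = d * bump_int e e"
    using integral_unique[OF has_integral_mult_right[OF I]] .
  finally show ?thesis .
qed

text \<open>The du Bois-Reymond lemma for interior points: testing against a difference of two bumps
  shows that the averages of h just to the right of a and of b agree, and continuity turns averages
  into values.\<close>

lemma weak_deriv_zero_const_interior:
  fixes h :: "real \<Rightarrow> 'a::euclidean_space"
  assumes h: "continuous_on {0..1} h"
    and z: "\<And>\<phi>. test_fun \<phi> \<Longrightarrow> integral {0..1} (\<lambda>x. deriv \<phi> x *\<^sub>R h x) = 0"
    and ab: "0 < a" "a < b" "b < 1"
  shows "h a = h b"
proof -
  have "norm (h a - h b) \<le> d" if d: "d > 0" for d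
  proof -
    have "uniformly_continuous_on {0..1} h" by (rule compact_uniformly_continuous[OF h]) simp
    then obtain \<delta> where \<delta>: "\<delta> > 0" "\<And>x y. x \<in> {0..1} \<Longrightarrow> y \<in> {0..1} \<Longrightarrow> dist y x < \<delta> \<Longrightarrow> dist (h y) (h x) < d/2"
      using d unfolding uniformly_continuous_on_def by (metis half_gt_zero)
    \<comment> \<open>The halves give strict inequalities: the bumps are narrower than the modulus
      of continuity, and the right one stays inside the unit interval.\<close>
    define e where "e = min (\<delta>/2) ((1 - b)/2)"
    have e: "e > 0" "e < \<delta>" "b + e < 1" using \<delta>(1) ab by (auto simp: e_def min_def field_simps)
    have ca: "norm (integral {0..1} (\<lambda>x. bump e (x - a) *\<^sub>R h x) - bump_int e e *\<^sub>R h a) \<le> (d/2) * bump_int e e"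
      by (rule bump_concentrates[OF h]) (use ab e \<delta>(2)[of a] in \<open>auto simp: dist_norm less_imp_le\<close>)
    have cb: "norm (integral {0..1} (\<lambda>x. bump e (x - b) *\<^sub>R h x) - bump_int e e *\<^sub>R h b) \<le> (d/2) * bump_int e e"
      by (rule bump_concentrates[OF h]) (use ab e \<delta>(2)[of b] in \<open>auto simp: dist_norm less_imp_le\<close>)
    have c: "continuous_on {0..1} (\<lambda>x. bump e (x - c))" for c
      by (intro continuous_on_compose2[OF bump_continuous[of UNIV]] continuous_intros) auto
    have "integral {0..1} (\<lambda>x. (bump e (x - a) - bump e (x - b)) *\<^sub>R h x) = 0"
      using z[OF test_fun_bump_diff(1)[OF ab(1,2) e(1,3)]]
      unfolding test_fun_bump_diff(2)[OF ab(1,2) e(1,3)] .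
    then have eq: "integral {0..1} (\<lambda>x. bump e (x - a) *\<^sub>R h x) = integral {0..1} (\<lambda>x. bump e (x - b) *\<^sub>R h x)"
      using integral_diff[of "\<lambda>x. bump e (x - a) *\<^sub>R h x" "{0..1}" "\<lambda>x. bump e (x - b) *\<^sub>R h x"]
      by (simp add: scaleR_diff_left integrable_continuous_real continuous_intros c h)
    have "norm (bump_int e e *\<^sub>R h a - bump_int e e *\<^sub>R h b) \<le> d * bump_int e e"
      using ca cb unfolding eq
      using norm_triangle_ineq4[of "integral {0..1} (\<lambda>x. bump e (x - b) *\<^sub>R h x) - bump_int e e *\<^sub>R h b"
         "integral {0..1} (\<lambda>x. bump e (x - b) *\<^sub>R h x) - bump_int e e *\<^sub>R h a"]
      by simp
    then show ?thesis
      using bump_int_pos[OF e(1)] by (simp flip: scaleR_diff_right add: mult.commute)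
  qed
  then have "norm (h a - h b) \<le> 0" by (rule field_le_epsilon) simp
  then show ?thesis by simp
qed

lemma weak_deriv_zero_const:
  fixes h :: "real \<Rightarrow> 'a::euclidean_space"
  assumes h: "continuous_on {0..1} h"
    and z: "\<And>\<phi>. test_fun \<phi> \<Longrightarrow> integral {0..1} (\<lambda>x. deriv \<phi> x *\<^sub>R h x) = 0"
    and x: "x \<in> {0..1}"
  shows "h x = h 0"
proof -
  have *: "h y = h (1/2)" if "y \<in> {0<..<1}" for y
  proof (cases y "1/2 :: real" rule: linorder_cases)
    case less
    show ?thesis by (rule weak_deriv_zero_const_interior[OF h z _ less]) (use that in auto)
  next
    case greater
    show ?thesis by (rule weak_deriv_zero_const_interior[OF h z _ greater, symmetric]) (use that in auto)
  qed (rule arg_cong)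
  have "h y = h (1/2)" if "y \<in> closure {0<..<1}" for y
  proof (rule continuous_constant_on_closure[of "{0<..<1}" h])
    show "continuous_on (closure {0<..<1}) h" using h by simp
  qed (use * that in blast)+
  from this[of x] this[of 0] x show ?thesis by simp
qed

section \<open>Lebesgue integrals on the open interval and gauge integrals on the closed one\<close>

lemma integrable_unit_leb: "integrable unit_leb f \<longleftrightarrow> L1 f"
  for f :: "real \<Rightarrow> 'a::euclidean_space"
proof -
  have "integrable unit_leb f \<longleftrightarrow> f absolutely_integrable_on {0<..<1}"
    by (simp add: set_integrable_def integrable_restrict_space)
  also have "\<dots> \<longleftrightarrow> L1 f"
    by (rule absolutely_integrable_spike_set_eq)
       (auto intro: negligible_subset[of "{0,1}"])
  finally show ?thesis .
qed

lemma integral_unit_leb: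
  fixes f :: "real \<Rightarrow> 'a::euclidean_space"
  assumes "L1 f"
  shows "integral\<^sup>L unit_leb f = integral {0..1} f"
  using lebesgue_integral_eq_integral[of "{0<..<1}" f] assms
  by (simp add: integrable_unit_leb integral_open_interval_real)

lemma AE_unit_leb: "(AE x in unit_leb. P x) \<longleftrightarrow> negligible {x \<in> {0..1}. \<not> P x}"
proof -
  have "(AE x in unit_leb. P x) \<longleftrightarrow> (AE x in lebesgue. x \<in> {0<..<1} \<longrightarrow> P x)"
    by (subst AE_restrict_space_iff) auto
  also have "\<dots> \<longleftrightarrow> negligible {x. \<not> (x \<in> {0<..<1} \<longrightarrow> P x)}"
    by (simp add: completion.AE_iff_null_sets negligible_iff_null_sets)
  also have "\<dots> \<longleftrightarrow> negligible {x \<in> {0..1}. \<not> P x}"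
  proof
    assume "negligible {x. \<not> (x \<in> {0<..<1} \<longrightarrow> P x)}"
    then have "negligible ({x. \<not> (x \<in> {0<..<1} \<longrightarrow> P x)} \<union> {0,1})" by (intro negligible_Un) auto
    then show "negligible {x \<in> {0..1}. \<not> P x}" by (rule negligible_subset) auto
  next
    assume "negligible {x \<in> {0..1}. \<not> P x}"
    then show "negligible {x. \<not> (x \<in> {0<..<1} \<longrightarrow> P x)}" by (rule negligible_subset) auto
  qed
  finally show ?thesis .
qed

lemma Lp_fun_1: "f \<in> Lp_fun 1 \<longleftrightarrow> L1 f"
proof
  assume f: "f \<in> Lp_fun 1"
  then have "integrable unit_leb (\<lambda>x. norm (f x))" by (simp add: Lp_fun_def)
  then have "integrable unit_leb f"
    using f by (subst integrable_norm_iff[symmetric]) (auto simp: Lp_fun_def)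
  then show "L1 f" by (simp add: integrable_unit_leb)
next
  assume "L1 f"
  then have "integrable unit_leb f" by (simp add: integrable_unit_leb)
  then show "f \<in> Lp_fun 1" by (auto simp: Lp_fun_def)
qed

text \<open>On a space of finite measure \<open>1 + norm (f x) powr p\<close> is an integrable
  majorant. Every exponent is thereby reduced to the integrable case.\<close>

lemma Lp_fun_L1:
  assumes "1 \<le> p" "f \<in> Lp_fun p" shows "L1 f"
proof -
  have m: "f \<in> borel_measurable unit_leb" and i: "integrable unit_leb (\<lambda>x. norm (f x) powr p)"
    using assms(2) by (auto simp: Lp_fun_def)
  have "L1 (\<lambda>x. 1 :: real)" by (intro L1_continuous continuous_intros)
  then have "integrable unit_leb (\<lambda>x. 1 + norm (f x) powr p)"
    by (intro Bochner_Integration.integrable_add i) (simp only: integrable_unit_leb)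
  then have "integrable unit_leb f"
  proof (rule Bochner_Integration.integrable_bound[OF _ m])
    have "norm (f x) \<le> 1 + norm (f x) powr p" for x
    proof (cases "norm (f x) \<le> 1")
      case True
      then show ?thesis by (simp add: add_increasing2)
    next
      case False
      then have "norm (f x) powr 1 \<le> norm (f x) powr p" by (intro powr_mono assms) auto
      then show ?thesis using False by simp
    qed
    then show "AE x in unit_leb. norm (f x) \<le> norm (1 + norm (f x) powr p)"
      by (auto intro!: AE_I2)
  qed
  then show ?thesis by (simp add: integrable_unit_leb)
qed

lemma test_fun_C1:
  assumes "test_fun \<phi>"
  shows "ac_deriv \<phi> (deriv \<phi>)" "\<phi> 0 = 0" "\<phi> 1 = 0" "continuous_on {0..1} (deriv \<phi>)"
proof -
  have d: "(deriv ^^ n) \<phi> differentiable_on UNIV" for n using assms by (simp add: test_fun_def)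
  show "\<phi> 0 = 0" "\<phi> 1 = 0" using assms by (auto simp: test_fun_def)
  have "continuous_on UNIV (deriv \<phi>)"
    using differentiable_imp_continuous_on[OF d[of 1]] by simp
  then show c: "continuous_on {0..1} (deriv \<phi>)" by (rule continuous_on_subset) simp
  show "ac_deriv \<phi> (deriv \<phi>)"
  proof (rule ac_deriv_C1[OF _ c])
    fix x :: real
    have "\<phi> differentiable (at x)" using d[of 0] by (simp add: differentiable_on_def)
    then have "(\<phi> has_real_derivative deriv \<phi> x) (at x)"
      by (simp add: DERIV_deriv_iff_real_differentiable)
    then show "(\<phi> has_vector_derivative deriv \<phi> x) (at x within {0..1})"
      by (simp add: has_real_derivative_iff_has_vector_derivative has_vector_derivative_at_within)
  qed
qed

lemma ac_deriv_weak:
  fixes f :: "real \<Rightarrow> 'a::euclidean_space"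
  assumes "ac_deriv f g" "test_fun \<phi>"
  shows "integral {0..1} (\<lambda>x. deriv \<phi> x *\<^sub>R f x) = - integral {0..1} (\<lambda>x. \<phi> x *\<^sub>R g x)"
proof -
  note t = test_fun_C1[OF assms(2)]
  have "ac_deriv (\<lambda>x. \<phi> x *\<^sub>R f x) (\<lambda>x. \<phi> x *\<^sub>R g x + deriv \<phi> x *\<^sub>R f x)"
    by (rule ac_deriv_bilinear[OF bounded_bilinear_scaleR t(1) assms(1)])
  from ac_deriv_eq[OF this, of 1]
  have "integral {0..1} (\<lambda>x. \<phi> x *\<^sub>R g x + deriv \<phi> x *\<^sub>R f x) = 0" using t by simp
  moreover have "integral {0..1} (\<lambda>x. \<phi> x *\<^sub>R g x + deriv \<phi> x *\<^sub>R f x) =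
     integral {0..1} (\<lambda>x. \<phi> x *\<^sub>R g x) + integral {0..1} (\<lambda>x. deriv \<phi> x *\<^sub>R f x)"
    by (intro integral_add L1_integrable_01 L1_bilinear_left[OF bounded_bilinear_scaleR] L1_continuous
        ac_deriv_L1[OF assms(1)] ac_deriv_continuous[OF assms(1)] ac_deriv_continuous[OF t(1)] t(4) continuous_intros)
  ultimately show ?thesis by (simp add: eq_neg_iff_add_eq_0 add.commute)
qed

text \<open>In one direction the product rule acts as integration by parts, test functions vanishing
  at both ends. In the other, f minus a primitive of g has weak derivative 0 and is therefore
  constant.\<close>

lemma has_weak_deriv_iff_ac_deriv:
  fixes f :: "real \<Rightarrow> 'a::euclidean_space"
  assumes c: "continuous_on {0..1} f"
  shows "has_weak_deriv f g \<longleftrightarrow> ac_deriv f g"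
proof
  assume ac: "ac_deriv f g"
  show "has_weak_deriv f g"
    unfolding has_weak_deriv_def
  proof (intro conjI allI impI)
    show "f \<in> Lp_fun 1" using L1_continuous[OF c] by (simp add: Lp_fun_1)
    show "g \<in> Lp_fun 1" using ac_deriv_L1[OF ac] by (simp add: Lp_fun_1)
    fix \<phi> assume \<phi>: "test_fun \<phi>"
    note t = test_fun_C1[OF \<phi>]
    have "L1 (\<lambda>x. deriv \<phi> x *\<^sub>R f x)" by (intro L1_continuous continuous_intros t c)
    moreover have "L1 (\<lambda>x. \<phi> x *\<^sub>R g x)"
      by (intro L1_bilinear_left[OF bounded_bilinear_scaleR] ac_deriv_continuous[OF t(1)] ac_deriv_L1[OF ac])
    ultimately show "(LINT x|unit_leb. deriv \<phi> x *\<^sub>R f x) = - (LINT x|unit_leb. \<phi> x *\<^sub>R g x)"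
      using ac_deriv_weak[OF ac \<phi>] by (simp add: integral_unit_leb)
  qed
next
  assume w: "has_weak_deriv f g"
  then have g: "L1 g" by (simp add: has_weak_deriv_def Lp_fun_1)
  let ?G = "\<lambda>x. 0 + integral {0..x} g"
  have G: "ac_deriv ?G g" by (rule ac_deriv_primitive[OF g])
  have "f x - ?G x = f 0 - ?G 0" if x: "x \<in> {0..1}" for x
  proof (rule weak_deriv_zero_const[OF _ _ x])
    show "continuous_on {0..1} (\<lambda>x. f x - ?G x)" by (intro continuous_on_diff c ac_deriv_continuous[OF G])
    fix \<phi> assume \<phi>: "test_fun \<phi>"
    note t = test_fun_C1[OF \<phi>]
    have 1: "L1 (\<lambda>x. deriv \<phi> x *\<^sub>R f x)" by (intro L1_continuous continuous_intros t c)
    have 2: "L1 (\<lambda>x. \<phi> x *\<^sub>R g x)"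
      by (intro L1_bilinear_left[OF bounded_bilinear_scaleR] ac_deriv_continuous[OF t(1)] g)
    have 3: "L1 (\<lambda>x. deriv \<phi> x *\<^sub>R ?G x)"
      by (intro L1_continuous continuous_on_scaleR t ac_deriv_continuous[OF G])
    have "integral {0..1} (\<lambda>x. deriv \<phi> x *\<^sub>R f x) = - integral {0..1} (\<lambda>x. \<phi> x *\<^sub>R g x)"
    proof -
      have "(LINT x|unit_leb. deriv \<phi> x *\<^sub>R f x) = - (LINT x|unit_leb. \<phi> x *\<^sub>R g x)"
        using w \<phi> by (simp add: has_weak_deriv_def)
      then show ?thesis unfolding integral_unit_leb[OF 1] integral_unit_leb[OF 2] .
    qed
    also have "\<dots> = integral {0..1} (\<lambda>x. deriv \<phi> x *\<^sub>R ?G x)" by (rule ac_deriv_weak[OF G \<phi>, symmetric])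
    finally show "integral {0..1} (\<lambda>x. deriv \<phi> x *\<^sub>R (f x - ?G x)) = 0"
      using integral_diff[OF L1_integrable_01[OF 1] L1_integrable_01[OF 3]]
      by (simp add: scaleR_diff_right)
  qed
  note const = this
  show "ac_deriv f g"
  proof (rule ac_derivI[OF g])
    fix x :: real assume x: "x \<in> {0..1}"
    from const[OF x] show "f x = f 0 + integral {0..x} g" by (simp add: algebra_simps)
  qed
qed

lemma W11_iff: "f \<in> W11 \<longleftrightarrow> (\<exists>g. ac_deriv f g)"
proof
  assume "f \<in> W11"
  then obtain g where "continuous_on {0..1} f" "has_weak_deriv f g" unfolding W11_def by blast
  then show "\<exists>g. ac_deriv f g" using has_weak_deriv_iff_ac_deriv[of f g] by blast
next
  assume "\<exists>g. ac_deriv f g"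
  then obtain g where g: "ac_deriv f g" ..
  then show "f \<in> W11"
    using has_weak_deriv_iff_ac_deriv[OF ac_deriv_continuous[OF g]] ac_deriv_continuous[OF g]
    unfolding W11_def by blast
qed

lemma ac_deriv_wderiv:
  assumes "ac_deriv f g" shows "ac_deriv f (wderiv f)"
proof -
  have c: "continuous_on {0..1} f" by (rule ac_deriv_continuous[OF assms])
  have "has_weak_deriv f (wderiv f)"
    unfolding wderiv_def by (rule someI[of _ g]) (simp add: has_weak_deriv_iff_ac_deriv[OF c] assms)
  then show ?thesis by (simp add: has_weak_deriv_iff_ac_deriv[OF c])
qed

section \<open>Complex matrices and linear differential equations\<close>

lemma norm_matrix_sq: "(norm (A :: complex^'n^'m))\<^sup>2 = (\<Sum>i\<in>UNIV. \<Sum>j\<in>UNIV. (norm (A $ i $ j))\<^sup>2)"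
  by (simp add: norm_vec_def L2_set_def sum_nonneg)

text \<open>Cauchy-Schwarz in every entry. The norm of nested vectors is the Frobenius norm:
  submultiplicative, but in general with \<open>norm (mat 1)\<close> above 1, which is why that
  factor survives in later constants.\<close>

lemma norm_matrix_mult: "norm ((A :: complex^'n^'m) ** (B :: complex^'p^'n)) \<le> norm A * norm B"
proof (rule power2_le_imp_le)
  have cs: "(norm (\<Sum>k\<in>UNIV. a k * b k))\<^sup>2 \<le> (\<Sum>k\<in>UNIV. (norm (a k))\<^sup>2) * (\<Sum>k\<in>UNIV. (norm (b k))\<^sup>2)"
    for a b :: "'n \<Rightarrow> complex"
  proof -
    have "norm (\<Sum>k\<in>UNIV. a k * b k) \<le> (\<Sum>k\<in>UNIV. norm (a k) * norm (b k))"
      by (rule sum_norm_le) (simp add: norm_mult)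
    then have "(norm (\<Sum>k\<in>UNIV. a k * b k))\<^sup>2 \<le> (\<Sum>k\<in>UNIV. norm (a k) * norm (b k))\<^sup>2"
      by (intro power_mono) auto
    also have "\<dots> \<le> (\<Sum>k\<in>UNIV. (norm (a k))\<^sup>2) * (\<Sum>k\<in>UNIV. (norm (b k))\<^sup>2)"
      by (rule Cauchy_Schwarz_ineq_sum)
    finally show ?thesis .
  qed
  have "(norm (A ** B))\<^sup>2 = (\<Sum>i\<in>UNIV. \<Sum>j\<in>UNIV. (norm (\<Sum>k\<in>UNIV. A $ i $ k * B $ k $ j))\<^sup>2)"
    unfolding norm_matrix_sq by (simp add: matrix_matrix_mult_def)
  also have "\<dots> \<le> (\<Sum>i\<in>UNIV. \<Sum>j\<in>UNIV. (\<Sum>k\<in>UNIV. (norm (A $ i $ k))\<^sup>2) * (\<Sum>k\<in>UNIV. (norm (B $ k $ j))\<^sup>2))"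
    by (intro sum_mono cs)
  also have "\<dots> = (\<Sum>i\<in>UNIV. \<Sum>k\<in>UNIV. (norm (A $ i $ k))\<^sup>2) * (\<Sum>j\<in>UNIV. \<Sum>k\<in>UNIV. (norm (B $ k $ j))\<^sup>2)"
    by (simp add: sum_product)
  also have "(\<Sum>j\<in>UNIV. \<Sum>k\<in>UNIV. (norm (B $ k $ j))\<^sup>2) = (\<Sum>k\<in>UNIV. \<Sum>j\<in>UNIV. (norm (B $ k $ j))\<^sup>2)"
    by (rule sum.swap)
  finally show "(norm (A ** B))\<^sup>2 \<le> (norm A * norm B)\<^sup>2"
    by (simp add: power_mult_distrib norm_matrix_sq)
qed simp

lemma norm_matrix_vector_mult: "norm ((A :: complex^'n^'m) *v x) \<le> norm A * norm x"
proof -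
  let ?X = "(\<chi> i j. x $ i) :: complex^unit^'n"
  have n: "norm ((\<chi> i j. y $ i) :: complex^unit^'k) = norm y" for y :: "complex^'k"
    by (simp add: norm_vec_def L2_set_def)
  have "A ** ?X = (\<chi> i j. (A *v x) $ i)"
    by (simp add: matrix_matrix_mult_def matrix_vector_mult_def vec_eq_iff)
  then have "norm (A *v x) = norm (A ** ?X)" using n[of "A *v x"] by simp
  also have "\<dots> \<le> norm A * norm ?X" by (rule norm_matrix_mult)
  finally show ?thesis by (simp only: n)
qed

lemma matrix_scaleR: "(r *\<^sub>R A) ** B = r *\<^sub>R (A ** B)" "A ** (r *\<^sub>R B) = r *\<^sub>R (A ** B)"
  for A :: "complex^'n^'m" and B :: "complex^'p^'n"
  by (simp_all add: matrix_matrix_mult_def vec_eq_iff scaleR_sum_right)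

lemma bounded_bilinear_matrix_mult:
  "bounded_bilinear (\<lambda>(A :: complex^'n^'m) (B :: complex^'p^'n). A ** B)"
proof
  show "\<exists>K. \<forall>a b. norm ((a :: complex^'n^'m) ** (b :: complex^'p^'n)) \<le> norm a * norm b * K"
    using norm_matrix_mult by (intro exI[of _ 1]) auto
qed (simp_all add: matrix_scaleR matrix_add_ldistrib, simp add: matrix_matrix_mult_def vec_eq_iff distrib_right sum.distrib)

interpretation mm: bounded_bilinear "(**) :: complex^'n^'m \<Rightarrow> complex^'p^'n \<Rightarrow> complex^'p^'m"
  by (rule bounded_bilinear_matrix_mult)

lemma bounded_bilinear_matrix_vector:
  "bounded_bilinear (\<lambda>(A :: complex^'n^'m) x. A *v x)"
proof
  show "\<exists>K. \<forall>a b. norm ((a :: complex^'n^'m) *v b) \<le> norm a * norm b * K"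
    using norm_matrix_vector_mult by (intro exI[of _ 1]) auto
qed (simp_all add: matrix_vector_mult_def vec_eq_iff scaleR_sum_right distrib_left distrib_right sum.distrib)

interpretation mv: bounded_bilinear "(*v) :: complex^'n^'m \<Rightarrow> complex^'n \<Rightarrow> complex^'m"
  by (rule bounded_bilinear_matrix_vector)

lemma norm_cmult_mat: "norm (cmult_mat c A) = norm c * norm A"
proof -
  have "(norm (cmult_mat c A))\<^sup>2 = (norm c * norm A)\<^sup>2"
    unfolding power_mult_distrib norm_matrix_sq
    by (simp add: cmult_mat_def norm_mult power_mult_distrib sum_distrib_left)
  then show ?thesis by simp
qed

lemma cmult_mat_simps:
  "cmult_mat c (A + B) = cmult_mat c A + cmult_mat c B"
  "cmult_mat c (A - B) = cmult_mat c A - cmult_mat c B"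
  "cmult_mat c (- A) = - cmult_mat c A"
  "cmult_mat c (cmult_mat d A) = cmult_mat (c * d) A"
  "cmult_mat 1 A = A"
  "cmult_mat 0 A = 0"
  "cmult_mat c 0 = 0"
  by (simp_all add: cmult_mat_def vec_eq_iff algebra_simps)

lemma cmult_mat_diff_left: "cmult_mat (c - d) A = cmult_mat c A - cmult_mat d A"
  and cmult_mat_minus_left: "cmult_mat (- c) A = - cmult_mat c A"
  by (simp_all add: cmult_mat_def vec_eq_iff algebra_simps)

lemma cmult_mat_mult_left: "cmult_mat c A ** B = cmult_mat c (A ** B)"
  and cmult_mat_mult_right: "A ** cmult_mat c B = cmult_mat c (A ** B)"
  by (simp_all add: cmult_mat_def matrix_matrix_mult_def vec_eq_iff sum_distrib_left mult_ac)

lemma cmult_mat_nth: "cmult_mat c A $ i $ j = c * A $ i $ j"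
  by (simp add: cmult_mat_def)

lemma bounded_bilinear_cmult_mat: "bounded_bilinear (\<lambda>c (A :: complex^'n^'m). cmult_mat c A)"
proof
  show "\<exists>K. \<forall>a b. norm (cmult_mat a (b :: complex^'n^'m)) \<le> norm a * norm b * K"
    by (intro exI[of _ 1]) (simp add: norm_cmult_mat)
qed (simp_all add: cmult_mat_def vec_eq_iff algebra_simps)

interpretation cm: bounded_bilinear "cmult_mat :: complex \<Rightarrow> complex^'n^'m \<Rightarrow> complex^'n^'m"
  by (rule bounded_bilinear_cmult_mat)

lemma adj_nth: "adj A $ i $ j = cnj (A $ j $ i)"
  by (simp add: adj_def)

lemma adj_simps:
  "adj (A + B) = adj A + adj B"
  "adj (A - B) = adj A - adj B"
  "adj (- A) = - adj A"
  "adj (cmult_mat c A) = cmult_mat (cnj c) (adj A)"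
  "adj (adj A) = A"
  "adj 0 = 0"
  by (simp_all add: adj_def cmult_mat_def vec_eq_iff)

lemma adj_mat_1: "adj (mat 1) = mat 1"
  by (simp add: adj_def mat_def vec_eq_iff)

lemma adj_mult: "adj (A ** B) = adj B ** adj A"
  by (simp add: adj_def matrix_matrix_mult_def vec_eq_iff mult.commute)

lemma norm_adj: "norm (adj A) = norm A"
proof -
  have "(norm (adj A))\<^sup>2 = (norm A)\<^sup>2"
    unfolding norm_matrix_sq by (subst sum.swap) (simp add: adj_nth)
  then show ?thesis by simp
qed

lemma bounded_linear_adj: "bounded_linear (adj :: complex^'n^'m \<Rightarrow> complex^'m^'n)"
proof (rule bounded_linear_intro[of _ 1])
  show "adj (r *\<^sub>R A) = r *\<^sub>R adj A" for r and A :: "complex^'n^'m"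
    by (simp add: adj_def vec_eq_iff)
qed (simp_all add: adj_simps norm_adj)

definition diagm :: "('n \<Rightarrow> complex) \<Rightarrow> complex^'n^'n::finite" where
  "diagm d = (\<chi> i j. if i = j then d i else 0)"

lemma diagm_mult_nth: "(diagm d ** B) $ i $ j = d i * B $ i $ j"
proof -
  have "(diagm d ** B) $ i $ j = (\<Sum>k\<in>UNIV. if i = k then d i * B $ k $ j else 0)"
    unfolding matrix_matrix_mult_def diagm_def vec_lambda_beta by (intro sum.cong) auto
  then show ?thesis by simp
qed

lemma mult_diagm_nth: "(B ** diagm d) $ i $ j = B $ i $ j * d j"
proof -
  have "(B ** diagm d) $ i $ j = (\<Sum>k\<in>UNIV. if k = j then B $ i $ k * d j else 0)"
    unfolding matrix_matrix_mult_def diagm_def vec_lambda_beta by (intro sum.cong) auto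
  then show ?thesis by simp
qed

lemma diagm_nth: "diagm d $ i $ j = (if i = j then d i else 0)"
  by (simp add: diagm_def)

lemma diagm_mult: "diagm c ** diagm d = diagm (\<lambda>i. c i * d i)"
  by (simp add: vec_eq_iff diagm_mult_nth diagm_nth)

lemma diagm_1: "diagm (\<lambda>i. 1) = mat 1"
  by (simp add: vec_eq_iff diagm_def mat_def)

lemma norm_matrix_le:
  fixes A B :: "complex^'n^'m"
  assumes "\<And>i j. norm (A $ i $ j) \<le> c * norm (B $ i $ j)" "c \<ge> 0"
  shows "norm A \<le> c * norm B"
proof (rule power2_le_imp_le)
  have "(norm A)\<^sup>2 \<le> (\<Sum>i\<in>UNIV. \<Sum>j\<in>UNIV. (c * norm (B $ i $ j))\<^sup>2)"
    unfolding norm_matrix_sq by (intro sum_mono power_mono assms) auto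
  also have "\<dots> = (c * norm B)\<^sup>2"
    unfolding power_mult_distrib norm_matrix_sq by (simp add: sum_distrib_left power_mult_distrib)
  finally show "(norm A)\<^sup>2 \<le> (c * norm B)\<^sup>2" .
qed (use assms(2) in simp)

lemma norm_matrix_entries:
  fixes A :: "complex^'n^'m"
  assumes "\<And>i j. norm (A $ i $ j) \<le> c"
  shows "norm A \<le> real CARD('m) * real CARD('n) * c"
proof -
  have "norm A \<le> (\<Sum>i\<in>UNIV. norm (A $ i))" by (simp add: norm_vec_def L2_set_le_sum)
  also have "\<dots> \<le> (\<Sum>i\<in>(UNIV :: 'm set). \<Sum>j\<in>(UNIV :: 'n set). norm (A $ i $ j))"
    by (intro sum_mono) (simp add: norm_vec_def L2_set_le_sum)
  also have "\<dots> \<le> (\<Sum>i\<in>(UNIV :: 'm set). \<Sum>j\<in>(UNIV :: 'n set). c)" by (intro sum_mono assms)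
  finally show ?thesis by simp
qed

lemma norm_matrix_nth: "norm ((A :: complex^'n^'m) $ i $ j) \<le> norm A"
  by (meson Finite_Cartesian_Product.norm_nth_le order_trans)

lemma bounded_linear_matrix_nth: "bounded_linear (\<lambda>A :: complex^'n^'m. A $ i $ j)"
  by (rule bounded_linear_compose[OF bounded_linear_vec_nth bounded_linear_vec_nth])

text \<open>Picard iteration. \<open>V n\<close> is the n-th iterated integral, bounded by the n-th
  term of the exponential series of the integral of \<open>norm (A t)\<close>, so the sum converges
  uniformly although A is only integrable.\<close>

lemma linear_ode_exists:
  fixes A :: "real \<Rightarrow> complex^'n^'n" and Y0 :: "complex^'m^'n"
  assumes A: "L1 A"
  shows "\<exists>Y. ac_deriv Y (\<lambda>x. A x ** Y x) \<and> Y 0 = Y0"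
proof -
  define V where "V = rec_nat (\<lambda>x. Y0) (\<lambda>n v x. integral {0..x} (\<lambda>t. A t ** v t))"
  have V0: "V 0 = (\<lambda>x. Y0)" and VS: "V (Suc n) = (\<lambda>x. integral {0..x} (\<lambda>t. A t ** V n t))" for n
    by (simp_all add: V_def)
  let ?K = "\<lambda>x. integral {0..x} (\<lambda>t. norm (A t))"
  have K: "ac_deriv ?K (\<lambda>t. norm (A t))" using ac_deriv_primitive[OF L1_norm[OF A], of 0] by simp
  have Kmono: "?K x \<le> ?K 1" if "x \<in> {0..1}" for x
    by (rule L1_integral_mono_set[OF L1_norm[OF A]]) (use that in auto)
  have K0: "0 \<le> ?K x" if "x \<in> {0..1}" for x
    by (rule integral_nonneg[OF L1_integrable[OF L1_norm[OF A] that]]) simp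
  have Vc: "continuous_on {0..1} (V n)" for n
  proof (induction n)
    case (Suc n)
    show ?case unfolding VS
      by (rule indefinite_integral_continuous_1[OF L1_integrable_01[OF L1_bilinear_right[OF bounded_bilinear_matrix_mult Suc A]]])
  qed (simp add: V0)
  have AV: "L1 (\<lambda>t. A t ** V n t)" for n by (rule L1_bilinear_right[OF bounded_bilinear_matrix_mult Vc A])
  have Vb: "norm (V n x) \<le> norm Y0 * (?K x ^ n / fact n)" if "x \<in> {0..1}" for n x
    using that
  proof (induction n arbitrary: x)
    case (Suc n)
    have ac: "ac_deriv (\<lambda>x. norm Y0 * (?K x ^ Suc n / fact (Suc n))) (\<lambda>t. norm Y0 * (norm (A t) * (?K t ^ n / fact n)))"
      by (rule ac_deriv_linear[OF bounded_linear_mult_right ac_deriv_power[OF K]])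
    have "norm (V (Suc n) x) \<le> integral {0..x} (\<lambda>t. norm Y0 * (norm (A t) * (?K t ^ n / fact n)))"
      unfolding VS
    proof (rule L1_integral_bound[OF AV ac_deriv_L1[OF ac] Suc.prems])
      fix t assume "t \<in> {0..x}"
      then have t: "t \<in> {0..1}" using Suc.prems by auto
      have "norm (A t ** V n t) \<le> norm (A t) * norm (V n t)" by (rule norm_matrix_mult)
      also have "\<dots> \<le> norm (A t) * (norm Y0 * (?K t ^ n / fact n))"
        by (rule mult_left_mono[OF Suc.IH[OF t]]) simp
      finally show "norm (A t ** V n t) \<le> norm Y0 * (norm (A t) * (?K t ^ n / fact n))"
        by (simp add: mult_ac)
    qed
    also have "\<dots> = norm Y0 * (?K x ^ Suc n / fact (Suc n))"
      using ac_deriv_eq[OF ac Suc.prems] by simp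
    finally show ?case .
  qed (simp add: V0)
  have Vb': "norm (V n x) \<le> norm Y0 * (?K 1 ^ n / fact n)" if "x \<in> {0..1}" for n x
    by (rule order_trans[OF Vb[OF that]])
       (use Kmono[OF that] K0[OF that] in \<open>auto intro!: mult_left_mono divide_right_mono power_mono\<close>)
  define Y where "Y x = (\<Sum>n. V n x)" for x
  have summ: "summable (\<lambda>n. norm Y0 * (?K 1 ^ n / fact n))"
    using summable_mult[OF summable_exp[of "?K 1"], of "norm Y0"] by (simp add: field_simps)
  have unif: "uniform_limit {0..1} (\<lambda>n x. \<Sum>i<n. V i x) Y sequentially"
    unfolding Y_def by (rule Weierstrass_m_test[OF Vb' summ])
  have Yc: "continuous_on {0..1} Y"
    by (rule uniform_limit_theorem[OF _ unif]) (auto intro!: always_eventually continuous_intros Vc)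
  have AY: "L1 (\<lambda>t. A t ** Y t)" by (rule L1_bilinear_right[OF bounded_bilinear_matrix_mult Yc A])
  have Sc: "continuous_on {0..1} (\<lambda>x. \<Sum>i<n. V i x)" for n by (intro continuous_intros Vc)
  have AS: "L1 (\<lambda>t. A t ** (\<Sum>i<n. V i t))" for n
    by (rule L1_bilinear_right[OF bounded_bilinear_matrix_mult Sc A])
  \<comment> \<open>Applying the integral operator to a partial sum lengthens it by one term; the
    limit of this relation is the integral equation for Y.\<close>
  have Srec: "(\<Sum>i<Suc n. V i x) = Y0 + integral {0..x} (\<lambda>t. A t ** (\<Sum>i<n. V i t))" if x: "x \<in> {0..1}" for n x
  proof -
    have "integral {0..x} (\<lambda>t. A t ** (\<Sum>i<n. V i t)) = (\<Sum>i<n. integral {0..x} (\<lambda>t. A t ** V i t))"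
      unfolding mm.sum_right by (rule integral_sum) (auto intro: L1_integrable[OF AV x])
    then show ?thesis by (simp only: sum.lessThan_Suc_shift V0 VS)
  qed
  have eq: "Y x = Y0 + integral {0..x} (\<lambda>t. A t ** Y t)" if x: "x \<in> {0..1}" for x
  proof (rule LIMSEQ_unique)
    show "(\<lambda>n. \<Sum>i<Suc n. V i x) \<longlonglongrightarrow> Y x"
      using tendsto_uniform_limitI[OF unif x] by (rule LIMSEQ_Suc)
    have "(\<lambda>n. integral {0..x} (\<lambda>t. A t ** (\<Sum>i<n. V i t))) \<longlonglongrightarrow> integral {0..x} (\<lambda>t. A t ** Y t)"
    proof (rule LIMSEQ_I)
      fix r :: real assume r: "r > 0"
      \<comment> \<open>The added 1 guards the divisions against a coefficient that vanishes almost
        everywhere.\<close>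
      have k1: "?K 1 + 1 > 0" using K0[of 1] by simp
      then have "\<forall>\<^sub>F n in sequentially. \<forall>x\<in>{0..1}. dist (\<Sum>i<n. V i x) (Y x) < r / (?K 1 + 1)"
        using unif r unfolding uniform_limit_iff by simp
      then obtain N where N: "\<And>n t. n \<ge> N \<Longrightarrow> t \<in> {0..1} \<Longrightarrow> dist (\<Sum>i<n. V i t) (Y t) < r / (?K 1 + 1)"
        unfolding eventually_sequentially by blast
      have "norm (integral {0..x} (\<lambda>t. A t ** (\<Sum>i<n. V i t)) - integral {0..x} (\<lambda>t. A t ** Y t)) < r"
        if n: "n \<ge> N" for n
      proof -
        have "integral {0..x} (\<lambda>t. A t ** (\<Sum>i<n. V i t)) - integral {0..x} (\<lambda>t. A t ** Y t) =
          integral {0..x} (\<lambda>t. A t ** (\<Sum>i<n. V i t) - A t ** Y t)"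
          by (rule integral_diff[symmetric]) (rule L1_integrable[OF AS x] L1_integrable[OF AY x])+
        also have "norm \<dots> \<le> integral {0..x} (\<lambda>t. (r / (?K 1 + 1)) * norm (A t))"
        proof (rule L1_integral_bound[OF set_integral_diff(1)[OF AS AY] _ x])
          show "L1 (\<lambda>t. (r / (?K 1 + 1)) * norm (A t))" by (rule L1_linear[OF bounded_linear_mult_right L1_norm[OF A]])
          fix t assume "t \<in> {0..x}"
          then have t: "t \<in> {0..1}" using x by auto
          have "norm (A t ** (\<Sum>i<n. V i t) - A t ** Y t) \<le> norm (A t) * norm ((\<Sum>i<n. V i t) - Y t)"
            unfolding mm.diff_right[symmetric] by (rule norm_matrix_mult)
          also have "\<dots> \<le> norm (A t) * (r / (?K 1 + 1))"
            by (rule mult_left_mono) (use N[OF n t] in \<open>auto simp: dist_norm\<close>)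
          finally show "norm (A t ** (\<Sum>i<n. V i t) - A t ** Y t) \<le> (r / (?K 1 + 1)) * norm (A t)"
            by (simp add: mult_ac)
        qed
        also have "\<dots> = (r / (?K 1 + 1)) * ?K x" by simp
        also have "\<dots> \<le> (r / (?K 1 + 1)) * ?K 1" by (rule mult_left_mono[OF Kmono[OF x]]) (use r k1 in auto)
        also have "\<dots> < r" using r k1 by (simp add: field_simps)
        finally show ?thesis .
      qed
      then show "\<exists>no. \<forall>n\<ge>no. norm (integral {0..x} (\<lambda>t. A t ** (\<Sum>i<n. V i t)) - integral {0..x} (\<lambda>t. A t ** Y t)) < r"
        by blast
    qed
    then show "(\<lambda>n. \<Sum>i<Suc n. V i x) \<longlonglongrightarrow> Y0 + integral {0..x} (\<lambda>t. A t ** Y t)"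
      unfolding Srec[OF x] by (intro tendsto_intros)
  qed
  have Y0: "Y 0 = Y0" using eq[of 0] by simp
  have "ac_deriv Y (\<lambda>x. A x ** Y x)" by (rule ac_derivI[OF AY]) (unfold Y0, rule eq)
  with Y0 show ?thesis by blast
qed

lemma linear_ode_zero:
  fixes A :: "real \<Rightarrow> complex^'n^'n" and Y :: "real \<Rightarrow> complex^'m^'n"
  assumes A: "L1 A" and Y: "ac_deriv Y (\<lambda>x. A x ** Y x)" "Y 0 = 0" and x: "x \<in> {0..1}"
  shows "Y x = 0"
proof -
  have "norm (Y x) \<le> 0 * exp (integral {0..x} (\<lambda>t. norm (A t)))"
  proof (rule gronwall[OF _ L1_norm[OF A] _ _ _ x])
    show c: "continuous_on {0..1} (\<lambda>x. norm (Y x))" by (intro continuous_intros ac_deriv_continuous[OF Y(1)])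
    fix x :: real assume x: "x \<in> {0..1}"
    have "norm (integral {0..x} (\<lambda>t. A t ** Y t)) \<le> integral {0..x} (\<lambda>t. norm (A t) * norm (Y t))"
      by (rule L1_integral_bound[OF ac_deriv_L1[OF Y(1)] L1_bilinear_right[OF bounded_bilinear_mult c L1_norm[OF A]] x])
         (rule norm_matrix_mult)
    then show "norm (Y x) \<le> 0 + integral {0..x} (\<lambda>t. norm (A t) * norm (Y t))"
      using ac_deriv_eq[OF Y(1) x] Y(2) by simp
  qed auto
  then show ?thesis by simp
qed

lemma linear_ode_unique:
  fixes A :: "real \<Rightarrow> complex^'n^'n" and Y Z :: "real \<Rightarrow> complex^'m^'n"
  assumes A: "L1 A" and Y: "ac_deriv Y (\<lambda>x. A x ** Y x)" and Z: "ac_deriv Z (\<lambda>x. A x ** Z x)"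
    and "Y 0 = Z 0" and x: "x \<in> {0..1}"
  shows "Y x = Z x"
proof -
  have "ac_deriv (\<lambda>x. Y x - Z x) (\<lambda>x. A x ** (Y x - Z x))"
    using ac_deriv_diff[OF Y Z] by (simp add: mm.diff_right)
  from linear_ode_zero[OF A this _ x] show ?thesis using assms(4) by simp
qed

section \<open>Solutions of the Dirac system\<close>

text \<open>Signs instead of blocks: \<open>theta\<close>, \<open>JJ\<close> and the free solution
  become diagonal matrices over one index type, and the off-diagonal blocks consist of the entries
  whose indices have different signs.\<close>

definition sg :: "'r + 'r \<Rightarrow> complex" where
  "sg i = (case i of Inl _ \<Rightarrow> 1 | Inr _ \<Rightarrow> - 1)"

definition JJ :: "complex^('r::finite+'r)^('r+'r)" where
  "JJ = diagm sg"

lemma sg_sq: "sg i * sg i = 1" by (simp add: sg_def split: sum.split)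

lemma norm_sg: "norm (sg i) = 1" by (simp add: sg_def split: sum.split)

lemma cnj_sg: "cnj (sg i) = sg i" by (simp add: sg_def split: sum.split)

lemma JJ_JJ: "JJ ** JJ = mat 1"
  by (simp add: JJ_def diagm_mult sg_sq diagm_1)

lemma adj_JJ: "adj JJ = JJ"
  by (auto simp: vec_eq_iff adj_nth JJ_def diagm_nth cnj_sg)

lemma theta_eq: "theta = cmult_mat (- \<i>) JJ"
  by (auto simp: theta_def JJ_def vec_eq_iff cmult_mat_nth block_mat_def diagm_nth sg_def mat_def split: sum.splits)

lemma bold_nth:
  "bold A $ i $ j = (case i of
      Inl k \<Rightarrow> (case j of Inl l \<Rightarrow> 0 | Inr l \<Rightarrow> A $ k $ l)
    | Inr k \<Rightarrow> (case j of Inl l \<Rightarrow> cnj (A $ l $ k) | Inr l \<Rightarrow> 0))"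
  by (simp add: bold_def block_mat_def adj_def split: sum.split)

lemma adj_bold: "adj (bold A) = bold A"
  by (auto simp: vec_eq_iff adj_nth bold_nth split: sum.splits)

lemma bounded_linear_bold: "bounded_linear (bold :: complex^'r::finite^'r \<Rightarrow> _)"
  unfolding linear_conv_bounded_linear[symmetric]
  by (rule linearI) (auto simp: vec_eq_iff bold_nth split: sum.splits)

lemma bold_inject: "bold A = bold B \<Longrightarrow> A = B"
proof -
  assume "bold A = bold B"
  then have "bold A $ Inl k $ Inr l = bold B $ Inl k $ Inr l" for k l by simp
  then show "A = B" by (simp add: bold_nth vec_eq_iff)
qed

text \<open>The Dirac system solved for the derivative, using that \<open>cmult_mat \<i> JJ\<close>
  inverts \<open>theta\<close>. The number of columns is left open, so that fundamental matrices,
  blocks of r columns and single vectors fall under one notion.\<close>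

definition lin_sol :: "(real \<Rightarrow> complex^('r::finite+'r)^('r+'r)) \<Rightarrow> complex \<Rightarrow> (real \<Rightarrow> complex^'m^('r+'r)) \<Rightarrow> bool" where
  "lin_sol Q \<kappa> Y \<longleftrightarrow> ac_deriv Y (\<lambda>x. (cmult_mat (\<i> * \<kappa>) JJ + Q x) ** Y x)"

definition Qm :: "(real \<Rightarrow> complex^'r^'r) \<Rightarrow> real \<Rightarrow> complex^('r::finite+'r)^('r+'r)" where
  "Qm q x = - cmult_mat \<i> (JJ ** bold (q x))"

lemma L1_Qm: assumes "L1 q" shows "L1 (Qm q)"
proof -
  have "bounded_linear (\<lambda>A. - cmult_mat \<i> (JJ ** bold A))"
    by (intro bounded_linear_minus bounded_linear_compose[OF cm.bounded_linear_right]
        bounded_linear_compose[OF mm.bounded_linear_right] bounded_linear_bold)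
  from L1_linear[OF this assms] show ?thesis by (simp add: Qm_def[abs_def])
qed

lemma L1_coeff: "L1 Q \<Longrightarrow> L1 (\<lambda>x. C + Q x)"
  by (rule set_integral_add(1)[OF L1_continuous[OF continuous_on_const]])

lemma i_JJ_theta: "cmult_mat \<i> JJ ** theta = mat 1" "theta ** cmult_mat \<i> JJ = mat 1"
  by (simp_all add: theta_eq cmult_mat_mult_left cmult_mat_mult_right cmult_mat_simps JJ_JJ)

lemma dirac_eq_iff:
  fixes w u :: "complex^'m^('r::finite+'r)"
  shows "theta ** w + bold A ** u = cmult_mat \<mu> u \<longleftrightarrow>
    w = (cmult_mat (\<i> * \<mu>) JJ + - cmult_mat \<i> (JJ ** bold A)) ** u"
proof -
  have r: "(cmult_mat (\<i> * \<mu>) JJ + - cmult_mat \<i> (JJ ** bold A)) ** u =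
      cmult_mat \<i> JJ ** (cmult_mat \<mu> u - bold A ** u)"
    by (simp add: mm.diff_left mm.diff_right cmult_mat_mult_left cmult_mat_mult_right
        cmult_mat_simps matrix_mul_assoc mult.commute)
  show ?thesis
  proof
    assume "theta ** w + bold A ** u = cmult_mat \<mu> u"
    then have "theta ** w = cmult_mat \<mu> u - bold A ** u" by (simp add: algebra_simps)
    then have "cmult_mat \<i> JJ ** (theta ** w) = cmult_mat \<i> JJ ** (cmult_mat \<mu> u - bold A ** u)" by simp
    then show "w = (cmult_mat (\<i> * \<mu>) JJ + - cmult_mat \<i> (JJ ** bold A)) ** u"
      unfolding r by (simp add: matrix_mul_assoc i_JJ_theta)
  next
    assume "w = (cmult_mat (\<i> * \<mu>) JJ + - cmult_mat \<i> (JJ ** bold A)) ** u"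
    then have "theta ** w = theta ** (cmult_mat \<i> JJ ** (cmult_mat \<mu> u - bold A ** u))" unfolding r by simp
    then show "theta ** w + bold A ** u = cmult_mat \<mu> u" by (simp add: matrix_mul_assoc i_JJ_theta)
  qed
qed

lemma lin_sol_exists:
  assumes "L1 Q" shows "\<exists>Y. lin_sol Q \<kappa> Y \<and> Y 0 = Y0"
  unfolding lin_sol_def by (rule linear_ode_exists[OF L1_coeff[OF assms]])

lemma lin_sol_unique:
  assumes "L1 Q" "lin_sol Q \<kappa> Y" "lin_sol Q \<kappa> Z" "Y 0 = Z 0" "x \<in> {0..1}"
  shows "Y x = Z x"
  by (rule linear_ode_unique[OF L1_coeff[OF assms(1)] assms(2,3)[unfolded lin_sol_def] assms(4,5)])

lemma lin_sol_continuous: "lin_sol Q \<kappa> Y \<Longrightarrow> continuous_on {0..1} Y"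
  unfolding lin_sol_def by (rule ac_deriv_continuous)

lemma lin_sol_mult: "lin_sol Q \<kappa> Y \<Longrightarrow> lin_sol Q \<kappa> (\<lambda>x. Y x ** C)"
  unfolding lin_sol_def
  using ac_deriv_linear[OF mm.bounded_linear_left, of Y _ C] by (simp add: matrix_mul_assoc)

lemma lin_sol_add: "lin_sol Q \<kappa> Y \<Longrightarrow> lin_sol Q \<kappa> Z \<Longrightarrow> lin_sol Q \<kappa> (\<lambda>x. Y x + Z x)"
  unfolding lin_sol_def using ac_deriv_add[of Y _ Z] by (simp add: mm.add_right)

text \<open>Existence gives meaning to the choice in \<open>fund_sol\<close>. What the chosen
  function satisfies almost everywhere in terms of \<open>wderiv\<close> becomes an integral
  equation, because a density may be changed on a null set.\<close>

lemma fund_sol: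
  fixes q :: "real \<Rightarrow> complex^'r::finite^'r"
  assumes q: "L1 q"
  shows lin_sol_fund_sol: "lin_sol (Qm q) \<mu> (fund_sol q \<mu>)" and fund_sol_0: "fund_sol q \<mu> 0 = mat 1"
proof -
  let ?P = "\<lambda>u :: real \<Rightarrow> complex^('r+'r)^('r+'r). u \<in> W11 \<and> u 0 = mat 1 \<and>
     (AE x in unit_leb. theta ** wderiv u x + bold (q x) ** u x = cmult_mat \<mu> (u x))"
  let ?G = "\<lambda>u x. (cmult_mat (\<i> * \<mu>) JJ + Qm q x) ** (u x)"
  have AE: "(AE x in unit_leb. theta ** wderiv u x + bold (q x) ** u x = cmult_mat \<mu> (u x)) \<longleftrightarrow>
     negligible {x \<in> {0..1}. wderiv u x \<noteq> ?G u x}" for u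
    unfolding AE_unit_leb dirac_eq_iff Qm_def ..
  have "\<exists>u. ?P u"
  proof -
    obtain u :: "real \<Rightarrow> complex^('r+'r)^('r+'r)" where u: "lin_sol (Qm q) \<mu> u" "u 0 = mat 1"
      using lin_sol_exists[OF L1_Qm[OF q]] by blast
    have ac: "ac_deriv u (?G u)" using u(1) by (simp add: lin_sol_def)
    have "negligible {x \<in> {0..1}. wderiv u x \<noteq> ?G u x}"
      by (rule ac_deriv_AE_unique[OF ac_deriv_wderiv[OF ac] ac])
    moreover have "u \<in> W11" unfolding W11_iff using ac by blast
    ultimately show ?thesis using u(2) AE by blast
  qed
  then have P: "?P (fund_sol q \<mu>)" unfolding fund_sol_def by (rule someI_ex)
  then obtain g where "ac_deriv (fund_sol q \<mu>) g" using W11_iff by blast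
  then have w: "ac_deriv (fund_sol q \<mu>) (wderiv (fund_sol q \<mu>))" by (rule ac_deriv_wderiv)
  have N: "negligible {x \<in> {0..1}. wderiv (fund_sol q \<mu>) x \<noteq> ?G (fund_sol q \<mu>) x}" using P AE by blast
  show "lin_sol (Qm q) \<mu> (fund_sol q \<mu>)"
    unfolding lin_sol_def by (rule ac_deriv_spike[OF w N]) auto
  show "fund_sol q \<mu> 0 = mat 1" using P by blast
qed

text \<open>The Lagrange identity. Multiplication by \<open>JJ\<close> turns each coefficient into a
  scalar plus a multiple of the self-adjoint \<open>bold (q x)\<close>; the two potential terms have
  opposite signs and cancel. Real zeros, simple poles, the symmetry of the Weyl function and the
  inverse of the fundamental solution all rest on this.\<close>

lemma pairing:
  fixes Y :: "real \<Rightarrow> complex^'m^('r::finite+'r)" and Z :: "real \<Rightarrow> complex^'k^('r+'r)"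
  assumes Y: "lin_sol (Qm q) \<kappa> Y" and Z: "lin_sol (Qm q) \<mu> Z"
  shows "ac_deriv (\<lambda>x. adj (Y x) ** JJ ** Z x) (\<lambda>x. cmult_mat (\<i> * (\<mu> - cnj \<kappa>)) (adj (Y x) ** Z x))"
proof -
  let ?A = "\<lambda>l x. cmult_mat (\<i> * l) JJ + Qm q x"
  have 1: "ac_deriv (\<lambda>x. adj (Y x) ** JJ) (\<lambda>x. adj (?A \<kappa> x ** Y x) ** JJ)"
    by (rule ac_deriv_linear[OF bounded_linear_compose[OF mm.bounded_linear_left bounded_linear_adj] Y[unfolded lin_sol_def]])
  have 2: "ac_deriv (\<lambda>x. adj (Y x) ** JJ ** Z x)
     (\<lambda>x. (adj (Y x) ** JJ) ** (?A \<mu> x ** Z x) + (adj (?A \<kappa> x ** Y x) ** JJ) ** Z x)"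
    by (rule ac_deriv_bilinear[OF bounded_bilinear_matrix_mult 1 Z[unfolded lin_sol_def]])
  show ?thesis
  proof (rule ac_deriv_cong[OF 2])
    fix x
    have a: "JJ ** ?A \<mu> x = cmult_mat (\<i> * \<mu>) (mat 1) - cmult_mat \<i> (bold (q x))"
      by (simp add: Qm_def mm.diff_right cmult_mat_mult_right matrix_mul_assoc JJ_JJ)
    have b: "adj (?A \<kappa> x) ** JJ = cmult_mat (- \<i> * cnj \<kappa>) (mat 1) + cmult_mat \<i> (bold (q x))"
      by (simp add: Qm_def adj_simps adj_mult adj_JJ adj_bold mm.add_left mm.diff_left mm.minus_left cmult_mat_mult_left
          matrix_mul_assoc[symmetric] JJ_JJ cmult_mat_minus_left)
    have "(adj (Y x) ** JJ) ** (?A \<mu> x ** Z x) + (adj (?A \<kappa> x ** Y x) ** JJ) ** Z x =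
       adj (Y x) ** (JJ ** ?A \<mu> x + adj (?A \<kappa> x) ** JJ) ** Z x"
      unfolding adj_mult by (simp add: matrix_mul_assoc mm.add_left mm.add_right)
    also have "JJ ** ?A \<mu> x + adj (?A \<kappa> x) ** JJ = cmult_mat (\<i> * (\<mu> - cnj \<kappa>)) (mat 1)"
      unfolding a b by (simp add: right_diff_distrib cmult_mat_diff_left cmult_mat_minus_left)
    finally show "(adj (Y x) ** JJ) ** (?A \<mu> x ** Z x) + (adj (?A \<kappa> x ** Y x) ** JJ) ** Z x =
        cmult_mat (\<i> * (\<mu> - cnj \<kappa>)) (adj (Y x) ** Z x)"
      by (simp add: cmult_mat_mult_right cmult_mat_mult_left)
  qed simp
qed

lemma pairing_eq:
  assumes Y: "lin_sol (Qm q) \<kappa> Y" and Z: "lin_sol (Qm q) \<mu> Z" and x: "x \<in> {0..1}"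
  shows "adj (Y x) ** JJ ** Z x = adj (Y 0) ** JJ ** Z 0 +
    cmult_mat (\<i> * (\<mu> - cnj \<kappa>)) (integral {0..x} (\<lambda>t. adj (Y t) ** Z t))"
proof -
  have c: "(\<lambda>t. adj (Y t) ** Z t) integrable_on {0..x}"
    by (rule L1_integrable[OF L1_continuous x])
       (intro mm.continuous_on lin_sol_continuous[OF Z] bounded_linear.continuous_on[OF bounded_linear_adj] lin_sol_continuous[OF Y])
  have "integral {0..x} (\<lambda>t. cmult_mat (\<i> * (\<mu> - cnj \<kappa>)) (adj (Y t) ** Z t)) =
      cmult_mat (\<i> * (\<mu> - cnj \<kappa>)) (integral {0..x} (\<lambda>t. adj (Y t) ** Z t))"
    using integral_linear[OF c cm.bounded_linear_right] by (simp add: o_def)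
  then show ?thesis using ac_deriv_eq[OF pairing[OF Y Z] x] by simp
qed

lemma pairing_const:
  assumes "lin_sol (Qm q) (cnj \<kappa>) Y" "lin_sol (Qm q) \<kappa> Z" "x \<in> {0..1}"
  shows "adj (Y x) ** JJ ** Z x = adj (Y 0) ** JJ ** Z 0"
  using pairing_eq[OF assms] by (simp add: cmult_mat_simps)

text \<open>The exponential of \<open>z JJ\<close>: the map \<open>x \<mapsto> Edg (\<i> * \<kappa> * x)\<close> is the fundamental solution for \<open>q = 0\<close>.\<close>

definition Edg :: "complex \<Rightarrow> complex^('r::finite+'r)^('r+'r)" where
  "Edg z = diagm (\<lambda>i. exp (sg i * z))"

lemma Edg_add: "Edg (z + w) = Edg z ** Edg w"
  by (simp add: Edg_def diagm_mult distrib_left exp_add)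

lemma Edg_0: "Edg 0 = mat 1"
  by (simp add: Edg_def diagm_1)

lemma norm_exp_sg: "norm (exp (sg i * z)) \<le> exp \<bar>Re z\<bar>"
  by (auto simp: sg_def split: sum.split)

text \<open>A diagonal factor only scales rows, so the largest modulus on the diagonal is the
  constant; the Frobenius norm of \<open>Edg z\<close> would bring in the dimension.\<close>

lemma norm_Edg_mult: "norm (Edg z ** B) \<le> exp \<bar>Re z\<bar> * norm B"
  by (rule norm_matrix_le)
     (auto simp: Edg_def diagm_mult_nth norm_mult simp del: norm_exp_eq_Re intro!: mult_right_mono norm_exp_sg)

lemma norm_mult_Edg: "norm (B ** Edg z) \<le> exp \<bar>Re z\<bar> * norm B"
  by (rule norm_matrix_le)
     (auto simp: Edg_def mult_diagm_nth norm_mult mult.commute[of "norm (B $ _ $ _)"] simp del: norm_exp_eq_Re intro!: mult_right_mono norm_exp_sg)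

lemma JJ_Edg: "JJ ** Edg z = Edg z ** JJ"
  by (simp add: JJ_def Edg_def diagm_mult mult.commute)

lemma Edg_minus: "Edg (- z) ** Edg z = mat 1" "Edg z ** Edg (- z) = mat 1"
  by (simp_all flip: Edg_add add: Edg_0)

lemma ac_deriv_Edg: "ac_deriv (\<lambda>x. Edg (c * of_real x)) (\<lambda>x. cmult_mat c (JJ ** Edg (c * of_real x)))"
proof -
  \<comment> \<open>\<open>?P 1 0\<close> and \<open>?P 0 1\<close> are the spectral projections of
    \<open>JJ\<close>; they reduce the matrix exponential to two scalar ones.\<close>
  let ?P = "\<lambda>a b. diagm (\<lambda>i. case i of Inl _ \<Rightarrow> a | Inr _ \<Rightarrow> b)"
  have E: "Edg z = cmult_mat (exp z) (?P 1 0) + cmult_mat (exp (- z)) (?P 0 1)" for z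
    by (auto simp: vec_eq_iff Edg_def diagm_nth cmult_mat_nth sg_def split: sum.splits)
  have JE: "cmult_mat c (JJ ** Edg z) = cmult_mat (c * exp z) (?P 1 0) + cmult_mat (- c * exp (- z)) (?P 0 1)" for z
    unfolding E by (auto simp: vec_eq_iff JJ_def diagm_mult_nth diagm_nth cmult_mat_nth sg_def split: sum.splits)
  have d: "ac_deriv (\<lambda>x. exp (d * of_real x)) (\<lambda>x. d * exp (d * of_real x))" for d :: complex
  proof (rule ac_deriv_C1)
    show "((\<lambda>x. exp (d * of_real x)) has_vector_derivative d * exp (d * of_real x)) (at x within {0..1})" for x :: real
      by (rule has_vector_derivative_real_field) (auto intro!: derivative_eq_intros)
  qed (intro continuous_intros)
  have "ac_deriv (\<lambda>x. cmult_mat (exp (c * of_real x)) (?P 1 0) + cmult_mat (exp (- c * of_real x)) (?P 0 1))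
     (\<lambda>x. cmult_mat (c * exp (c * of_real x)) (?P 1 0) + cmult_mat (- c * exp (- c * of_real x)) (?P 0 1))"
    by (intro ac_deriv_add ac_deriv_linear[OF cm.bounded_linear_left] d)
  then show ?thesis by (simp only: JE) (simp add: E)
qed

text \<open>Applying the free evolution backwards removes the free part of the equation, because
  \<open>Edg\<close> commutes with \<open>JJ\<close>; integrating the rest and evolving forwards
  again gives the formula.\<close>

lemma variation_of_constants:
  assumes Q: "L1 Q" and Y: "lin_sol Q \<kappa> Y" and x: "x \<in> {0..1}"
  shows "Y x = Edg (\<i> * \<kappa> * of_real x) ** Y 0 +
     integral {0..x} (\<lambda>t. Edg (\<i> * \<kappa> * (of_real x - of_real t)) ** (Q t ** Y t))"
proof -
  let ?c = "- (\<i> * \<kappa>)"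
  have 1: "ac_deriv (\<lambda>x. Edg (?c * of_real x) ** Y x)
     (\<lambda>x. Edg (?c * of_real x) ** ((cmult_mat (\<i> * \<kappa>) JJ + Q x) ** Y x) +
        cmult_mat ?c (JJ ** Edg (?c * of_real x)) ** Y x)"
    by (rule ac_deriv_bilinear[OF bounded_bilinear_matrix_mult ac_deriv_Edg Y[unfolded lin_sol_def]])
  have 2: "ac_deriv (\<lambda>x. Edg (?c * of_real x) ** Y x) (\<lambda>x. Edg (?c * of_real x) ** (Q x ** Y x))"
    by (rule ac_deriv_cong[OF 1])
       (simp_all add: JJ_Edg mm.add_left mm.add_right mm.minus_left cmult_mat_mult_left cmult_mat_mult_right
           matrix_mul_assoc cmult_mat_minus_left)
  have "Edg (\<i> * \<kappa> * of_real x) ** (Edg (?c * of_real x) ** Y x) = Y x"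
    by (simp add: matrix_mul_assoc Edg_minus)
  then have "Y x = Edg (\<i> * \<kappa> * of_real x) ** (Y 0 + integral {0..x} (\<lambda>t. Edg (?c * of_real t) ** (Q t ** Y t)))"
    using ac_deriv_eq[OF 2 x] by (simp add: Edg_0)
  also have "\<dots> = Edg (\<i> * \<kappa> * of_real x) ** Y 0 +
      integral {0..x} (\<lambda>t. Edg (\<i> * \<kappa> * of_real x) ** (Edg (?c * of_real t) ** (Q t ** Y t)))"
    using integral_linear[OF L1_integrable[OF ac_deriv_L1[OF 2] x] mm.bounded_linear_right, of "Edg (\<i> * \<kappa> * of_real x)"]
    by (simp add: o_def mm.add_right)
  also have "(\<lambda>t. Edg (\<i> * \<kappa> * of_real x) ** (Edg (?c * of_real t) ** (Q t ** Y t))) =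
      (\<lambda>t. Edg (\<i> * \<kappa> * (of_real x - of_real t)) ** (Q t ** Y t))"
    by (simp add: matrix_mul_assoc algebra_simps flip: Edg_add)
  finally show ?thesis .
qed

lemma L1_Edg_mult:
  assumes "L1 F" shows "L1 (\<lambda>t. Edg (\<i> * \<kappa> * (of_real x - of_real t)) ** F t)"
proof (rule L1_bilinear_left[OF bounded_bilinear_matrix_mult _ assms])
  have "continuous_on {0..1} (\<lambda>t. Edg (\<i> * \<kappa> * of_real x) ** Edg (- (\<i> * \<kappa>) * of_real t))"
    by (intro mm.continuous_on continuous_on_const ac_deriv_continuous[OF ac_deriv_Edg])
  then show "continuous_on {0..1} (\<lambda>t. Edg (\<i> * \<kappa> * (of_real x - of_real t)))"
    by (simp add: algebra_simps flip: Edg_add)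
qed

text \<open>The kernel grows like the exponential of
  \<open>\<bar>Im \<kappa>\<bar> * (x - t)\<close>, so the weight \<open>exp (- m * x)\<close>
  absorbs it exactly and leaves a Gronwall inequality whose kernel \<open>norm (Q t)\<close> is free
  of \<kappa>. Admitting a defect in the integral equation makes the lemma apply to solutions and
  also to the error of the free approximation.\<close>

lemma weighted_gronwall:
  assumes Q: "L1 Q" and W: "continuous_on {0..1} W" and e: "0 \<le> e" and x: "x \<in> {0..1}"
    and le: "\<And>x. x \<in> {0..1} \<Longrightarrow> norm (W x - integral {0..x} (\<lambda>t. Edg (\<i> * \<kappa> * (of_real x - of_real t)) ** (Q t ** W t)))
        \<le> e * exp (\<bar>Im \<kappa>\<bar> * x)"
  shows "norm (W x) \<le> e * exp (integral {0..1} (\<lambda>t. norm (Q t))) * exp (\<bar>Im \<kappa>\<bar> * x)"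
proof -
  define m where "m = \<bar>Im \<kappa>\<bar>"
  have nQ: "L1 (\<lambda>t. norm (Q t))" by (rule L1_norm[OF Q])
  let ?w = "\<lambda>x. exp (- m * x) * norm (W x)"
  have wc: "continuous_on {0..1} ?w" by (intro continuous_intros W)
  have QW: "L1 (\<lambda>t. Q t ** W t)" by (rule L1_bilinear_right[OF bounded_bilinear_matrix_mult W Q])
  have "?w x \<le> e * exp (integral {0..x} (\<lambda>t. norm (Q t)))"
  proof (rule gronwall[OF wc nQ _ e _ x])
    fix x :: real assume x: "x \<in> {0..1}"
    let ?I = "integral {0..x} (\<lambda>t. Edg (\<i> * \<kappa> * (of_real x - of_real t)) ** (Q t ** W t))"
    have Qw: "L1 (\<lambda>t. norm (Q t) * ?w t)" by (rule L1_bilinear_right[OF bounded_bilinear_mult wc nQ])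
    have "norm ?I \<le> integral {0..x} (\<lambda>t. exp (m * x) * (norm (Q t) * ?w t))"
    proof (rule L1_integral_bound[OF L1_Edg_mult[OF QW] L1_linear[OF bounded_linear_mult_right Qw] x])
      fix t assume t: "t \<in> {0..x}"
      have r: "\<bar>Re (\<i> * \<kappa> * (of_real x - of_real t))\<bar> = m * (x - t)"
        using t by (simp add: m_def abs_mult flip: of_real_diff)
      have "norm (Edg (\<i> * \<kappa> * (of_real x - of_real t)) ** (Q t ** W t)) \<le> exp (m * (x - t)) * norm (Q t ** W t)"
        using norm_Edg_mult[of "\<i> * \<kappa> * (of_real x - of_real t)" "Q t ** W t"] unfolding r .
      also have "\<dots> \<le> exp (m * (x - t)) * (norm (Q t) * norm (W t))"
        by (intro mult_left_mono norm_matrix_mult) simp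
      also have "\<dots> = exp (m * x) * (norm (Q t) * ?w t)"
        by (simp add: right_diff_distrib exp_diff exp_minus field_simps)
      finally show "norm (Edg (\<i> * \<kappa> * (of_real x - of_real t)) ** (Q t ** W t)) \<le> exp (m * x) * (norm (Q t) * ?w t)" .
    qed
    also have "\<dots> = exp (m * x) * integral {0..x} (\<lambda>t. norm (Q t) * ?w t)"
      using integral_linear[OF L1_integrable[OF Qw x] bounded_linear_mult_right] by (simp add: o_def)
    finally have "norm (W x) \<le> e * exp (m * x) + exp (m * x) * integral {0..x} (\<lambda>t. norm (Q t) * ?w t)"
      using le[OF x] norm_triangle_ineq[of "W x - ?I" ?I] by (simp add: m_def)
    then have le': "exp (- m * x) * norm (W x) \<le> exp (- m * x) * (exp (m * x) * (e + integral {0..x} (\<lambda>t. norm (Q t) * ?w t)))"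
      by (intro mult_left_mono) (auto simp: algebra_simps)
    have c: "exp (- m * x) * (exp (m * x) * c) = c" for c by (simp flip: mult.assoc exp_add)
    show "?w x \<le> e + integral {0..x} (\<lambda>t. norm (Q t) * ?w t)" using le' unfolding c .
  qed auto
  also have "\<dots> \<le> e * exp (integral {0..1} (\<lambda>t. norm (Q t)))"
    using L1_integral_mono_set[OF nQ, of x 1] x e by (intro mult_left_mono) auto
  finally have "exp (m * x) * ?w x \<le> exp (m * x) * (e * exp (integral {0..1} (\<lambda>t. norm (Q t))))"
    by (intro mult_left_mono) auto
  then show ?thesis by (simp add: exp_minus m_def mult_ac)
qed

lemma lin_sol_bound:
  assumes Q: "L1 Q" and Y: "lin_sol Q \<kappa> Y" and x: "x \<in> {0..1}"
  shows "norm (Y x) \<le> norm (Y 0) * exp (integral {0..1} (\<lambda>t. norm (Q t))) * exp (\<bar>Im \<kappa>\<bar> * x)"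
proof (rule weighted_gronwall[OF Q lin_sol_continuous[OF Y] _ x])
  fix x :: real assume x: "x \<in> {0..1}"
  have "norm (Edg (\<i> * \<kappa> * of_real x) ** Y 0) \<le> exp (\<bar>Im \<kappa>\<bar> * x) * norm (Y 0)"
    using norm_Edg_mult[of "\<i> * \<kappa> * of_real x" "Y 0"] x by (simp add: abs_mult)
  then show "norm (Y x - integral {0..x} (\<lambda>t. Edg (\<i> * \<kappa> * (of_real x - of_real t)) ** (Q t ** Y t)))
        \<le> norm (Y 0) * exp (\<bar>Im \<kappa>\<bar> * x)"
    using variation_of_constants[OF Q Y x] by (simp add: mult.commute)
qed simp

section \<open>Asymptotics and dependence on the spectral parameter\<close>

lemma integral_const_unit_le:
  fixes c :: real
  assumes "x \<in> {0..1::real}" "0 \<le> c"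
  shows "integral {0..x} (\<lambda>t. c) \<le> c"
  using assms mult_right_mono[of x 1 c] by simp

lemma norm_exp_oscillation_le:
  assumes "t \<in> {0..x}"
  shows "norm (exp (\<i> * \<kappa> * (of_real x - 2 * of_real t))) \<le> exp (\<bar>Im \<kappa>\<bar> * x)"
proof -
  have "- (Im \<kappa> * (x - 2 * t)) \<le> \<bar>Im \<kappa>\<bar> * \<bar>x - 2 * t\<bar>" by (simp flip: abs_mult)
  also have "\<dots> \<le> \<bar>Im \<kappa>\<bar> * x" using assms by (intro mult_left_mono) auto
  finally show ?thesis by (simp add: algebra_simps)
qed

text \<open>On \<open>{0..x}\<close> the phase \<open>x - 2 * t\<close> has modulus at most x, which
  makes the weight right for every direction of \<kappa>. For a C1 approximant integration by parts
  gains a factor of order \<open>1 / norm \<kappa>\<close>; the remainder is small in mean and is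
  carried by the weight alone.\<close>

lemma riemann_lebesgue_scalar:
  fixes f :: "real \<Rightarrow> complex"
  assumes f: "L1 f" and e: "e > 0"
  shows "\<forall>\<^sub>F \<kappa> in at_infinity. \<forall>x\<in>{0..1}.
    norm (integral {0..x} (\<lambda>t. exp (\<i> * \<kappa> * (of_real x - 2 * of_real t)) * f t)) \<le> e * exp (\<bar>Im \<kappa>\<bar> * x)"
proof -
  obtain p p' where p: "\<And>x. (p has_vector_derivative p' x) (at x)" "continuous_on UNIV p'"
     "integral {0..1} (\<lambda>x. norm (f x - p x)) < e/2"
    using L1_approx_C1[OF f, of "e/2"] e by auto
  have pc: "continuous_on S p" for S
    by (intro continuous_at_imp_continuous_on ballI has_vector_derivative_continuous[OF p(1)])
  have p'c: "continuous_on S p'" for S by (rule continuous_on_subset[OF p(2)]) simp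
  have Lp: "L1 p" by (rule L1_continuous[OF pc])
  have "bounded (p ` {0..1})" "bounded (p' ` {0..1})"
    by (rule compact_imp_bounded[OF compact_continuous_image[OF pc]], simp)
       (rule compact_imp_bounded[OF compact_continuous_image[OF p'c]], simp)
  then obtain M1 M2 where M1: "\<And>t. t \<in> {0..1} \<Longrightarrow> norm (p t) \<le> M1" and M2: "\<And>t. t \<in> {0..1} \<Longrightarrow> norm (p' t) \<le> M2"
    unfolding bounded_iff by blast
  define M where "M = max M1 M2"
  have M: "norm (p t) \<le> M" "norm (p' t) \<le> M" if "t \<in> {0..1}" for t
    using M1[OF that] M2[OF that] by (auto simp: M_def)
  have M0: "M \<ge> 0" using M(1)[of 0] norm_ge_zero[of "p 0"] by (simp del: norm_ge_zero)
  \<comment> \<open>Integration by parts leaves two boundary terms and one integral, each at most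
    \<open>M / (2 * norm \<kappa>)\<close> times the weight; the threshold makes their sum at most
    \<open>e / 2\<close> times the weight. The added 1 keeps \<kappa> away from 0.\<close>
  have "norm (integral {0..x} (\<lambda>t. exp (\<i> * \<kappa> * (of_real x - 2 * of_real t)) * f t)) \<le> e * exp (\<bar>Im \<kappa>\<bar> * x)"
    if \<kappa>: "norm \<kappa> \<ge> 4 * M / e + 1" and x: "x \<in> {0..1}" for \<kappa> x
  proof -
    let ?X = "exp (\<bar>Im \<kappa>\<bar> * x)" and ?E = "\<lambda>t. exp (\<i> * \<kappa> * (of_real x - 2 * of_real t))"
    have "4 * M / e \<ge> 0" using M0 e by simp
    then have k0: "\<kappa> \<noteq> 0" "norm \<kappa> > 0" using \<kappa> by auto
    have kM: "4 * M \<le> e * norm \<kappa>"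
    proof -
      have "4 * M / e \<le> norm \<kappa>" using \<kappa> by simp
      then show ?thesis using e by (simp add: field_simps)
    qed
    have Ec: "continuous_on S ?E" for S by (intro continuous_intros)
    have El: "L1 (\<lambda>t. ?E t * g t)" if "L1 g" for g
      by (rule L1_bilinear_left[OF bounded_bilinear_mult Ec that])
    let ?g = "\<lambda>t. ?E t / (- 2 * \<i> * \<kappa>)"
    have gb: "norm (?g t) \<le> ?X / (2 * norm \<kappa>)" if "t \<in> {0..x}" for t
      using norm_exp_oscillation_le[OF that, of \<kappa>] k0 by (simp add: norm_divide norm_mult divide_right_mono)
    have gd: "(?g has_vector_derivative ?E t) (at t within {0..x})" for t
    proof -
      have "((\<lambda>t. exp (\<i> * \<kappa> * (of_real x - 2 * t)) / (- 2 * \<i> * \<kappa>)) has_field_derivative ?E t) (at (of_real t))"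
        using k0 by (auto intro!: derivative_eq_intros simp: field_simps)
      then show ?thesis by (rule has_vector_derivative_real_field)
    qed
    have int: "((\<lambda>t. ?E t * p t + ?g t * p' t) has_integral (?g x * p x - ?g 0 * p 0)) {0..x}"
    proof (rule fundamental_theorem_of_calculus)
      fix t
      show "((\<lambda>t. ?g t * p t) has_vector_derivative ?E t * p t + ?g t * p' t) (at t within {0..x})"
        using has_vector_derivative_mult[OF gd[of t] has_vector_derivative_at_within[OF p(1)]] by (simp add: add.commute)
    qed (use x in auto)
    have gi: "(\<lambda>t. ?g t * p' t) integrable_on {0..x}"
      by (rule integrable_continuous_real) (use k0 in \<open>intro continuous_intros p'c; simp\<close>)
    have "integral {0..x} (\<lambda>t. ?E t * p t) + integral {0..x} (\<lambda>t. ?g t * p' t) = ?g x * p x - ?g 0 * p 0"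
      using integral_unique[OF int] integral_add[OF L1_integrable[OF El[OF Lp] x] gi] by simp
    then have "integral {0..x} (\<lambda>t. ?E t * p t) = ?g x * p x - ?g 0 * p 0 - integral {0..x} (\<lambda>t. ?g t * p' t)"
      by (simp add: algebra_simps)
    also have "norm \<dots> \<le> ?X / (2 * norm \<kappa>) * M + ?X / (2 * norm \<kappa>) * M + ?X / (2 * norm \<kappa>) * M"
    proof -
      have a: "norm (?g t * c) \<le> ?X / (2 * norm \<kappa>) * M" if "t \<in> {0..x}" "norm c \<le> M" for t c
        unfolding norm_mult by (rule mult_mono[OF gb]) (use that in auto)
      have "norm (integral {0..x} (\<lambda>t. ?g t * p' t)) \<le> integral {0..x} (\<lambda>t. ?X / (2 * norm \<kappa>) * M)"
        by (rule integral_norm_bound_integral[OF gi]) (use a M x in auto)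
      also have "\<dots> \<le> ?X / (2 * norm \<kappa>) * M"
        by (rule integral_const_unit_le[OF x]) (use M0 in simp)
      finally have b: "norm (integral {0..x} (\<lambda>t. ?g t * p' t)) \<le> ?X / (2 * norm \<kappa>) * M" .
      have "norm (?g x * p x) \<le> ?X / (2 * norm \<kappa>) * M" "norm (?g 0 * p 0) \<le> ?X / (2 * norm \<kappa>) * M"
        using a[of x "p x"] a[of 0 "p 0"] x M(1)[of x] M(1)[of 0] by auto
      then show ?thesis
        using b norm_triangle_ineq4[of "?g x * p x - ?g 0 * p 0" "integral {0..x} (\<lambda>t. ?g t * p' t)"]
          norm_triangle_ineq4[of "?g x * p x" "?g 0 * p 0"] by linarith
    qed
    also have "\<dots> = ?X * ((3 * M) / (2 * norm \<kappa>))" by (simp add: field_simps)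
    also have "\<dots> \<le> ?X * (e / 2)"
      by (rule mult_left_mono) (use k0 kM M0 in \<open>auto simp: divide_simps\<close>)
    finally have 1: "norm (integral {0..x} (\<lambda>t. ?E t * p t)) \<le> ?X * (e / 2)" .
    have dl: "L1 (\<lambda>t. f t - p t)" by (rule set_integral_diff(1)[OF f Lp])
    have "norm (integral {0..x} (\<lambda>t. ?E t * (f t - p t))) \<le> integral {0..x} (\<lambda>t. ?X * norm (f t - p t))"
    proof (rule L1_integral_bound[OF El[OF dl] _ x])
      show "L1 (\<lambda>t. ?X * norm (f t - p t))" by (rule L1_linear[OF bounded_linear_mult_right L1_norm[OF dl]])
      show "norm (?E t * (f t - p t)) \<le> ?X * norm (f t - p t)" if "t \<in> {0..x}" for t
        unfolding norm_mult by (rule mult_right_mono[OF norm_exp_oscillation_le[OF that]]) simp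
    qed
    also have "\<dots> = ?X * integral {0..x} (\<lambda>t. norm (f t - p t))" by simp
    also have "\<dots> \<le> ?X * (e / 2)"
    proof (rule mult_left_mono)
      have "integral {0..x} (\<lambda>t. norm (f t - p t)) \<le> integral {0..1} (\<lambda>t. norm (f t - p t))"
        by (rule L1_integral_mono_set[OF L1_norm[OF dl]]) (use x in auto)
      then show "integral {0..x} (\<lambda>t. norm (f t - p t)) \<le> e / 2" using p(3) by simp
    qed simp
    finally have 2: "norm (integral {0..x} (\<lambda>t. ?E t * (f t - p t))) \<le> ?X * (e / 2)" .
    have "integral {0..x} (\<lambda>t. ?E t * f t) = integral {0..x} (\<lambda>t. ?E t * (f t - p t)) + integral {0..x} (\<lambda>t. ?E t * p t)"
      using integral_add[OF L1_integrable[OF El[OF dl] x] L1_integrable[OF El[OF Lp] x]]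
      by (simp add: algebra_simps)
    then show ?thesis
      using 1 2 norm_triangle_ineq[of "integral {0..x} (\<lambda>t. ?E t * (f t - p t))" "integral {0..x} (\<lambda>t. ?E t * p t)"]
      by (simp add: field_simps)
  qed
  then show ?thesis unfolding eventually_at_infinity by blast
qed

lemma eventually_at_infinity_mult_sg:
  assumes "\<forall>\<^sub>F \<kappa> in at_infinity. P \<kappa>" shows "\<forall>\<^sub>F \<kappa> in at_infinity. P (sg i * \<kappa>)"
proof -
  obtain b where "\<And>x. b \<le> norm x \<Longrightarrow> P x" using assms unfolding eventually_at_infinity by blast
  then show ?thesis unfolding eventually_at_infinity by (intro exI[of _ b]) (simp add: norm_mult norm_sg)
qed

text \<open>Only entries joining opposite signs acquire the oscillating phase
  \<open>x - 2 * t\<close>; an entry of a diagonal block would carry the phase x, free of t, and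
  there would be no cancellation.\<close>

definition offdiag :: "complex^('r::finite+'r)^('r+'r) \<Rightarrow> bool" where
  "offdiag A \<longleftrightarrow> (\<forall>i j. sg i = sg j \<longrightarrow> A $ i $ j = 0)"

lemma offdiag_Qm: "offdiag (Qm q x)"
  by (auto simp: offdiag_def Qm_def cmult_mat_nth JJ_def diagm_mult_nth bold_nth sg_def split: sum.splits)

lemma riemann_lebesgue_matrix:
  fixes Q :: "real \<Rightarrow> complex^('r::finite+'r)^('r+'r)"
  assumes Q: "L1 Q" and o: "\<And>t. offdiag (Q t)" and e: "e > 0"
  shows "\<forall>\<^sub>F \<kappa> in at_infinity. \<forall>x\<in>{0..1}.
    norm (integral {0..x} (\<lambda>t. Edg (\<i> * \<kappa> * (of_real x - of_real t)) ** (Q t ** Edg (\<i> * \<kappa> * of_real t)))) \<le> e * exp (\<bar>Im \<kappa>\<bar> * x)"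
proof -
  let ?N = "real CARD('r+'r) * real CARD('r+'r)"
  have N: "?N > 0" by simp
  have "\<forall>\<^sub>F \<kappa> in at_infinity. \<forall>x\<in>{0..1}.
    norm (integral {0..x} (\<lambda>t. exp (\<i> * (sg i * \<kappa>) * (of_real x - 2 * of_real t)) * Q t $ i $ j)) \<le> (e / ?N) * exp (\<bar>Im (sg i * \<kappa>)\<bar> * x)" for i j
    using eventually_at_infinity_mult_sg[OF riemann_lebesgue_scalar[OF L1_linear[OF bounded_linear_matrix_nth Q], of "e / ?N" i j]]
    using e N by simp
  then have ev: "\<forall>\<^sub>F \<kappa> in at_infinity. \<forall>i j. \<forall>x\<in>{0..1}.
    norm (integral {0..x} (\<lambda>t. exp (\<i> * (sg i * \<kappa>) * (of_real x - 2 * of_real t)) * Q t $ i $ j)) \<le> (e / ?N) * exp (\<bar>Im (sg i * \<kappa>)\<bar> * x)"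
    by (intro eventually_all_finite)
  have ab: "\<bar>Im (sg i * \<kappa>)\<bar> = \<bar>Im \<kappa>\<bar>" for i :: "'r+'r" and \<kappa> by (simp add: sg_def split: sum.split)
  show ?thesis using ev
  proof (eventually_elim, intro ballI)
    fix \<kappa> and x :: real
    assume H: "\<forall>i j. \<forall>x\<in>{0..1}. norm (integral {0..x} (\<lambda>t. exp (\<i> * (sg i * \<kappa>) * (of_real x - 2 * of_real t)) * Q t $ i $ j)) \<le> (e / ?N) * exp (\<bar>Im (sg i * \<kappa>)\<bar> * x)"
      and x: "x \<in> {0..1}"
    let ?F = "\<lambda>t. Edg (\<i> * \<kappa> * (of_real x - of_real t)) ** (Q t ** Edg (\<i> * \<kappa> * of_real t))"
    have F: "?F integrable_on {0..x}"
      by (intro L1_integrable[OF L1_Edg_mult x] L1_bilinear_right[OF bounded_bilinear_matrix_mult _ Q] ac_deriv_continuous[OF ac_deriv_Edg])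
    have "norm (integral {0..x} ?F $ i $ j) \<le> (e / ?N) * exp (\<bar>Im \<kappa>\<bar> * x)" for i j
    proof -
      have "integral {0..x} ?F $ i $ j = integral {0..x} (\<lambda>t. ?F t $ i $ j)"
        using integral_linear[OF F bounded_linear_matrix_nth[of i j]] by (simp add: o_def)
      also have "\<dots> = integral {0..x} (\<lambda>t. exp (\<i> * (sg i * \<kappa>) * (of_real x - 2 * of_real t)) * Q t $ i $ j)"
      proof (rule integral_cong)
        fix t
        have "?F t $ i $ j = exp (sg i * (\<i> * \<kappa> * (of_real x - of_real t))) * Q t $ i $ j * exp (sg j * (\<i> * \<kappa> * of_real t))"
          by (simp add: Edg_def diagm_mult_nth mult_diagm_nth)
        also have "\<dots> = exp (\<i> * (sg i * \<kappa>) * (of_real x - 2 * of_real t)) * Q t $ i $ j"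
        proof (cases "sg i = sg j")
          case True
          then show ?thesis using o[of t] by (simp add: offdiag_def)
        next
          case False
          then have sj: "sg j = - sg i" by (simp add: sg_def split: sum.splits)
          have "exp (sg i * (\<i> * \<kappa> * (of_real x - of_real t))) * exp (sg j * (\<i> * \<kappa> * of_real t)) =
             exp (\<i> * (sg i * \<kappa>) * (of_real x - 2 * of_real t))"
            unfolding sj exp_add[symmetric] by (rule arg_cong[of _ _ exp]) (simp add: algebra_simps)
          note eq = this
          have "a * c * b = a * b * c" for a b c :: complex by simp
          then show ?thesis unfolding eq[symmetric] by this
        qed
        finally show "?F t $ i $ j = exp (\<i> * (sg i * \<kappa>) * (of_real x - 2 * of_real t)) * Q t $ i $ j" .
      qed
      finally show ?thesis using H[rule_format, OF x, of i j] unfolding ab by (simp only:)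
    qed
    then have "norm (integral {0..x} ?F) \<le> ?N * ((e / ?N) * exp (\<bar>Im \<kappa>\<bar> * x))"
      by (rule norm_matrix_entries)
    then show "norm (integral {0..x} ?F) \<le> e * exp (\<bar>Im \<kappa>\<bar> * x)" using N by simp
  qed
qed

text \<open>The error solves the same Volterra equation with the first iterate of the free solution
  as inhomogeneity. That iterate is small by Riemann-Lebesgue, and Gronwall loses only the factor
  \<open>?C\<close>, which is independent of \<kappa> and can be divided out in advance.\<close>

lemma fund_sol_asymptotics:
  fixes q :: "real \<Rightarrow> complex^'r::finite^'r"
  assumes q: "L1 q" and e: "e > 0"
  shows "\<forall>\<^sub>F \<kappa> in at_infinity. \<forall>x\<in>{0..1}.
    norm (fund_sol q \<kappa> x - Edg (\<i> * \<kappa> * of_real x)) \<le> e * exp (\<bar>Im \<kappa>\<bar> * x)"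
proof -
  let ?C = "exp (integral {0..1} (\<lambda>t. norm (Qm q t)))"
  have Q: "L1 (Qm q)" by (rule L1_Qm[OF q])
  have e': "e / ?C > 0" using e by simp
  show ?thesis using riemann_lebesgue_matrix[OF Q offdiag_Qm e']
  proof (eventually_elim, intro ballI)
    fix \<kappa> and x :: real
    assume H: "\<forall>x\<in>{0..1}. norm (integral {0..x} (\<lambda>t. Edg (\<i> * \<kappa> * (of_real x - of_real t)) ** (Qm q t ** Edg (\<i> * \<kappa> * of_real t)))) \<le> e / ?C * exp (\<bar>Im \<kappa>\<bar> * x)"
      and x: "x \<in> {0..1}"
    let ?U = "fund_sol q \<kappa>" and ?E = "\<lambda>x. Edg (\<i> * \<kappa> * of_real x) :: complex^('r+'r)^('r+'r)"
    let ?W = "\<lambda>x. ?U x - ?E x"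
    have U: "lin_sol (Qm q) \<kappa> ?U" by (rule lin_sol_fund_sol[OF q])
    have Uc: "continuous_on {0..1} ?U" by (rule lin_sol_continuous[OF U])
    have Ec: "continuous_on {0..1} ?E" by (rule ac_deriv_continuous[OF ac_deriv_Edg])
    have "norm (?W x) \<le> e / ?C * ?C * exp (\<bar>Im \<kappa>\<bar> * x)"
    proof (rule weighted_gronwall[OF Q _ _ x])
      show "continuous_on {0..1} ?W" by (intro continuous_intros Uc Ec)
      show "0 \<le> e / ?C" using e' by simp
      fix x :: real assume x: "x \<in> {0..1}"
      let ?K = "\<lambda>t. Edg (\<i> * \<kappa> * (of_real x - of_real t)) :: complex^('r+'r)^('r+'r)"
      have i: "(\<lambda>t. ?K t ** (Qm q t ** F t)) integrable_on {0..x}" if "continuous_on {0..1} F" for F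
        by (intro L1_integrable[OF L1_Edg_mult x] L1_bilinear_right[OF bounded_bilinear_matrix_mult that Q])
      have "?U x = ?E x + integral {0..x} (\<lambda>t. ?K t ** (Qm q t ** ?U t))"
        using variation_of_constants[OF Q U x] fund_sol_0[OF q] by simp
      then have "?W x - integral {0..x} (\<lambda>t. ?K t ** (Qm q t ** ?W t)) = integral {0..x} (\<lambda>t. ?K t ** (Qm q t ** ?E t))"
        using integral_diff[OF i[OF Uc] i[OF Ec]] by (simp add: mm.diff_right)
      then show "norm (?W x - integral {0..x} (\<lambda>t. ?K t ** (Qm q t ** ?W t))) \<le> e / ?C * exp (\<bar>Im \<kappa>\<bar> * x)"
        using H x by simp
    qed
    then show "norm (?W x) \<le> e * exp (\<bar>Im \<kappa>\<bar> * x)" by simp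
  qed
qed

section \<open>Uniform bounds and holomorphic dependence on the spectral parameter\<close>

lemma fund_sol_bound:
  fixes q :: "real \<Rightarrow> complex^'r::finite^'r"
  assumes q: "L1 q"
  obtains C where "C > 0" "\<And>\<kappa> x. x \<in> {0..1} \<Longrightarrow> norm (fund_sol q \<kappa> x) \<le> C * exp (\<bar>Im \<kappa>\<bar> * x)"
proof -
  let ?n = "norm (mat 1 :: complex^('r+'r)^('r+'r))" and ?e = "exp (integral {0..1} (\<lambda>t. norm (Qm q t)))"
  have b: "norm (fund_sol q \<kappa> x) \<le> ?n * ?e * exp (\<bar>Im \<kappa>\<bar> * x)" if "x \<in> {0..1}" for \<kappa> x
    using lin_sol_bound[OF L1_Qm[OF q] lin_sol_fund_sol[OF q] that, of \<kappa>] by (simp add: fund_sol_0[OF q])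
  have "norm (fund_sol q \<kappa> x) \<le> (?n * ?e + 1) * exp (\<bar>Im \<kappa>\<bar> * x)" if "x \<in> {0..1}" for \<kappa> x
    by (rule order_trans[OF b[OF that]]) (simp add: mult_right_mono)
  moreover have "?n * ?e + 1 > 0" by (simp add: add_nonneg_pos)
  ultimately show ?thesis using that by blast
qed

text \<open>The pairing of the solutions at \<open>cnj \<kappa>\<close> and \<kappa> is constant.
  The adjoint and the conjugate argument offset each other, so the inverse of the fundamental
  solution is again entire in \<kappa>.\<close>

lemma fund_sol_inverse:
  fixes q :: "real \<Rightarrow> complex^'r::finite^'r"
  assumes q: "L1 q" and x: "x \<in> {0..1}"
  shows "adj (fund_sol q (cnj \<kappa>) x) ** JJ ** fund_sol q \<kappa> x = JJ"
    and "fund_sol q \<kappa> x ** (JJ ** adj (fund_sol q (cnj \<kappa>) x) ** JJ) = mat 1"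
proof -
  show 1: "adj (fund_sol q (cnj \<kappa>) x) ** JJ ** fund_sol q \<kappa> x = JJ"
    using pairing_const[OF lin_sol_fund_sol[OF q] lin_sol_fund_sol[OF q] x]
    by (simp add: fund_sol_0[OF q] adj_mat_1)
  have "(JJ ** adj (fund_sol q (cnj \<kappa>) x) ** JJ) ** fund_sol q \<kappa> x = JJ ** (adj (fund_sol q (cnj \<kappa>) x) ** JJ ** fund_sol q \<kappa> x)"
    by (simp add: matrix_mul_assoc)
  also have "\<dots> = mat 1" unfolding 1 by (rule JJ_JJ)
  finally show "fund_sol q \<kappa> x ** (JJ ** adj (fund_sol q (cnj \<kappa>) x) ** JJ) = mat 1"
    by (rule matrix_left_right_inverse[THEN iffD2])
qed

text \<open>The pairing identity at \<open>cnj \<kappa>\<close> and \<mu>, freed of its left factor.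
  As \<open>\<mu> - \<kappa>\<close> stands outside exactly, the Lipschitz bound and then the
  complex derivative can be read off.\<close>

lemma fund_sol_difference:
  fixes q :: "real \<Rightarrow> complex^'r::finite^'r"
  assumes q: "L1 q" and x: "x \<in> {0..1}"
  shows "fund_sol q \<mu> x - fund_sol q \<kappa> x = cmult_mat (\<i> * (\<mu> - \<kappa>)) (fund_sol q \<kappa> x ** JJ **
     integral {0..x} (\<lambda>t. adj (fund_sol q (cnj \<kappa>) t) ** fund_sol q \<mu> t))"
proof -
  let ?I = "integral {0..x} (\<lambda>t. adj (fund_sol q (cnj \<kappa>) t) ** fund_sol q \<mu> t)"
  have "adj (fund_sol q (cnj \<kappa>) x) ** JJ ** fund_sol q \<mu> x = JJ + cmult_mat (\<i> * (\<mu> - \<kappa>)) ?I"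
    using pairing_eq[OF lin_sol_fund_sol[OF q, of "cnj \<kappa>"] lin_sol_fund_sol[OF q, of \<mu>] x]
    by (simp add: fund_sol_0[OF q] adj_mat_1)
  note eq = this
  have "fund_sol q \<kappa> x ** (JJ ** adj (fund_sol q (cnj \<kappa>) x) ** JJ) ** fund_sol q \<mu> x =
     fund_sol q \<kappa> x ** JJ ** (adj (fund_sol q (cnj \<kappa>) x) ** JJ ** fund_sol q \<mu> x)"
    by (simp only: matrix_mul_assoc)
  then show ?thesis
    unfolding fund_sol_inverse(2)[OF q x] eq
    by (simp add: mm.add_right cmult_mat_mult_right matrix_mul_assoc[symmetric] JJ_JJ)
qed

lemma integral_adj_mult_bound:
  fixes Y :: "real \<Rightarrow> complex^'m^'n" and Z :: "real \<Rightarrow> complex^'k^'n"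
  assumes Y: "continuous_on {0..1} Y" and Z: "continuous_on {0..1} Z" and x: "x \<in> {0..1}"
    and b: "\<And>t. t \<in> {0..1} \<Longrightarrow> norm (Y t) \<le> b" and c: "\<And>t. t \<in> {0..1} \<Longrightarrow> norm (Z t) \<le> c"
  shows "norm (integral {0..x} (\<lambda>t. adj (Y t) ** Z t)) \<le> b * c"
proof -
  have 0: "b \<ge> 0" "c \<ge> 0" using order_trans[OF norm_ge_zero b[of 0]] order_trans[OF norm_ge_zero c[of 0]] by auto
  have "norm (integral {0..x} (\<lambda>t. adj (Y t) ** Z t)) \<le> integral {0..x} (\<lambda>t. b * c)"
  proof (rule L1_integral_bound[OF _ _ x])
    show "L1 (\<lambda>t. adj (Y t) ** Z t)"
      by (intro L1_continuous mm.continuous_on Z bounded_linear.continuous_on[OF bounded_linear_adj] Y)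
    show "L1 (\<lambda>t::real. b * c)" by (intro L1_continuous continuous_intros)
    fix t assume "t \<in> {0..x}"
    then have "t \<in> {0..1}" using x by auto
    then show "norm (adj (Y t) ** Z t) \<le> b * c"
      by (intro order_trans[OF norm_matrix_mult] mult_mono) (use 0 in \<open>auto simp: norm_adj b c\<close>)
  qed
  also have "\<dots> \<le> b * c" by (rule integral_const_unit_le[OF x]) (use 0 in simp)
  finally show ?thesis .
qed

lemma fund_sol_lipschitz:
  fixes q :: "real \<Rightarrow> complex^'r::finite^'r"
  assumes q: "L1 q"
  obtains L where "L > 0" "\<And>\<mu> x. norm (\<mu> - \<kappa>) \<le> 1 \<Longrightarrow> x \<in> {0..1} \<Longrightarrow>
    norm (fund_sol q \<mu> x - fund_sol q \<kappa> x) \<le> L * norm (\<mu> - \<kappa>)"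
proof -
  obtain C where C: "C > 0" "\<And>\<kappa> x. x \<in> {0..1} \<Longrightarrow> norm (fund_sol q \<kappa> x) \<le> C * exp (\<bar>Im \<kappa>\<bar> * x)"
    using fund_sol_bound[OF q] by blast
  define B where "B = C * exp (\<bar>Im \<kappa>\<bar> + 1)"
  have B: "norm (fund_sol q \<mu> x) \<le> B" if "\<bar>Im \<mu>\<bar> \<le> \<bar>Im \<kappa>\<bar> + 1" "x \<in> {0..1}" for \<mu> x
  proof -
    have "\<bar>Im \<mu>\<bar> * x \<le> \<bar>Im \<mu>\<bar>" using that by (simp add: mult_left_le)
    then show ?thesis
      unfolding B_def using that C(1) by (intro order_trans[OF C(2)[OF that(2)]] mult_left_mono) auto
  qed
  have B0: "B > 0" using C(1) by (simp add: B_def)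
  have "norm (fund_sol q \<mu> x - fund_sol q \<kappa> x) \<le> (B * norm (JJ :: complex^('r+'r)^('r+'r)) * (B * B) + 1) * norm (\<mu> - \<kappa>)"
    if \<mu>: "norm (\<mu> - \<kappa>) \<le> 1" and x: "x \<in> {0..1}" for \<mu> x
  proof -
    have "\<bar>Im \<mu> - Im \<kappa>\<bar> \<le> 1" using abs_Im_le_cmod[of "\<mu> - \<kappa>"] \<mu> by simp
    then have im: "\<bar>Im \<mu>\<bar> \<le> \<bar>Im \<kappa>\<bar> + 1" by linarith
    let ?I = "integral {0..x} (\<lambda>t. adj (fund_sol q (cnj \<kappa>) t) ** fund_sol q \<mu> t)"
    have I: "norm ?I \<le> B * B"
      by (rule integral_adj_mult_bound[OF _ _ x]) (use B im lin_sol_continuous[OF lin_sol_fund_sol[OF q]] in auto)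
    have "norm (fund_sol q \<kappa> x ** JJ ** ?I) \<le> B * norm (JJ :: complex^('r+'r)^('r+'r)) * (B * B)"
      by (intro order_trans[OF norm_matrix_mult] mult_mono B I x mult_nonneg_nonneg) (use B0 in auto)
    then have "norm (fund_sol q \<mu> x - fund_sol q \<kappa> x) \<le> norm (\<mu> - \<kappa>) * (B * norm (JJ :: complex^('r+'r)^('r+'r)) * (B * B))"
      unfolding fund_sol_difference[OF q x, of \<mu> \<kappa>] norm_cmult_mat by (simp add: norm_mult mult_left_mono)
    then have "norm (fund_sol q \<mu> x - fund_sol q \<kappa> x) \<le> norm (\<mu> - \<kappa>) * (B * norm (JJ :: complex^('r+'r)^('r+'r)) * (B * B)) + norm (\<mu> - \<kappa>)"
      by (rule order_trans) simp
    then show ?thesis by (simp add: algebra_simps)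
  qed
  moreover have "B * norm (JJ :: complex^('r+'r)^('r+'r)) * (B * B) + 1 > 0" using B0 by (simp add: add_nonneg_pos)
  ultimately show ?thesis using that by blast
qed

lemma has_field_derivative_quadratic:
  fixes f :: "complex \<Rightarrow> complex"
  assumes "\<And>\<mu>. norm (\<mu> - \<kappa>) \<le> 1 \<Longrightarrow> norm (f \<mu> - f \<kappa> - (\<mu> - \<kappa>) * D) \<le> C * (norm (\<mu> - \<kappa>))\<^sup>2"
  shows "(f has_field_derivative D) (at \<kappa>)"
  unfolding has_field_derivative_iff
proof (rule LIM_zero_cancel, rule Lim_null_comparison)
  show "\<forall>\<^sub>F \<mu> in at \<kappa>. norm ((f \<mu> - f \<kappa>) / (\<mu> - \<kappa>) - D) \<le> C * norm (\<mu> - \<kappa>)"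
    unfolding eventually_at
  proof (intro exI[of _ 1] conjI ballI impI)
    fix \<mu> assume "\<mu> \<noteq> \<kappa> \<and> dist \<mu> \<kappa> < 1"
    then have \<mu>: "\<mu> - \<kappa> \<noteq> 0" "norm (\<mu> - \<kappa>) \<le> 1" by (auto simp: dist_norm)
    have "(f \<mu> - f \<kappa>) / (\<mu> - \<kappa>) - D = (f \<mu> - f \<kappa> - (\<mu> - \<kappa>) * D) / (\<mu> - \<kappa>)"
      using \<mu>(1) by (simp add: field_simps)
    also have "norm \<dots> \<le> C * (norm (\<mu> - \<kappa>))\<^sup>2 / norm (\<mu> - \<kappa>)"
      unfolding norm_divide by (rule divide_right_mono[OF assms[OF \<mu>(2)]]) simp
    finally show "norm ((f \<mu> - f \<kappa>) / (\<mu> - \<kappa>) - D) \<le> C * norm (\<mu> - \<kappa>)"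
      using \<mu>(1) by (simp add: power2_eq_square)
  qed simp
  show "((\<lambda>\<mu>. C * norm (\<mu> - \<kappa>)) \<longlongrightarrow> 0) (at \<kappa>)"
    by (auto intro!: tendsto_eq_intros)
qed

definition mholo :: "(complex \<Rightarrow> complex^'n^'m) \<Rightarrow> complex set \<Rightarrow> bool" where
  "mholo F S \<longleftrightarrow> (\<forall>i j. (\<lambda>\<kappa>. F \<kappa> $ i $ j) holomorphic_on S)"

lemma mholo_fund_sol:
  fixes q :: "real \<Rightarrow> complex^'r::finite^'r"
  assumes q: "L1 q" and x: "x \<in> {0..1}"
  shows "mholo (\<lambda>\<kappa>. fund_sol q \<kappa> x) UNIV"
  unfolding mholo_def holomorphic_on_open[OF open_UNIV]
proof (intro allI ballI)
  fix i j \<kappa>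
  let ?U = "fund_sol q"
  have c: "continuous_on {0..1} (?U \<kappa>)" for \<kappa> by (rule lin_sol_continuous[OF lin_sol_fund_sol[OF q]])
  let ?I = "\<lambda>\<mu>. integral {0..x} (\<lambda>t. adj (?U (cnj \<kappa>) t) ** ?U \<mu> t)"
  \<comment> \<open>The difference formula divided by \<open>\<mu> - \<kappa>\<close>, with \<mu>
    set to \<kappa> under the integral; by the Lipschitz bound the resulting error of the linear
    approximation is quadratic.\<close>
  let ?D = "cmult_mat \<i> (?U \<kappa> x ** JJ ** ?I \<kappa>)"
  obtain L where L: "L > 0" "\<And>\<mu> x. norm (\<mu> - \<kappa>) \<le> 1 \<Longrightarrow> x \<in> {0..1} \<Longrightarrow> norm (?U \<mu> x - ?U \<kappa> x) \<le> L * norm (\<mu> - \<kappa>)"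
    using fund_sol_lipschitz[OF q] by blast
  have "bounded (?U (cnj \<kappa>) ` {0..1})" by (rule compact_imp_bounded[OF compact_continuous_image[OF c]]) simp
  then obtain B where B: "\<And>t. t \<in> {0..1} \<Longrightarrow> norm (?U (cnj \<kappa>) t) \<le> B" unfolding bounded_iff by blast
  have ii: "(\<lambda>t. adj (?U (cnj \<kappa>) t) ** ?U \<mu> t) integrable_on {0..x}" for \<mu>
    by (intro L1_integrable[OF L1_continuous x] mm.continuous_on c bounded_linear.continuous_on[OF bounded_linear_adj])
  have "((\<lambda>\<kappa>. ?U \<kappa> x $ i $ j) has_field_derivative ?D $ i $ j) (at \<kappa>)"
  proof (rule has_field_derivative_quadratic)
    fix \<mu> assume \<mu>: "norm (\<mu> - \<kappa>) \<le> 1"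
    have Id: "?I \<mu> - ?I \<kappa> = integral {0..x} (\<lambda>t. adj (?U (cnj \<kappa>) t) ** (?U \<mu> t - ?U \<kappa> t))"
      unfolding mm.diff_right by (rule integral_diff[OF ii ii, symmetric])
    have In: "norm (?I \<mu> - ?I \<kappa>) \<le> B * (L * norm (\<mu> - \<kappa>))"
      unfolding Id by (rule integral_adj_mult_bound[OF c _ x B L(2)[OF \<mu>]]) (intro continuous_intros c)
    have eq: "?U \<mu> x - ?U \<kappa> x - cmult_mat (\<mu> - \<kappa>) ?D = cmult_mat (\<i> * (\<mu> - \<kappa>)) (?U \<kappa> x ** JJ ** (?I \<mu> - ?I \<kappa>))"
      unfolding fund_sol_difference[OF q x, of \<mu> \<kappa>] by (simp add: cmult_mat_simps mm.diff_right mult.commute)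
    have "?U \<mu> x $ i $ j - ?U \<kappa> x $ i $ j - (\<mu> - \<kappa>) * ?D $ i $ j = (?U \<mu> x - ?U \<kappa> x - cmult_mat (\<mu> - \<kappa>) ?D) $ i $ j"
      by (simp add: cmult_mat_nth)
    also have "norm \<dots> \<le> norm (cmult_mat (\<i> * (\<mu> - \<kappa>)) (?U \<kappa> x ** JJ ** (?I \<mu> - ?I \<kappa>)))"
      unfolding eq by (rule norm_matrix_nth)
    also have "\<dots> \<le> norm (\<mu> - \<kappa>) * (norm (?U \<kappa> x ** JJ) * (B * (L * norm (\<mu> - \<kappa>))))"
      unfolding norm_cmult_mat
      by (simp add: norm_mult) (intro mult_left_mono order_trans[OF norm_matrix_mult] In; simp)
    also have "\<dots> = (norm (?U \<kappa> x ** JJ) * B * L) * (norm (\<mu> - \<kappa>))\<^sup>2" by (simp add: power2_eq_square mult_ac)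
    finally show "norm (?U \<mu> x $ i $ j - ?U \<kappa> x $ i $ j - (\<mu> - \<kappa>) * ?D $ i $ j) \<le> (norm (?U \<kappa> x ** JJ) * B * L) * (norm (\<mu> - \<kappa>))\<^sup>2" .
  qed
  then show "\<exists>f'. ((\<lambda>\<kappa>. ?U \<kappa> x $ i $ j) has_field_derivative f') (at \<kappa>)" by blast
qed

section \<open>The Weyl function\<close>

lemma sum_UNIV_Plus: "(\<Sum>k\<in>(UNIV :: ('a::finite + 'b::finite) set). f k) = (\<Sum>k\<in>UNIV. f (Inl k)) + (\<Sum>k\<in>UNIV. f (Inr k))"
  by (subst UNIV_Plus_UNIV[symmetric], subst sum.Plus) auto

lemma amat_nth: "amat $ i $ j = (case j of Inl l \<Rightarrow> if i = l then 1 / complex_of_real (sqrt 2) else 0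
    | Inr l \<Rightarrow> if i = l then - 1 / complex_of_real (sqrt 2) else 0)"
  by (simp add: amat_def cmult_mat_nth block_row_def mat_def split: sum.split)

lemma sqrt2_sq: "complex_of_real (sqrt 2) * complex_of_real (sqrt 2) = 2"
  by (simp flip: of_real_mult)

text \<open>For the diagonal of the free solution at 1 these averages are
  \<open>cos \<kappa>\<close>, and with the additional factor \<open>theta\<close> they become
  \<open>sin \<kappa>\<close>; this is how the trigonometric functions enter.\<close>

lemma amat_diagm_amat:
  "amat ** diagm d ** adj (amat :: complex^('r::finite+'r)^'r) = diagm (\<lambda>i. (d (Inl i) + d (Inr i)) / 2)"
proof -
  have "(amat ** diagm d ** adj amat) $ i $ j = diagm (\<lambda>i. (d (Inl i) + d (Inr i)) / 2) $ i $ j" for i j :: 'r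
  proof -
    have "(amat ** diagm d ** adj amat) $ i $ j = (\<Sum>k\<in>UNIV. (amat $ i $ k * d k) * cnj (amat $ j $ k))"
      by (simp add: matrix_matrix_mult_def[of "amat ** diagm d"] mult_diagm_nth adj_nth)
    also have "\<dots> = (\<Sum>k\<in>UNIV. if k = i then (if i = j then d (Inl i) / 2 else 0) else 0) +
        (\<Sum>k\<in>UNIV. if k = i then (if i = j then d (Inr i) / 2 else 0) else 0)"
      unfolding sum_UNIV_Plus
      by (intro arg_cong2[of _ _ _ _ "(+)"] sum.cong refl) (auto simp: amat_nth sqrt2_sq)
    also have "\<dots> = diagm (\<lambda>i. (d (Inl i) + d (Inr i)) / 2) $ i $ j"
      by (simp add: diagm_nth add_divide_distrib)
    finally show ?thesis .
  qed
  then show ?thesis by (simp add: vec_eq_iff)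
qed

lemma amat_adj: "amat ** adj (amat :: complex^('r::finite+'r)^'r) = mat 1"
  using amat_diagm_amat[of "\<lambda>i :: 'r + 'r. 1"] by (simp add: diagm_1)

lemma amat_JJ_adj: "amat ** JJ ** adj (amat :: complex^('r::finite+'r)^'r) = 0"
  using amat_diagm_amat[of "sg :: 'r + 'r \<Rightarrow> complex"] by (simp add: JJ_def sg_def diagm_def vec_eq_iff)

text \<open>The summands are complementary orthogonal projections, since the rows of
  \<open>amat\<close> are orthonormal and orthogonal to those of \<open>amat ** JJ\<close>. Hence
  \<open>amat ** Y\<close> and \<open>amat ** JJ ** Y\<close> form a full set of boundary values of
  Y.\<close>

lemma amat_complete:
  "adj amat ** amat + JJ ** adj amat ** amat ** JJ = (mat 1 :: complex^('r::finite+'r)^('r+'r))"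
proof -
  let ?L = "adj amat ** amat + JJ ** adj amat ** amat ** JJ :: complex^('r+'r)^('r+'r)"
  have *: "(adj amat ** amat :: complex^('r+'r)^('r+'r)) $ i $ j =
      (case i of Inl k \<Rightarrow> (case j of Inl l \<Rightarrow> if k = l then 1/2 else 0 | Inr l \<Rightarrow> if k = l then -1/2 else 0)
       | Inr k \<Rightarrow> (case j of Inl l \<Rightarrow> if k = l then -1/2 else 0 | Inr l \<Rightarrow> if k = l then 1/2 else 0))" for i j
  proof -
    have "(adj amat ** amat :: complex^('r+'r)^('r+'r)) $ i $ j = (\<Sum>k\<in>UNIV. cnj (amat $ k $ i) * amat $ k $ j)"
      by (simp add: matrix_matrix_mult_def adj_nth)
    also have "\<dots> = (\<Sum>m\<in>UNIV. if m = (case i of Inl k \<Rightarrow> k | Inr k \<Rightarrow> k) then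
       (case i of Inl k \<Rightarrow> (case j of Inl l \<Rightarrow> if k = l then 1/2 else 0 | Inr l \<Rightarrow> if k = l then -1/2 else 0)
       | Inr k \<Rightarrow> (case j of Inl l \<Rightarrow> if k = l then -1/2 else 0 | Inr l \<Rightarrow> if k = l then 1/2 else 0)) else 0)"
      by (intro sum.cong refl) (auto simp: amat_nth sqrt2_sq split: sum.splits)
    finally show ?thesis by simp
  qed
  have "?L $ i $ j = (mat 1 :: complex^('r+'r)^('r+'r)) $ i $ j" for i j
  proof -
    have "?L $ i $ j = (adj amat ** amat) $ i $ j + sg i * (adj amat ** amat) $ i $ j * sg j"
      by (simp add: JJ_def mult_diagm_nth diagm_mult_nth flip: matrix_mul_assoc[of _ "adj amat" amat] mult.assoc)
    then show ?thesis unfolding * by (auto simp: sg_def mat_def split: sum.splits)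
  qed
  then show ?thesis by (simp add: vec_eq_iff)
qed

lemma JJ_split: "JJ = adj amat ** amat ** JJ + JJ ** adj amat ** (amat :: complex^('r::finite+'r)^'r)"
proof -
  have "JJ = (adj amat ** amat + JJ ** adj amat ** amat ** JJ) ** JJ" unfolding amat_complete by simp
  then show ?thesis by (simp add: mm.add_left matrix_mul_assoc[symmetric] JJ_JJ)
qed

text \<open>Every term contains \<open>amat ** Y\<close> or \<open>amat ** Z\<close>, so the form
  vanishes when both functions satisfy the boundary condition; this is the self-adjointness of that
  condition.\<close>

lemma boundary_form:
  "adj Y ** JJ ** Z = adj (amat ** Y) ** (amat ** JJ ** Z) + adj (amat ** JJ ** Y) ** (amat ** Z)"
proof -
  have "adj Y ** JJ ** Z = adj Y ** (adj amat ** amat ** JJ + JJ ** adj amat ** amat) ** Z"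
    by (rule arg_cong[OF JJ_split, of "\<lambda>M. adj Y ** M ** Z"])
  then show ?thesis by (simp add: adj_mult adj_JJ mm.add_left mm.add_right matrix_mul_assoc)
qed

lemma adj_theta: "adj theta = cmult_mat \<i> JJ"
  by (simp add: theta_eq adj_simps adj_JJ)

context
  fixes q :: "real \<Rightarrow> complex^'r::finite^'r"
  assumes q: "L1 q"
begin

lemma lin_sol_phi: "lin_sol (Qm q) \<kappa> (\<lambda>x. phi_sol q x \<kappa>)"
  unfolding phi_sol_def by (intro lin_sol_mult lin_sol_fund_sol q)

lemma lin_sol_psi: "lin_sol (Qm q) \<kappa> (\<lambda>x. psi_sol q x \<kappa>)"
  unfolding psi_sol_def by (intro lin_sol_mult lin_sol_fund_sol q)

lemma phi_0: "phi_sol q 0 \<kappa> = theta ** adj amat" and psi_0: "psi_sol q 0 \<kappa> = adj amat"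
  by (simp_all add: phi_sol_def psi_sol_def fund_sol_0[OF q])

lemma amat_phi_0: "amat ** phi_sol q 0 \<kappa> = 0"
  by (simp add: phi_0 theta_eq cmult_mat_mult_left cmult_mat_mult_right matrix_mul_assoc amat_JJ_adj cmult_mat_simps)

lemma s_mat_asymptotics:
  assumes e: "e > 0"
  shows "\<forall>\<^sub>F \<kappa> in at_infinity. norm (s_mat q \<kappa> - cmult_mat (sin \<kappa>) (mat 1)) \<le> e * exp \<bar>Im \<kappa>\<bar> \<and>
     norm (c_mat q \<kappa> - cmult_mat (cos \<kappa>) (mat 1)) \<le> e * exp \<bar>Im \<kappa>\<bar>"
proof -
  \<comment> \<open>Dominates \<open>norm amat * norm B\<close> for the two right factors that
    occur, \<open>theta ** adj amat\<close> and \<open>adj amat\<close>; the 1 makes it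
    positive.\<close>
  define N where "N = 1 + norm (amat :: complex^('r+'r)^'r) * (norm (theta ** adj (amat :: complex^('r+'r)^'r)) + norm (adj (amat :: complex^('r+'r)^'r)))"
  have N: "N > 0" by (simp add: N_def add_pos_nonneg)
  have sin: "amat ** Edg (\<i> * \<kappa>) ** (theta ** adj (amat :: complex^('r+'r)^'r)) = cmult_mat (sin \<kappa>) (mat 1)" for \<kappa>
  proof -
    have "Edg (\<i> * \<kappa>) ** theta = cmult_mat (- \<i>) (diagm (\<lambda>i :: 'r + 'r. exp (sg i * (\<i> * \<kappa>)) * sg i))"
      by (simp add: theta_eq Edg_def JJ_def diagm_mult cmult_mat_mult_right)
    moreover have "amat ** Edg (\<i> * \<kappa>) ** (theta ** adj (amat :: complex^('r+'r)^'r)) = amat ** (Edg (\<i> * \<kappa>) ** theta) ** adj amat"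
      by (simp only: matrix_mul_assoc)
    ultimately have "amat ** Edg (\<i> * \<kappa>) ** (theta ** adj (amat :: complex^('r+'r)^'r)) =
       cmult_mat (- \<i>) (amat ** diagm (\<lambda>i. exp (sg i * (\<i> * \<kappa>)) * sg i) ** adj (amat :: complex^('r+'r)^'r))"
      by (simp add: cmult_mat_mult_left cmult_mat_mult_right)
    also have "\<dots> = cmult_mat (sin \<kappa>) (mat 1)"
      unfolding amat_diagm_amat
      by (auto simp: vec_eq_iff cmult_mat_nth diagm_nth mat_def sg_def sin_exp_eq field_simps)
    finally show ?thesis .
  qed
  have cos: "amat ** Edg (\<i> * \<kappa>) ** adj (amat :: complex^('r+'r)^'r) = cmult_mat (cos \<kappa>) (mat 1)" for \<kappa>
    unfolding Edg_def amat_diagm_amat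
    by (auto simp: vec_eq_iff cmult_mat_nth diagm_nth mat_def sg_def cos_exp_eq field_simps)
  have "\<forall>\<^sub>F \<kappa> in at_infinity. \<forall>x\<in>{0..1}.
    norm (fund_sol q \<kappa> x - Edg (\<i> * \<kappa> * of_real x)) \<le> (e / N) * exp (\<bar>Im \<kappa>\<bar> * x)"
    by (rule fund_sol_asymptotics[OF q]) (use e N in simp)
  then show ?thesis
  proof eventually_elim
    case (elim \<kappa>)
    let ?D = "fund_sol q \<kappa> 1 - Edg (\<i> * \<kappa>)"
    have D: "norm ?D \<le> (e / N) * exp \<bar>Im \<kappa>\<bar>" using elim[rule_format, of 1] by simp
    have gen: "norm (amat ** ?D ** B) \<le> e * exp \<bar>Im \<kappa>\<bar>"
      if "norm (amat :: complex^('r+'r)^'r) * norm B \<le> N" for B :: "complex^'r^('r+'r)"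
    proof -
      have "norm (amat ** ?D ** B) \<le> norm (amat :: complex^('r+'r)^'r) * norm ?D * norm B"
        by (intro order_trans[OF norm_matrix_mult] mult_right_mono norm_matrix_mult) simp
      also have "\<dots> = (norm (amat :: complex^('r+'r)^'r) * norm B) * norm ?D" by simp
      also have "\<dots> \<le> N * ((e / N) * exp \<bar>Im \<kappa>\<bar>)" by (intro mult_mono that D) (use N in auto)
      finally show ?thesis using N by simp
    qed
    have "s_mat q \<kappa> - cmult_mat (sin \<kappa>) (mat 1) = amat ** ?D ** (theta ** adj amat)"
      unfolding sin[symmetric] by (simp add: s_mat_def phi_sol_def mm.diff_left mm.diff_right matrix_mul_assoc)
    moreover have "c_mat q \<kappa> - cmult_mat (cos \<kappa>) (mat 1) = amat ** ?D ** adj amat"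
      unfolding cos[symmetric] by (simp add: c_mat_def psi_sol_def mm.diff_left mm.diff_right matrix_mul_assoc)
    moreover have "norm (amat ** ?D ** (theta ** adj amat)) \<le> e * exp \<bar>Im \<kappa>\<bar>"
      by (rule gen) (simp add: N_def distrib_left add_increasing)
    moreover have "norm (amat ** ?D ** adj amat) \<le> e * exp \<bar>Im \<kappa>\<bar>"
      by (rule gen) (simp add: N_def distrib_left add_increasing)
    ultimately show ?case by simp
  qed
qed

end

text \<open>The complement of neighbourhoods of the zeros of \<open>sin\<close>; it contains the boundaries of the squares
  with half-width \<open>\<pi> n + \<pi>/2\<close> around the origin.\<close>

definition good :: "complex \<Rightarrow> bool" where
  "good \<kappa> \<longleftrightarrow> exp \<bar>Im \<kappa>\<bar> \<le> 4 * norm (sin \<kappa>)"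

lemma good_cnj: "good (cnj \<kappa>) \<longleftrightarrow> good \<kappa>"
  by (simp add: good_def flip: cnj_sin)

lemma norm_near_scalar:
  fixes M :: "complex^'n^'n" and X :: "complex^'m^'n"
  assumes "norm (M - cmult_mat z (mat 1)) \<le> d"
  shows "(norm z - d) * norm X \<le> norm (M ** X)"
proof -
  have "norm ((M - cmult_mat z (mat 1)) ** X) \<le> d * norm X"
    by (rule order_trans[OF norm_matrix_mult]) (use assms in \<open>auto intro: mult_right_mono\<close>)
  moreover have "cmult_mat z X = M ** X - (M - cmult_mat z (mat 1)) ** X"
    by (simp add: mm.diff_left cmult_mat_mult_left)
  then have "norm z * norm X \<le> norm (M ** X) + norm ((M - cmult_mat z (mat 1)) ** X)"
    by (metis norm_cmult_mat norm_triangle_ineq4)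
  ultimately show ?thesis by (simp add: algebra_simps)
qed

text \<open>One-column matrices in place of vectors bring eigenvectors under the results on
  \<open>lin_sol\<close>.\<close>

definition to_col :: "complex^'n \<Rightarrow> complex^unit^'n" where
  "to_col v = (\<chi> i j. v $ i)"

lemma mult_to_col: "A ** to_col v = to_col (A *v v)"
  by (simp add: to_col_def matrix_matrix_mult_def matrix_vector_mult_def vec_eq_iff)

lemma to_col_eq_0: "to_col v = 0 \<longleftrightarrow> v = 0"
  by (auto simp: to_col_def vec_eq_iff)

lemma of_col: "V = to_col (\<chi> i. V $ i $ ())"
  by (auto simp: to_col_def vec_eq_iff)

lemma det_0_iff_col:
  fixes A :: "complex^'n^'n"
  shows "det A = 0 \<longleftrightarrow> (\<exists>V :: complex^unit^'n. V \<noteq> 0 \<and> A ** V = 0)"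
proof -
  have 1: "det A \<noteq> 0 \<longleftrightarrow> (\<exists>B. B ** A = mat 1)"
    using invertible_det_nz[of A] invertible_left_inverse[of A] by blast
  have 2: "(\<exists>B. B ** A = mat 1) \<longleftrightarrow> (\<forall>x. A *v x = 0 \<longrightarrow> x = 0)" by (rule matrix_left_invertible_ker)
  have 3: "A *v x = 0 \<longleftrightarrow> A ** to_col x = 0" for x by (simp add: mult_to_col to_col_eq_0)
  have "(\<forall>x. A *v x = 0 \<longrightarrow> x = 0) \<longleftrightarrow> (\<forall>V :: complex^unit^'n. A ** V = 0 \<longrightarrow> V = 0)"
  proof
    assume H: "\<forall>x. A *v x = 0 \<longrightarrow> x = 0"
    show "\<forall>V :: complex^unit^'n. A ** V = 0 \<longrightarrow> V = 0"
    proof (intro allI impI)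
      fix V :: "complex^unit^'n" assume "A ** V = 0"
      then have "A ** to_col (\<chi> i. V $ i $ ()) = 0" by (simp flip: of_col)
      then show "V = 0" using H by (subst of_col) (simp add: to_col_eq_0 flip: 3)
    qed
  next
    assume H: "\<forall>V :: complex^unit^'n. A ** V = 0 \<longrightarrow> V = 0"
    show "\<forall>x. A *v x = 0 \<longrightarrow> x = 0" using H unfolding 3 by (auto simp: to_col_eq_0)
  qed
  then show ?thesis using 1 2 by blast
qed

lemma matrix_inv_det:
  fixes A :: "complex^'n^'n"
  assumes "det A \<noteq> 0" shows "A ** matrix_inv A = mat 1" "matrix_inv A ** A = mat 1"
proof -
  have "\<exists>A'. A ** A' = mat 1 \<and> A' ** A = mat 1"
    using assms invertible_det_nz[of A] by (simp add: invertible_def)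
  from someI_ex[OF this] show "A ** matrix_inv A = mat 1" "matrix_inv A ** A = mat 1"
    by (simp_all add: matrix_inv_def)
qed

text \<open>The Weyl solution, characterised by \<open>amat ** chi_sol q 1 \<kappa> = 0\<close>.\<close>

definition chi_sol :: "(real \<Rightarrow> complex^'r^'r) \<Rightarrow> real \<Rightarrow> complex \<Rightarrow> complex^'r^('r::finite+'r)" where
  "chi_sol q x \<kappa> = psi_sol q x \<kappa> + phi_sol q x \<kappa> ** weyl q \<kappa>"

lemma lin_sol_reflect:
  assumes "lin_sol Q \<kappa> Y"
  shows "lin_sol (\<lambda>x. - Q (1 - x)) (- \<kappa>) (\<lambda>x. Y (1 - x))"
proof -
  have "ac_deriv (\<lambda>x. Y (1 - x)) (\<lambda>x. - ((cmult_mat (\<i> * \<kappa>) JJ + Q (1 - x)) ** Y (1 - x)))"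
    by (rule ac_deriv_reflect[OF assms[unfolded lin_sol_def]])
  then show ?thesis
    unfolding lin_sol_def by (simp add: mm.add_left mm.diff_left cmult_mat_minus_left mm.minus_left)
qed

lemma lin_sol_bound_backward:
  assumes Q: "L1 Q" and Y: "lin_sol Q \<kappa> Y" and x: "x \<in> {0..1}"
  shows "norm (Y x) \<le> norm (Y 1) * exp (integral {0..1} (\<lambda>t. norm (Q (1 - t)))) * exp (\<bar>Im \<kappa>\<bar> * (1 - x))"
proof -
  have L: "L1 (\<lambda>x. - Q (1 - x))"
    by (rule L1_linear[OF bounded_linear_minus[OF bounded_linear_ident] L1_reflect[OF Q]])
  show ?thesis
    using lin_sol_bound[OF L lin_sol_reflect[OF Y], of "1 - x"] x by simp
qed

context
  fixes q :: "real \<Rightarrow> complex^'r::finite^'r"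
  assumes q: "L1 q"
begin

lemma lin_sol_chi: "lin_sol (Qm q) \<kappa> (\<lambda>x. chi_sol q x \<kappa>)"
  unfolding chi_sol_def by (intro lin_sol_add lin_sol_mult lin_sol_psi lin_sol_phi q)

lemma chi_0: "chi_sol q 0 \<kappa> = adj amat + theta ** adj amat ** weyl q \<kappa>"
  by (simp add: chi_sol_def psi_0[OF q] phi_0[OF q])

lemma amat_chi_1: assumes "det (s_mat q \<kappa>) \<noteq> 0" shows "amat ** chi_sol q 1 \<kappa> = 0"
proof -
  have "amat ** chi_sol q 1 \<kappa> = c_mat q \<kappa> + s_mat q \<kappa> ** weyl q \<kappa>"
    by (simp add: chi_sol_def c_mat_def s_mat_def mm.add_right matrix_mul_assoc)
  also have "s_mat q \<kappa> ** weyl q \<kappa> = - c_mat q \<kappa>"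
    by (simp add: weyl_def mm.minus_right matrix_mul_assoc matrix_inv_det[OF assms])
  finally show ?thesis by simp
qed

lemma theta_products:
  "amat ** JJ ** theta ** adj (amat :: complex^('r+'r)^'r) = cmult_mat (- \<i>) (mat 1)"
  "amat ** adj theta ** JJ ** adj (amat :: complex^('r+'r)^'r) = cmult_mat \<i> (mat 1)"
  "amat ** adj theta ** JJ ** theta ** adj (amat :: complex^('r+'r)^'r) = 0"
  by (simp_all add: theta_eq adj_simps adj_JJ cmult_mat_mult_left cmult_mat_mult_right cmult_mat_simps
      amat_adj amat_JJ_adj JJ_JJ flip: matrix_mul_assoc[of amat JJ JJ])

text \<open>The Weyl solutions at \<kappa> and \<open>cnj \<kappa>\<close> both satisfy the boundary
  condition at 1, so their constant pairing is 0. Evaluated at 0 it is \<open>\<i>\<close> times the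
  difference of the two sides.\<close>

lemma weyl_symmetric:
  assumes "det (s_mat q \<kappa>) \<noteq> 0" "det (s_mat q (cnj \<kappa>)) \<noteq> 0"
  shows "adj (weyl q (cnj \<kappa>)) = weyl q \<kappa>"
proof -
  let ?m = "weyl q \<kappa>" and ?n = "adj (weyl q (cnj \<kappa>))"
  have "adj (chi_sol q 1 (cnj \<kappa>)) ** JJ ** chi_sol q 1 \<kappa> = 0"
    unfolding boundary_form amat_chi_1[OF assms(1)] amat_chi_1[OF assms(2)]
    by (simp add: adj_simps)
  then have "adj (chi_sol q 0 (cnj \<kappa>)) ** JJ ** chi_sol q 0 \<kappa> = 0"
    using pairing_const[OF lin_sol_chi lin_sol_chi, of 1 \<kappa>] by simp
  moreover have "adj (chi_sol q 0 (cnj \<kappa>)) ** JJ ** chi_sol q 0 \<kappa> =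
      (amat ** JJ ** adj amat) + (amat ** JJ ** theta ** adj amat) ** ?m
     + ?n ** (amat ** adj theta ** JJ ** adj amat) + ?n ** (amat ** adj theta ** JJ ** theta ** adj amat) ** ?m"
    by (simp add: chi_0 adj_simps adj_mult mm.add_left mm.add_right matrix_mul_assoc)
  ultimately have "cmult_mat \<i> ?n = cmult_mat \<i> ?m"
    unfolding theta_products amat_JJ_adj
    by (simp add: cmult_mat_mult_left cmult_mat_mult_right cmult_mat_minus_left mm.minus_left)
  then have "cmult_mat (- \<i>) (cmult_mat \<i> ?n) = cmult_mat (- \<i>) (cmult_mat \<i> ?m)" by simp
  then show ?thesis by (simp add: cmult_mat_simps)
qed

text \<open>At 1 only the boundary value \<open>amat ** JJ ** chi_sol q 1 \<kappa>\<close> is left,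
  and the constant pairing with \<open>phi_sol\<close> identifies it, up to a factor, as an inverse
  of \<open>adj (s_mat q (cnj \<kappa>))\<close>. Growth of \<open>s_mat\<close> thus becomes decay
  of the Weyl solution at 1.\<close>

lemma chi_1_eq:
  assumes "det (s_mat q \<kappa>) \<noteq> 0"
  shows "adj (s_mat q (cnj \<kappa>)) ** (amat ** JJ ** chi_sol q 1 \<kappa>) = cmult_mat \<i> (mat 1)"
    and "chi_sol q 1 \<kappa> = JJ ** adj amat ** (amat ** JJ ** chi_sol q 1 \<kappa>)"
proof -
  have "adj (phi_sol q 1 (cnj \<kappa>)) ** JJ ** chi_sol q 1 \<kappa> = adj (phi_sol q 0 (cnj \<kappa>)) ** JJ ** chi_sol q 0 \<kappa>"
    by (rule pairing_const[OF lin_sol_phi[OF q] lin_sol_chi]) simp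
  also have "\<dots> = amat ** adj theta ** JJ ** adj amat + (amat ** adj theta ** JJ ** theta ** adj amat) ** weyl q \<kappa>"
    by (simp add: chi_0 phi_0[OF q] adj_simps adj_mult mm.add_left mm.add_right matrix_mul_assoc)
  also have "\<dots> = cmult_mat \<i> (mat 1)" unfolding theta_products by simp
  finally show "adj (s_mat q (cnj \<kappa>)) ** (amat ** JJ ** chi_sol q 1 \<kappa>) = cmult_mat \<i> (mat 1)"
    unfolding boundary_form amat_chi_1[OF assms] by (simp add: s_mat_def)
  have "chi_sol q 1 \<kappa> = (adj amat ** amat + JJ ** adj amat ** amat ** JJ) ** chi_sol q 1 \<kappa>"
    unfolding amat_complete by simp
  also have "\<dots> = adj amat ** (amat ** chi_sol q 1 \<kappa>) + JJ ** adj amat ** (amat ** JJ ** chi_sol q 1 \<kappa>)"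
    by (simp add: mm.add_left matrix_mul_assoc)
  finally show "chi_sol q 1 \<kappa> = JJ ** adj amat ** (amat ** JJ ** chi_sol q 1 \<kappa>)"
    unfolding amat_chi_1[OF assms] by simp
qed

text \<open>At good points \<open>sin\<close> has at least a quarter of the size of the exponential;
  a remainder of one eighth leaves one eighth. Testing on X avoids an inverse before the determinant
  is known to be nonzero.\<close>

lemma s_mat_lower_bound:
  "\<forall>\<^sub>F \<kappa> in at_infinity. good \<kappa> \<longrightarrow> (\<forall>X :: complex^'m^'r. exp \<bar>Im \<kappa>\<bar> / 8 * norm X \<le> norm (s_mat q \<kappa> ** X))"
proof -
  have "\<forall>\<^sub>F \<kappa> in at_infinity. norm (s_mat q \<kappa> - cmult_mat (sin \<kappa>) (mat 1)) \<le> 1/8 * exp \<bar>Im \<kappa>\<bar> \<and>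
     norm (c_mat q \<kappa> - cmult_mat (cos \<kappa>) (mat 1)) \<le> 1/8 * exp \<bar>Im \<kappa>\<bar>"
    by (rule s_mat_asymptotics[OF q]) simp
  then show ?thesis
  proof (eventually_elim, intro impI allI)
    fix \<kappa> and X :: "complex^'m^'r"
    assume H: "norm (s_mat q \<kappa> - cmult_mat (sin \<kappa>) (mat 1)) \<le> 1/8 * exp \<bar>Im \<kappa>\<bar> \<and>
       norm (c_mat q \<kappa> - cmult_mat (cos \<kappa>) (mat 1)) \<le> 1/8 * exp \<bar>Im \<kappa>\<bar>" and g: "good \<kappa>"
    have "exp \<bar>Im \<kappa>\<bar> / 8 * norm X \<le> (norm (sin \<kappa>) - exp \<bar>Im \<kappa>\<bar> / 8) * norm X"
      by (rule mult_right_mono) (use g in \<open>auto simp: good_def\<close>)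
    also have "\<dots> \<le> norm (s_mat q \<kappa> ** X)" by (rule norm_near_scalar) (use H in simp)
    finally show "exp \<bar>Im \<kappa>\<bar> / 8 * norm X \<le> norm (s_mat q \<kappa> ** X)" .
  qed
qed

lemma adj_s_mat_lower_bound:
  "\<forall>\<^sub>F \<kappa> in at_infinity. good \<kappa> \<longrightarrow> (\<forall>X :: complex^'m^'r. exp \<bar>Im \<kappa>\<bar> / 8 * norm X \<le> norm (adj (s_mat q (cnj \<kappa>)) ** X))"
proof -
  have ev: "\<forall>\<^sub>F \<kappa> in at_infinity. norm (s_mat q (cnj \<kappa>) - cmult_mat (sin (cnj \<kappa>)) (mat 1)) \<le> exp \<bar>Im \<kappa>\<bar> / 8"
  proof -
    obtain b where b: "\<And>\<kappa>. b \<le> norm \<kappa> \<Longrightarrow> norm (s_mat q \<kappa> - cmult_mat (sin \<kappa>) (mat 1)) \<le> 1/8 * exp \<bar>Im \<kappa>\<bar>"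
      using s_mat_asymptotics[OF q, of "1/8"] unfolding eventually_at_infinity by auto
    show ?thesis unfolding eventually_at_infinity
      by (intro exI[of _ b] allI impI) (use b[of "cnj _"] in simp)
  qed
  show ?thesis using ev
  proof (eventually_elim, intro impI allI)
    fix \<kappa> and X :: "complex^'m^'r"
    assume H: "norm (s_mat q (cnj \<kappa>) - cmult_mat (sin (cnj \<kappa>)) (mat 1)) \<le> exp \<bar>Im \<kappa>\<bar> / 8" and g: "good \<kappa>"
    have "adj (s_mat q (cnj \<kappa>)) - cmult_mat (sin \<kappa>) (mat 1) = adj (s_mat q (cnj \<kappa>) - cmult_mat (sin (cnj \<kappa>)) (mat 1))"
      by (simp add: adj_simps adj_mat_1 cnj_sin)
    then have "norm (adj (s_mat q (cnj \<kappa>)) - cmult_mat (sin \<kappa>) (mat 1)) \<le> exp \<bar>Im \<kappa>\<bar> / 8"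
      using H by (simp only: norm_adj)
    then have "(norm (sin \<kappa>) - exp \<bar>Im \<kappa>\<bar> / 8) * norm X \<le> norm (adj (s_mat q (cnj \<kappa>)) ** X)" by (rule norm_near_scalar)
    moreover have "exp \<bar>Im \<kappa>\<bar> / 8 * norm X \<le> (norm (sin \<kappa>) - exp \<bar>Im \<kappa>\<bar> / 8) * norm X"
      by (rule mult_right_mono) (use g in \<open>auto simp: good_def\<close>)
    ultimately show "exp \<bar>Im \<kappa>\<bar> / 8 * norm X \<le> norm (adj (s_mat q (cnj \<kappa>)) ** X)" by linarith
  qed
qed

lemma good_det:
  "\<forall>\<^sub>F \<kappa> in at_infinity. good \<kappa> \<longrightarrow> det (s_mat q \<kappa>) \<noteq> 0"
  using s_mat_lower_bound[where 'm=unit]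
proof (eventually_elim, intro impI notI)
  fix \<kappa> assume H: "good \<kappa> \<longrightarrow> (\<forall>X :: complex^unit^'r. exp \<bar>Im \<kappa>\<bar> / 8 * norm X \<le> norm (s_mat q \<kappa> ** X))"
    and g: "good \<kappa>" and d: "det (s_mat q \<kappa>) = 0"
  obtain V :: "complex^unit^'r" where V: "V \<noteq> 0" "s_mat q \<kappa> ** V = 0" using d det_0_iff_col by blast
  have "exp \<bar>Im \<kappa>\<bar> / 8 * norm V \<le> 0" using H g V(2) by (metis norm_zero)
  moreover have "exp \<bar>Im \<kappa>\<bar> / 8 * norm V > 0" using V(1) by simp
  ultimately show False by simp
qed

text \<open>Written as a combination of growing solutions, the Weyl solution hides its decay. Its
  value at 1 is of order \<open>exp (- \<bar>Im \<kappa>\<bar>)\<close>, and the backward estimate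
  from there costs at most \<open>exp (\<bar>Im \<kappa>\<bar> * (1 - x))\<close>.\<close>

lemma chi_bound:
  obtains C where "C > 0" "\<forall>\<^sub>F \<kappa> in at_infinity. good \<kappa> \<longrightarrow> (\<forall>x\<in>{0..1}. norm (chi_sol q x \<kappa>) \<le> C * exp (- (\<bar>Im \<kappa>\<bar> * x)))"
proof -
  let ?e = "exp (integral {0..1} (\<lambda>t. norm (Qm q (1 - t))))"
  define N where "N = norm (JJ ** adj (amat :: complex^('r+'r)^'r))"
  define C where "C = N * (8 * norm (mat 1 :: complex^'r^'r)) * ?e + 1"
  have C: "C > 0" by (simp add: C_def N_def add_nonneg_pos)
  have "\<forall>\<^sub>F \<kappa> in at_infinity. good \<kappa> \<longrightarrow> (\<forall>x\<in>{0..1}. norm (chi_sol q x \<kappa>) \<le> C * exp (- (\<bar>Im \<kappa>\<bar> * x)))"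
    using adj_s_mat_lower_bound[where 'm='r] good_det
  proof (eventually_elim, intro impI ballI)
    fix \<kappa> and x :: real
    assume H: "good \<kappa> \<longrightarrow> (\<forall>X :: complex^'r^'r. exp \<bar>Im \<kappa>\<bar> / 8 * norm X \<le> norm (adj (s_mat q (cnj \<kappa>)) ** X))"
      and d: "good \<kappa> \<longrightarrow> det (s_mat q \<kappa>) \<noteq> 0" and g: "good \<kappa>" and x: "x \<in> {0..1}"
    have dk: "det (s_mat q \<kappa>) \<noteq> 0" using d g by blast
    let ?b = "amat ** JJ ** chi_sol q 1 \<kappa>"
    have "exp \<bar>Im \<kappa>\<bar> / 8 * norm ?b \<le> norm (cmult_mat \<i> (mat 1 :: complex^'r^'r))"
      using H g chi_1_eq(1)[OF dk] by metis
    then have "norm ?b \<le> 8 * norm (mat 1 :: complex^'r^'r) * exp (- \<bar>Im \<kappa>\<bar>)"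
      by (simp add: norm_cmult_mat exp_minus field_simps)
    then have "norm (chi_sol q 1 \<kappa>) \<le> N * (8 * norm (mat 1 :: complex^'r^'r) * exp (- \<bar>Im \<kappa>\<bar>))"
      unfolding N_def
      by (subst chi_1_eq(2)[OF dk]) (rule order_trans[OF norm_matrix_mult], rule mult_left_mono, auto)
    then have "norm (chi_sol q 1 \<kappa>) * ?e * exp (\<bar>Im \<kappa>\<bar> * (1 - x)) \<le>
       N * (8 * norm (mat 1 :: complex^'r^'r) * exp (- \<bar>Im \<kappa>\<bar>)) * ?e * exp (\<bar>Im \<kappa>\<bar> * (1 - x))"
      by (intro mult_right_mono) auto
    then have "norm (chi_sol q x \<kappa>) \<le> N * (8 * norm (mat 1 :: complex^'r^'r) * exp (- \<bar>Im \<kappa>\<bar>)) * ?e * exp (\<bar>Im \<kappa>\<bar> * (1 - x))"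
      using lin_sol_bound_backward[OF L1_Qm[OF q] lin_sol_chi x, of \<kappa>] by linarith
    also have "\<dots> = (C - 1) * (exp (- \<bar>Im \<kappa>\<bar>) * exp (\<bar>Im \<kappa>\<bar> * (1 - x)))"
      by (simp add: C_def)
    also have "exp (- \<bar>Im \<kappa>\<bar>) * exp (\<bar>Im \<kappa>\<bar> * (1 - x)) = exp (- (\<bar>Im \<kappa>\<bar> * x))"
      unfolding exp_add[symmetric] by (simp add: algebra_simps)
    also have "(C - 1) * exp (- (\<bar>Im \<kappa>\<bar> * x)) \<le> C * exp (- (\<bar>Im \<kappa>\<bar> * x))" by (intro mult_right_mono) auto
    finally show "norm (chi_sol q x \<kappa>) \<le> C * exp (- (\<bar>Im \<kappa>\<bar> * x))" .
  qed
  with C show ?thesis using that by blast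
qed

lemma weyl_asymptotics:
  assumes e: "e > 0"
  shows "\<forall>\<^sub>F \<kappa> in at_infinity. good \<kappa> \<longrightarrow> norm (weyl q \<kappa> + cmult_mat (cot \<kappa>) (mat 1)) \<le> e"
proof -
  \<comment> \<open>Since \<open>cot\<close> is bounded by 4 at good points, the errors of
    \<open>s_mat\<close> and \<open>c_mat\<close> add up to five times \<open>e / 40\<close>, that
    is \<open>e / 8\<close>, which matches the lower bound \<open>?X / 8\<close>.\<close>
  have e': "e / 40 > 0" using e by simp
  show ?thesis using s_mat_asymptotics[OF q e'] s_mat_lower_bound[where 'm='r] good_det
  proof (eventually_elim, intro impI)
    fix \<kappa>
    let ?X = "exp \<bar>Im \<kappa>\<bar>"
    assume H: "norm (s_mat q \<kappa> - cmult_mat (sin \<kappa>) (mat 1)) \<le> e / 40 * ?X \<and>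
       norm (c_mat q \<kappa> - cmult_mat (cos \<kappa>) (mat 1)) \<le> e / 40 * ?X"
      and s: "good \<kappa> \<longrightarrow> (\<forall>X :: complex^'r^'r. ?X / 8 * norm X \<le> norm (s_mat q \<kappa> ** X))"
      and d: "good \<kappa> \<longrightarrow> det (s_mat q \<kappa>) \<noteq> 0" and g: "good \<kappa>"
    have sn: "?X \<le> 4 * norm (sin \<kappa>)" using g by (simp add: good_def)
    have "?X > 0" by simp
    then have s0: "norm (sin \<kappa>) > 0" using sn by linarith
    have cosb: "norm (cos \<kappa>) \<le> ?X"
    proof -
      have "norm (cos \<kappa>) = norm (exp (\<i> * \<kappa>) + exp (- (\<i> * \<kappa>))) / 2"
        by (simp add: cos_exp_eq norm_divide)
      also have "\<dots> \<le> (norm (exp (\<i> * \<kappa>)) + norm (exp (- (\<i> * \<kappa>)))) / 2"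
        by (intro divide_right_mono norm_triangle_ineq) simp
      also have "\<dots> \<le> ?X"
      proof -
        have "exp (- Im \<kappa>) \<le> ?X" "exp (Im \<kappa>) \<le> ?X" by simp_all
        then show ?thesis by (simp del: exp_le_cancel_iff)
      qed
      finally show ?thesis .
    qed
    have "norm (cos \<kappa>) \<le> 4 * norm (sin \<kappa>)" using cosb sn by linarith
    then have cotb: "norm (cot \<kappa>) \<le> 4" using s0 by (simp add: cot_def norm_divide divide_simps)
    let ?Y = "weyl q \<kappa> + cmult_mat (cot \<kappa>) (mat 1)"
    have sw: "s_mat q \<kappa> ** weyl q \<kappa> = - c_mat q \<kappa>"
      using d g by (simp add: weyl_def mm.minus_right matrix_mul_assoc matrix_inv_det)
    have "s_mat q \<kappa> ** ?Y = cmult_mat (cot \<kappa>) (s_mat q \<kappa>) - c_mat q \<kappa>"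
      by (simp add: mm.add_right sw cmult_mat_mult_right)
    also have "\<dots> = cmult_mat (cot \<kappa>) (s_mat q \<kappa> - cmult_mat (sin \<kappa>) (mat 1)) - (c_mat q \<kappa> - cmult_mat (cos \<kappa>) (mat 1))"
      using s0 by (simp add: cmult_mat_simps cot_def)
    also have "norm \<dots> \<le> 4 * (e / 40 * ?X) + e / 40 * ?X"
    proof (rule order_trans[OF norm_triangle_ineq4], rule add_mono)
      show "norm (cmult_mat (cot \<kappa>) (s_mat q \<kappa> - cmult_mat (sin \<kappa>) (mat 1))) \<le> 4 * (e / 40 * ?X)"
        unfolding norm_cmult_mat by (rule mult_mono) (use H cotb in auto)
    qed (use H in blast)
    finally have "norm (s_mat q \<kappa> ** ?Y) \<le> 4 * (e / 40 * ?X) + e / 40 * ?X" .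
    moreover have "?X / 8 * norm ?Y \<le> norm (s_mat q \<kappa> ** ?Y)" using s g by blast
    ultimately have "?X / 8 * norm ?Y \<le> 4 * (e / 40 * ?X) + e / 40 * ?X" by (rule order_trans[rotated])
    then have "?X * norm ?Y \<le> ?X * e" by simp
    then show "norm ?Y \<le> e" by simp
  qed
qed

end

section \<open>Zeros of the characteristic function\<close>

lemma mholo_const: "mholo (\<lambda>\<kappa>. C) S"
  by (simp add: mholo_def)

lemma mholo_mult: "mholo F S \<Longrightarrow> mholo G S \<Longrightarrow> mholo (\<lambda>\<kappa>. F \<kappa> ** G \<kappa>) S"
  unfolding mholo_def matrix_matrix_mult_def by (simp add: holomorphic_on_sum holomorphic_on_mult)

lemma mholo_minus: "mholo F S \<Longrightarrow> mholo (\<lambda>\<kappa>. - F \<kappa>) S"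
  unfolding mholo_def by (simp add: holomorphic_on_minus)

lemma mholo_subset: "mholo F S \<Longrightarrow> T \<subseteq> S \<Longrightarrow> mholo F T"
  unfolding mholo_def using holomorphic_on_subset by blast

lemma mholo_adj_cnj:
  assumes "mholo F UNIV" shows "mholo (\<lambda>\<kappa>. adj (F (cnj \<kappa>))) UNIV"
  unfolding mholo_def adj_nth
proof (intro allI)
  fix i j
  have "cnj \<circ> (\<lambda>\<kappa>. F \<kappa> $ j $ i) \<circ> cnj holomorphic_on UNIV"
    by (rule holomorphic_on_compose_cnj_cnj)
       (use assms in \<open>auto simp: mholo_def intro: holomorphic_on_subset\<close>)
  then show "(\<lambda>\<kappa>. cnj (F (cnj \<kappa>) $ j $ i)) holomorphic_on UNIV" by (simp add: o_def)
qed

lemma holomorphic_det: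
  assumes "mholo F S" shows "(\<lambda>\<kappa>. det (F \<kappa>)) holomorphic_on S"
  unfolding det_def using assms by (intro holomorphic_intros) (simp add: mholo_def)

text \<open>Cramer's rule writes the entries of the inverse as quotients of determinants, from which
  holomorphy of the inverse follows.\<close>

lemma matrix_inv_nth:
  fixes A :: "complex^'n^'n"
  assumes "det A \<noteq> 0"
  shows "matrix_inv A $ k $ l = det (\<chi> i j. if j = k then (if i = l then 1 else 0) else A $ i $ j) / det A"
proof -
  let ?x = "\<chi> k. matrix_inv A $ k $ l" and ?b = "(\<chi> i. if i = l then 1 else 0) :: complex^'n"
  have "A *v ?x = ?b"
  proof -
    have "(A *v ?x) $ i = (A ** matrix_inv A) $ i $ l" for i
      by (simp add: matrix_vector_mult_def matrix_matrix_mult_def)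
    then show ?thesis unfolding matrix_inv_det[OF assms] by (simp add: vec_eq_iff mat_def)
  qed
  then have "?x = (\<chi> k. det (\<chi> i j. if j = k then ?b $ i else A $ i $ j) / det A)"
    by (simp only: cramer[OF assms])
  then have "?x $ k = (\<chi> k. det (\<chi> i j. if j = k then ?b $ i else A $ i $ j) / det A) $ k" by (rule arg_cong)
  then show ?thesis by (simp only: vec_lambda_beta)
qed

lemma mholo_inv:
  assumes F: "mholo F S" and d: "\<And>\<kappa>. \<kappa> \<in> S \<Longrightarrow> det (F \<kappa>) \<noteq> 0"
  shows "mholo (\<lambda>\<kappa>. matrix_inv (F \<kappa>)) S"
  unfolding mholo_def
proof (intro allI)
  fix k l
  let ?G = "\<lambda>\<kappa>. \<chi> i j. if j = k then (if i = l then 1 else 0) else F \<kappa> $ i $ j"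
  have "(\<lambda>\<kappa>. if j = k then (if i = l then 1 else 0) else F \<kappa> $ i $ j) holomorphic_on S" for i j
    using F unfolding mholo_def by (cases "j = k") simp_all
  then have "mholo ?G S" unfolding mholo_def by simp
  then have "(\<lambda>\<kappa>. det (?G \<kappa>) / det (F \<kappa>)) holomorphic_on S"
    by (intro holomorphic_on_divide holomorphic_det F d)
  then show "(\<lambda>\<kappa>. matrix_inv (F \<kappa>) $ k $ l) holomorphic_on S"
    by (rule holomorphic_transform) (simp add: matrix_inv_nth[OF d])
qed

text \<open>The square of \<open>4 * norm (sin \<kappa>)\<close> is
  \<open>4 * (E + inverse E - 2 * cos (2 * Re \<kappa>))\<close>. This exceeds E at once when the
  cosine is -1; otherwise E is at least 3, and 4 E - 8 is at least E.\<close>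

lemma goodI:
  assumes "1 \<le> \<bar>Im \<kappa>\<bar> \<or> cos (2 * Re \<kappa>) = -1"
  shows "good \<kappa>"
proof -
  define E where "E = exp (2 * \<bar>Im \<kappa>\<bar>)"
  have ch: "exp (2 * Im \<kappa>) + inverse (exp (2 * Im \<kappa>)) = E + inverse E"
    unfolding E_def by (cases "Im \<kappa> \<ge> 0") (simp_all flip: exp_minus)
  have E1: "E > 0" "inverse E > 0" unfolding E_def by auto
  have "E \<le> 4 * (E + inverse E - 2 * cos (2 * Re \<kappa>))"
  proof (cases "cos (2 * Re \<kappa>) = -1")
    case True
    then show ?thesis using E1 by (simp add: algebra_simps)
  next
    case False
    then have "1 + 2 * \<bar>Im \<kappa>\<bar> \<le> E" "1 \<le> \<bar>Im \<kappa>\<bar>" unfolding E_def using assms exp_ge_add_one_self[of "2 * \<bar>Im \<kappa>\<bar>"] by auto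
    then have "E \<ge> 3" by linarith
    then show ?thesis using E1 cos_le_one[of "2 * Re \<kappa>"] by argo
  qed
  also have "\<dots> = (4 * norm (sin \<kappa>))\<^sup>2"
    unfolding power_mult_distrib norm_sin_squared ch by simp
  finally have "(exp \<bar>Im \<kappa>\<bar>)\<^sup>2 \<le> (4 * norm (sin \<kappa>))\<^sup>2"
    by (simp add: E_def exp_double)
  then show ?thesis unfolding good_def by (rule power2_le_imp_le) simp
qed

lemma cos_odd_pi: "cos (2 * (pi * of_int n + pi / 2)) = -1" "cos (2 * (pi * of_int n - pi / 2)) = -1"
proof -
  have "cos (of_int n * (2 * pi)) = 1" "sin (of_int n * (2 * pi)) = 0"
    using cos_int_2pin[of n] sin_int_2pin[of n] by (simp_all add: mult_ac)
  moreover have "2 * (pi * of_int n + pi / 2) = of_int n * (2 * pi) + pi" "2 * (pi * of_int n - pi / 2) = of_int n * (2 * pi) - pi"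
    by (simp_all add: algebra_simps)
  ultimately show "cos (2 * (pi * of_int n + pi / 2)) = -1" "cos (2 * (pi * of_int n - pi / 2)) = -1"
    by (simp_all only: cos_add cos_diff) simp_all
qed

text \<open>The trace of the integrand is the squared norm of \<open>Y t\<close>, a nonnegative
  continuous function; if its integral vanished, so would \<open>Y 0\<close>.\<close>

lemma integral_adj_self_pos:
  fixes Y :: "real \<Rightarrow> complex^'m^'n"
  assumes c: "continuous_on {0..1} Y" and Y0: "Y 0 \<noteq> 0"
  shows "integral {0..1} (\<lambda>t. adj (Y t) ** Y t) \<noteq> 0"
proof
  let ?T = "\<lambda>A :: complex^'m^'m. \<Sum>j\<in>UNIV. Re (A $ j $ j)"
  assume H: "integral {0..1} (\<lambda>t. adj (Y t) ** Y t) = 0"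
  have e: "?T (adj (Y t) ** Y t) = (norm (Y t))\<^sup>2" for t
  proof -
    have "Re ((adj (Y t) ** Y t) $ j $ j) = (\<Sum>i\<in>UNIV. (norm (Y t $ i $ j))\<^sup>2)" for j
      by (simp add: matrix_matrix_mult_def adj_nth mult.commute cmod_power2 flip: power2_eq_square)
    then show ?thesis unfolding norm_matrix_sq by (subst sum.swap) simp
  qed
  have bl: "bounded_linear ?T"
    by (intro bounded_linear_sum bounded_linear_compose[OF bounded_linear_Re bounded_linear_matrix_nth])
  have i: "(\<lambda>t. adj (Y t) ** Y t) integrable_on {0..1}"
    by (intro L1_integrable_01[OF L1_continuous] mm.continuous_on c bounded_linear.continuous_on[OF bounded_linear_adj])
  have "integral {0..1} (\<lambda>t. (norm (Y t))\<^sup>2) = ?T (integral {0..1} (\<lambda>t. adj (Y t) ** Y t))"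
    using integral_linear[OF i bl] unfolding o_def e .
  then have "integral {0..1} (\<lambda>t. (norm (Y t))\<^sup>2) = 0" using H by simp
  then have "\<forall>t\<in>{0..1}. (norm (Y t))\<^sup>2 = 0"
    by (subst (asm) integral_eq_0_iff) (auto intro!: continuous_intros c)
  then show False using Y0 by auto
qed

lemma theta_adj_amat_inject:
  fixes V :: "complex^'m^'r::finite"
  assumes "theta ** adj amat ** V = 0" shows "V = 0"
proof -
  have "amat ** adj theta ** (theta ** adj amat ** V) = V"
  proof -
    have "adj theta ** theta = (mat 1 :: complex^('r+'r)^('r+'r))"
      unfolding adj_theta by (simp add: i_JJ_theta)
    moreover have "amat ** adj theta ** (theta ** adj amat ** V) = amat ** (adj theta ** theta) ** adj amat ** V"
      by (simp only: matrix_mul_assoc)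
    ultimately show ?thesis by (simp add: amat_adj)
  qed
  then show ?thesis using assms by simp
qed

context
  fixes q :: "real \<Rightarrow> complex^'r::finite^'r"
  assumes q: "L1 q"
begin

lemma mholo_phi: "x \<in> {0..1} \<Longrightarrow> mholo (\<lambda>\<kappa>. phi_sol q x \<kappa>) UNIV"
  unfolding phi_sol_def by (intro mholo_mult mholo_const mholo_fund_sol q)

lemma mholo_s_mat: "mholo (s_mat q) UNIV"
  unfolding s_mat_def by (intro mholo_mult mholo_const mholo_phi) simp

lemma mholo_c_mat: "mholo (c_mat q) UNIV"
  unfolding c_mat_def psi_sol_def by (intro mholo_mult mholo_const mholo_fund_sol q) simp

lemma mholo_weyl: "mholo (weyl q) {\<kappa>. det (s_mat q \<kappa>) \<noteq> 0}"
  unfolding weyl_def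
  by (intro mholo_minus mholo_mult mholo_inv mholo_subset[OF mholo_s_mat] mholo_subset[OF mholo_c_mat]) auto

lemma s_mat_kernel_solution:
  assumes "s_mat q \<kappa> ** V = 0"
  shows "lin_sol (Qm q) \<kappa> (\<lambda>x. phi_sol q x \<kappa> ** V)" "amat ** (phi_sol q 0 \<kappa> ** V) = 0" "amat ** (phi_sol q 1 \<kappa> ** V) = 0"
  using assms by (simp_all add: lin_sol_mult[OF lin_sol_phi[OF q]] matrix_mul_assoc amat_phi_0[OF q] s_mat_def)

text \<open>The reality of the eigenvalues of a self-adjoint operator, seen on the solution: both
  boundary terms of the pairing vanish, which leaves \<open>\<kappa> - cnj \<kappa>\<close> times a
  nonzero integral.\<close>

lemma det_s_mat_real:
  assumes "det (s_mat q \<kappa>) = 0" shows "Im \<kappa> = 0"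
proof (rule ccontr)
  assume im: "Im \<kappa> \<noteq> 0"
  obtain V :: "complex^unit^'r" where V: "V \<noteq> 0" "s_mat q \<kappa> ** V = 0" using assms det_0_iff_col by blast
  let ?Y = "\<lambda>x. phi_sol q x \<kappa> ** V"
  note Y = s_mat_kernel_solution[OF V(2)]
  have "adj (?Y 1) ** JJ ** ?Y 1 = adj (?Y 0) ** JJ ** ?Y 0 +
    cmult_mat (\<i> * (\<kappa> - cnj \<kappa>)) (integral {0..1} (\<lambda>t. adj (?Y t) ** ?Y t))"
    by (rule pairing_eq[OF Y(1) Y(1)]) simp
  then have "cmult_mat (\<i> * (\<kappa> - cnj \<kappa>)) (integral {0..1} (\<lambda>t. adj (?Y t) ** ?Y t)) = 0"
    unfolding boundary_form Y(2,3) by (simp add: adj_simps)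
  then have "norm (\<i> * (\<kappa> - cnj \<kappa>)) * norm (integral {0..1} (\<lambda>t. adj (?Y t) ** ?Y t)) = 0"
    unfolding norm_cmult_mat[symmetric] by (simp only: norm_zero)
  moreover have "\<i> * (\<kappa> - cnj \<kappa>) \<noteq> 0" using im by (auto simp: complex_eq_iff)
  moreover have "integral {0..1} (\<lambda>t. adj (?Y t) ** ?Y t) \<noteq> 0"
  proof (rule integral_adj_self_pos[OF lin_sol_continuous[OF Y(1)]])
    show "?Y 0 \<noteq> 0" using theta_adj_amat_inject V(1) unfolding phi_0[OF q] by blast
  qed
  ultimately show False by simp
qed

text \<open>Without a zero in the box around \<open>\<pi> n\<close>, the function \<open>s(\<kappa>)\<^sup>-\<^sup>1 sin \<kappa> - I\<close> would be
  holomorphic there and small on the boundary, although it equals \<open>- I\<close> at the centre.\<close>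

lemma det_s_mat_zero_in_box:
  obtains b where "\<And>n :: int. b \<le> pi * \<bar>of_int n\<bar> \<Longrightarrow> \<exists>t :: real. det (s_mat q (of_real t)) = 0 \<and> \<bar>t - pi * of_int n\<bar> \<le> pi / 2"
proof -
  have "\<forall>\<^sub>F \<kappa> in at_infinity. (norm (s_mat q \<kappa> - cmult_mat (sin \<kappa>) (mat 1)) \<le> 1/16 * exp \<bar>Im \<kappa>\<bar>) \<and>
     (good \<kappa> \<longrightarrow> (\<forall>X :: complex^'r^'r. exp \<bar>Im \<kappa>\<bar> / 8 * norm X \<le> norm (s_mat q \<kappa> ** X)))"
    using s_mat_asymptotics[OF q, of "1/16", OF divide_pos_pos[OF zero_less_one zero_less_numeral]]
      s_mat_lower_bound[OF q, where 'm='r]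
    by eventually_elim blast
  then obtain b where b: "\<And>\<kappa>. b \<le> norm \<kappa> \<Longrightarrow> norm (s_mat q \<kappa> - cmult_mat (sin \<kappa>) (mat 1)) \<le> 1/16 * exp \<bar>Im \<kappa>\<bar>"
     "\<And>\<kappa> X. b \<le> norm \<kappa> \<Longrightarrow> good \<kappa> \<Longrightarrow> exp \<bar>Im \<kappa>\<bar> / 8 * norm (X :: complex^'r^'r) \<le> norm (s_mat q \<kappa> ** X)"
    unfolding eventually_at_infinity by blast
  have "\<exists>t :: real. det (s_mat q (of_real t)) = 0 \<and> \<bar>t - pi * of_int n\<bar> \<le> pi / 2"
    if n: "b + pi / 2 \<le> pi * \<bar>of_int n\<bar>" for n :: int
  proof -
    let ?a = "pi * of_int n"
    define S where "S = cbox (Complex (?a - pi / 2) (-1)) (Complex (?a + pi / 2) 1)"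
    have S: "\<kappa> \<in> S \<longleftrightarrow> \<bar>Re \<kappa> - ?a\<bar> \<le> pi / 2 \<and> \<bar>Im \<kappa>\<bar> \<le> 1" for \<kappa>
      unfolding S_def in_cbox_complex_iff abs_le_iff complex.sel atLeastAtMost_iff by linarith
    \<comment> \<open>The margin \<open>pi / 2\<close> in the condition on n pays for the half-width
      of the box.\<close>
    have big: "b \<le> norm \<kappa>" if "\<kappa> \<in> S" for \<kappa>
    proof -
      have "\<bar>Re \<kappa>\<bar> \<ge> \<bar>?a\<bar> - pi / 2" using that unfolding S by linarith
      moreover have "\<bar>?a\<bar> = pi * \<bar>of_int n\<bar>" by (simp add: abs_mult)
      ultimately show ?thesis using n abs_Re_le_cmod[of \<kappa>] by linarith
    qed
    have "\<exists>\<kappa>\<in>S. det (s_mat q \<kappa>) = 0"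
    proof (rule ccontr)
      assume "\<not> (\<exists>\<kappa>\<in>S. det (s_mat q \<kappa>) = 0)"
      then have nz: "\<And>\<kappa>. \<kappa> \<in> S \<Longrightarrow> det (s_mat q \<kappa>) \<noteq> 0" by blast
      \<comment> \<open>The maximum principle is applied to a scalar function; any diagonal entry
        will do.\<close>
      obtain k :: 'r where True by simp
      define f where "f \<kappa> = matrix_inv (s_mat q \<kappa>) $ k $ k * sin \<kappa> - 1" for \<kappa>
      have "mholo (\<lambda>\<kappa>. matrix_inv (s_mat q \<kappa>)) S" by (rule mholo_inv[OF mholo_subset[OF mholo_s_mat] nz]) auto
      then have hol: "f holomorphic_on S" unfolding f_def mholo_def by (intro holomorphic_intros) auto
      have "norm (f (of_real ?a)) \<le> 1/2"
      proof (rule maximum_modulus_frontier[of f S])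
        show "f holomorphic_on interior S" by (rule holomorphic_on_subset[OF hol interior_subset])
        show "continuous_on (closure S) f" using holomorphic_on_imp_continuous_on[OF hol] by (simp add: S_def)
        show "bounded S" by (simp add: S_def)
        show "of_real ?a \<in> S" by (simp add: S)
        fix \<kappa> assume fr: "\<kappa> \<in> frontier S"
        then have \<kappa>: "\<kappa> \<in> S" "\<kappa> \<notin> box (Complex (?a - pi / 2) (-1)) (Complex (?a + pi / 2) 1)"
          unfolding S_def frontier_cbox by auto
        have "1 \<le> \<bar>Im \<kappa>\<bar> \<or> Re \<kappa> = ?a + pi / 2 \<or> Re \<kappa> = ?a - pi / 2"
          using \<kappa> unfolding S in_box_complex_iff complex.sel greaterThanLessThan_iff by linarith
        then have "1 \<le> \<bar>Im \<kappa>\<bar> \<or> cos (2 * Re \<kappa>) = -1"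
          using cos_odd_pi[of n] by metis
        then have g: "good \<kappa>" by (rule goodI)
        let ?X = "exp \<bar>Im \<kappa>\<bar>"
        let ?Y = "matrix_inv (s_mat q \<kappa>) ** (cmult_mat (sin \<kappa>) (mat 1) - s_mat q \<kappa>)"
        have "s_mat q \<kappa> ** ?Y = cmult_mat (sin \<kappa>) (mat 1) - s_mat q \<kappa>"
          by (simp add: matrix_mul_assoc matrix_inv_det[OF nz[OF \<kappa>(1)]])
        note sY = this
        \<comment> \<open>The tolerance 1/16 against the lower bound 1/8 leaves 1/2, below the
          modulus 1 of f at the centre.\<close>
        have "?X / 8 * norm ?Y \<le> norm (s_mat q \<kappa> ** ?Y)" by (rule b(2)[OF big[OF \<kappa>(1)] g])
        also have "\<dots> \<le> 1/16 * ?X"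
          unfolding sY using b(1)[OF big[OF \<kappa>(1)]] by (simp add: norm_minus_commute)
        finally have "?X * norm ?Y \<le> ?X * (1/2)" by linarith
        then have Y: "norm ?Y \<le> 1/2" by (rule mult_left_le_imp_le) simp
        have "?Y = cmult_mat (sin \<kappa>) (matrix_inv (s_mat q \<kappa>)) - mat 1"
          by (simp add: mm.diff_right cmult_mat_mult_right matrix_inv_det[OF nz[OF \<kappa>(1)]])
        then have "f \<kappa> = ?Y $ k $ k" by (simp add: f_def cmult_mat_nth mat_def mult.commute)
        then show "norm (f \<kappa>) \<le> 1/2" using norm_matrix_nth[of ?Y k k] Y by simp
      qed
      moreover have "sin (complex_of_real ?a) = 0"
        unfolding sin_of_real by (simp add: sin_zero_iff_int2 mult.commute)
      then have "f (of_real ?a) = -1" by (simp add: f_def)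
      ultimately show False by simp
    qed
    then obtain \<kappa> where \<kappa>: "\<kappa> \<in> S" "det (s_mat q \<kappa>) = 0" by blast
    have "\<kappa> = of_real (Re \<kappa>)" using det_s_mat_real[OF \<kappa>(2)] by (simp add: complex_eq_iff)
    then show ?thesis using \<kappa> unfolding S by (intro exI[of _ "Re \<kappa>"]) auto
  qed
  then show ?thesis using that by blast
qed

text \<open>The determinant is entire and not constant: it vanishes somewhere in every distant box,
  but not at \<open>\<i>\<close>, its zeros being real.\<close>

lemma det_s_mat_zeros_finite: "finite {t \<in> {a..b}. det (s_mat q (complex_of_real t)) = 0}"
proof -
  let ?f = "\<lambda>\<kappa>. det (s_mat q \<kappa>)"
  have h: "?f holomorphic_on UNIV" by (rule holomorphic_det[OF mholo_s_mat])
  let ?K = "complex_of_real ` {a..b}"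
  have "finite {z \<in> ?K. ?f z = 0}"
  proof (rule holomorphic_compact_finite_zeros[OF h])
    show "compact ?K" by (intro compact_continuous_image continuous_intros) auto
    show "\<not> ?f constant_on UNIV"
    proof
      assume "?f constant_on UNIV"
      then obtain c where c: "\<And>z. ?f z = c" unfolding constant_on_def by auto
      have "?f \<i> \<noteq> 0" using det_s_mat_real[of \<i>] by auto
      then have "?f z \<noteq> 0" for z using c by simp
      moreover obtain b' where "\<And>n :: int. b' \<le> pi * \<bar>of_int n\<bar> \<Longrightarrow> \<exists>t :: real. ?f (of_real t) = 0 \<and> \<bar>t - pi * of_int n\<bar> \<le> pi / 2"
        using det_s_mat_zero_in_box by blast
      moreover obtain n :: nat where "b' \<le> real n * pi" using reals_Archimedean3[OF pi_gt_zero] less_imp_le by blast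
      moreover have "b' \<le> pi * \<bar>of_int (int n)\<bar>" using \<open>b' \<le> real n * pi\<close> by (simp add: mult.commute)
      ultimately show False by blast
    qed
  qed auto
  then have "finite (complex_of_real ` {t \<in> {a..b}. ?f (complex_of_real t) = 0})"
    by (rule rev_finite_subset) auto
  then show ?thesis by (rule finite_imageD) (auto intro: inj_onI)
qed

end

section \<open>Two-sided enumerations of discrete sets of reals\<close>

lemma int_enumeration_unique:
  fixes l l' :: "int \<Rightarrow> real"
  assumes l: "strict_mono l" "l 0 \<le> 0" "0 < l 1" and l': "strict_mono l'" "l' 0 \<le> 0" "0 < l' 1"
    and r: "range l = range l'"
  shows "l = l'"
proof
  fix j
  \<comment> \<open>Index 1 is the anchor of the induction in both directions: the sign conditions
    make the value there the least positive element of the common range.\<close>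
  have le1: "f 1 \<le> g 1" if f: "strict_mono f" "f 0 \<le> 0" and g: "0 < g 1" and r: "range f = range g" for f g :: "int \<Rightarrow> real"
  proof -
    have "g 1 \<in> range f" unfolding r by simp
    then obtain i where i: "g 1 = f i" by blast
    have "f 0 < f i" using f(2) g i by linarith
    then have "1 \<le> i" by (simp add: strict_mono_less[OF f(1)])
    then show ?thesis unfolding i by (simp add: strict_mono_less_eq[OF f(1)])
  qed
  have up: "f (j + 1) \<le> g (j + 1)" if f: "strict_mono f" and g: "strict_mono g" and r: "range f = range g" and e: "f j = g j"
    for f g :: "int \<Rightarrow> real" and j
  proof -
    have "g (j + 1) \<in> range f" unfolding r by simp
    then obtain i where i: "g (j + 1) = f i" by blast
    have "f j < f i" unfolding e i[symmetric] by (simp add: strict_mono_less[OF g])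
    then have "j + 1 \<le> i" by (simp add: strict_mono_less[OF f])
    then show ?thesis unfolding i by (simp add: strict_mono_less_eq[OF f])
  qed
  have dn: "g (j - 1) \<le> f (j - 1)" if f: "strict_mono f" and g: "strict_mono g" and r: "range f = range g" and e: "f j = g j"
    for f g :: "int \<Rightarrow> real" and j
  proof -
    have "g (j - 1) \<in> range f" unfolding r by simp
    then obtain i where i: "g (j - 1) = f i" by blast
    have "f i < f j" unfolding e i[symmetric] by (simp add: strict_mono_less[OF g])
    then have "i \<le> j - 1" by (simp add: strict_mono_less[OF f])
    then show ?thesis unfolding i by (simp add: strict_mono_less_eq[OF f])
  qed
  show "l j = l' j"
  proof (induction j rule: int_induct[where k = 1])
    case base
    show ?case using le1[OF l(1,2) l'(3) r] le1[OF l'(1,2) l(3) r[symmetric]] by (rule antisym)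
  next
    case (step1 j)
    show ?case using up[OF l(1) l'(1) r step1(2)] up[OF l'(1) l(1) r[symmetric] step1(2)[symmetric]] by (rule antisym)
  next
    case (step2 j)
    show ?case using dn[OF l'(1) l(1) r[symmetric] step2(2)[symmetric]] dn[OF l(1) l'(1) r step2(2)] by (rule antisym)
  qed
qed

text \<open>Local finiteness and unboundedness on both sides provide a successor \<open>nx\<close>
  and a predecessor \<open>pv\<close> in S. Both are defined at every real, so that 0 can serve as a
  starting point without belonging to S.\<close>

lemma int_enumeration_exists:
  fixes S :: "real set"
  assumes fin: "\<And>a b. finite (S \<inter> {a..b})" and up: "\<And>b. \<exists>s\<in>S. b < s" and dn: "\<And>b. \<exists>s\<in>S. s < b"
  shows "\<exists>l :: int \<Rightarrow> real. strict_mono l \<and> range l = S \<and> l 0 \<le> 0 \<and> 0 < l 1"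
proof -
  have "\<exists>y. y \<in> S \<and> x < y \<and> (\<forall>s\<in>S. x < s \<longrightarrow> y \<le> s)" for x
  proof -
    obtain z where z: "z \<in> S" "x < z" using up by blast
    have f: "finite (S \<inter> {x<..z})" by (rule finite_subset[OF _ fin[of x z]]) auto
    have m: "Min (S \<inter> {x<..z}) \<in> S \<inter> {x<..z}" by (rule Min_in[OF f]) (use z in auto)
    have "Min (S \<inter> {x<..z}) \<le> s" if "s \<in> S" "x < s" for s
    proof (cases "s \<le> z")
      case True
      then show ?thesis using that by (intro Min_le[OF f]) auto
    next
      case False
      then show ?thesis using m by auto
    qed
    then show ?thesis using m by (intro exI[of _ "Min (S \<inter> {x<..z})"]) auto
  qed
  then obtain nx where nx: "\<And>x. nx x \<in> S" "\<And>x. x < nx x" "\<And>x s. s \<in> S \<Longrightarrow> x < s \<Longrightarrow> nx x \<le> s"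
    by metis
  have "\<exists>y. y \<in> S \<and> y < x \<and> (\<forall>s\<in>S. s < x \<longrightarrow> s \<le> y)" for x
  proof -
    obtain z where z: "z \<in> S" "z < x" using dn by blast
    have f: "finite (S \<inter> {z..<x})" by (rule finite_subset[OF _ fin[of z x]]) auto
    have m: "Max (S \<inter> {z..<x}) \<in> S \<inter> {z..<x}" by (rule Max_in[OF f]) (use z in auto)
    have "s \<le> Max (S \<inter> {z..<x})" if "s \<in> S" "s < x" for s
    proof (cases "z \<le> s")
      case True
      then show ?thesis using that by (intro Max_ge[OF f]) auto
    next
      case False
      then show ?thesis using m by auto
    qed
    then show ?thesis using m by (intro exI[of _ "Max (S \<inter> {z..<x})"]) auto
  qed
  then obtain pv where pv: "\<And>x. pv x \<in> S" "\<And>x. pv x < x" "\<And>x s. s \<in> S \<Longrightarrow> s < x \<Longrightarrow> s \<le> pv x"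
    by metis
  have nxpv: "nx (pv a) = a" if "a \<in> S" for a
  proof (rule antisym)
    show "nx (pv a) \<le> a" by (rule nx(3)[OF that pv(2)])
    show "a \<le> nx (pv a)"
    proof (rule ccontr)
      assume "\<not> a \<le> nx (pv a)"
      then have "nx (pv a) \<le> pv a" by (intro pv(3) nx(1)) simp
      then show False using nx(2)[of "pv a"] by simp
    qed
  qed
  \<comment> \<open>\<open>nx 0\<close> is the least positive element and \<open>pv (nx 0)\<close>
    the greatest one below it, hence at most 0; this is the normalisation in
    \<open>eigval\<close>.\<close>
  define l :: "int \<Rightarrow> real" where "l j = (if 1 \<le> j then (nx ^^ nat (j - 1)) (nx 0) else (pv ^^ nat (- j)) (pv (nx 0)))" for j
  have inS1: "(nx ^^ n) (nx 0) \<in> S" for n by (cases n) (auto simp: nx(1))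
  have inS2: "(pv ^^ n) (pv (nx 0)) \<in> S" for n by (cases n) (auto simp: pv(1))
  have inS: "l j \<in> S" for j using inS1 inS2 by (simp add: l_def)
  have step: "l (j + 1) = nx (l j)" for j
  proof (cases "1 \<le> j")
    case True
    then have "nat (j + 1 - 1) = Suc (nat (j - 1))" by simp
    then show ?thesis using True by (simp add: l_def)
  next
    case False
    have "l j = pv (l (j + 1))"
    proof (cases "j = 0")
      case True
      then show ?thesis by (simp add: l_def)
    next
      case False
      then have "nat (- j) = Suc (nat (- (j + 1)))" "\<not> 1 \<le> j + 1" using \<open>\<not> 1 \<le> j\<close> by simp_all
      then show ?thesis using \<open>\<not> 1 \<le> j\<close> by (simp add: l_def)
    qed
    then show ?thesis using nxpv[OF inS] by simp
  qed
  have lt: "l i < l j" if "i < j" for i j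
    using that
  proof (induction j rule: int_gr_induct)
    case base
    then show ?case using nx(2) by (simp add: step)
  next
    case (step j)
    then show ?case using nx(2)[of "l j"] \<open>\<And>j. l (j + 1) = nx (l j)\<close>[of j] by simp
  qed
  then have mono: "strict_mono l" by (rule strict_monoI)
  have l1: "0 < l 1" using nx(2)[of 0] by (simp add: l_def)
  have l0: "l 0 \<le> 0"
  proof (rule ccontr)
    assume "\<not> l 0 \<le> 0"
    then have "nx 0 \<le> pv (nx 0)" by (intro nx(3) pv(1)) (simp add: l_def)
    then show False using pv(2)[of "nx 0"] by simp
  qed
  have "s \<in> range l" if s: "s \<in> S" for s
  proof (rule ccontr)
    assume ns: "s \<notin> range l"
    then have ne: "l j \<noteq> s" for j by blast
    \<comment> \<open>A skipped element s would confine infinitely many values of l between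
      \<open>l 0\<close> and s, against local finiteness; c is 1 or -1 for the two
      directions.\<close>
    have inf: "\<not> range (\<lambda>n :: nat. l (c * int n)) \<subseteq> S \<inter> {a..b}" if "c \<noteq> 0" for c a b
    proof
      assume H: "range (\<lambda>n. l (c * int n)) \<subseteq> S \<inter> {a..b}"
      have "inj (\<lambda>n :: nat. l (c * int n))"
        using that strict_mono_eq[OF mono] by (intro injI) simp
      then show False using finite_subset[OF H fin] finite_imageD infinite_UNIV_nat by blast
    qed
    show False
    proof (cases "l 0 < s")
      case True
      have "l (int n) < s" for n
      proof (induction n)
        case (Suc n)
        then show ?case using nx(3)[OF s Suc] step[of "int n"] ne[of "int n + 1"] by (simp add: add.commute)
      qed (use True in simp)
      moreover have "l 0 \<le> l (int n)" for n by (simp add: strict_mono_less_eq[OF mono])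
      ultimately show False using inf[of 1 "l 0" s] inS by (auto simp: less_imp_le)
    next
      case False
      have "s < l (- int n)" for n
      proof (induction n)
        case 0
        then show ?case using False ne[of 0] by simp
      next
        case (Suc n)
        have "\<not> l (- int (Suc n)) < s"
        proof
          assume "l (- int (Suc n)) < s"
          then have "nx (l (- int (Suc n))) \<le> s" by (rule nx(3)[OF s])
          then show False using step[of "- int (Suc n)"] Suc by simp
        qed
        then show ?case using ne[of "- int (Suc n)"] by simp
      qed
      moreover have "l (- int n) \<le> l 0" for n by (simp add: strict_mono_less_eq[OF mono])
      ultimately show False using inf[of "-1" s "l 0"] inS by (auto simp: less_imp_le)
    qed
  qed
  then have "range l = S" using inS by blast
  with mono l0 l1 show ?thesis by blast
qed

section \<open>Eigenvalues\<close>

lemma dirac_eq_vec_iff: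
  fixes w u :: "complex^('r::finite+'r)"
  shows "theta *v w + bold A *v u = \<mu> *s u \<longleftrightarrow>
    w = (cmult_mat (\<i> * \<mu>) JJ + - cmult_mat \<i> (JJ ** bold A)) *v u"
proof -
  have inj: "to_col v = to_col v' \<longleftrightarrow> v = v'" for v v' :: "complex^('r+'r)"
    by (auto simp: to_col_def vec_eq_iff)
  have add: "to_col v + to_col v' = to_col (v + v')" and mul: "cmult_mat \<mu> (to_col v) = to_col (\<mu> *s v)"
    for v v' :: "complex^('r+'r)"
    by (simp_all add: to_col_def vec_eq_iff cmult_mat_nth)
  show ?thesis
    using dirac_eq_iff[of "to_col w" A "to_col u" \<mu>] unfolding mult_to_col add mul inj .
qed

lemma bounded_linear_to_col: "bounded_linear (to_col :: complex^'n \<Rightarrow> complex^unit^'n)"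
  unfolding linear_conv_bounded_linear[symmetric]
  by (rule linearI) (auto simp: to_col_def vec_eq_iff)

definition from_col :: "complex^unit^'n \<Rightarrow> complex^'n" where
  "from_col V = (\<chi> i. V $ i $ ())"

lemma bounded_linear_from_col: "bounded_linear (from_col :: complex^unit^'n \<Rightarrow> complex^'n)"
  unfolding linear_conv_bounded_linear[symmetric]
  by (rule linearI) (auto simp: from_col_def vec_eq_iff)

lemma from_col_mult: "from_col (A ** V) = A *v from_col V"
  by (simp add: from_col_def matrix_matrix_mult_def matrix_vector_mult_def vec_eq_iff)

lemma to_col_from_col: "to_col (from_col V) = V"
  unfolding from_col_def by (rule of_col[symmetric])

lemma bounded_linear_comps:
  "bounded_linear (fst_comp :: complex^('r::finite+'r) \<Rightarrow> complex^'r)"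
  "bounded_linear (snd_comp :: complex^('r::finite+'r) \<Rightarrow> complex^'r)"
  unfolding linear_conv_bounded_linear[symmetric]
  by (rule linearI; auto simp: fst_comp_def snd_comp_def vec_eq_iff)+

lemma ac_deriv_from_comps:
  fixes y :: "real \<Rightarrow> complex^('r::finite+'r)"
  assumes "(\<lambda>x. fst_comp (y x)) \<in> W11" "(\<lambda>x. snd_comp (y x)) \<in> W11"
  shows "\<exists>g. ac_deriv y g"
proof -
  let ?f = "\<lambda>v :: complex^'r. (\<chi> i. case i of Inl k \<Rightarrow> v $ k | Inr k \<Rightarrow> 0) :: complex^('r+'r)"
  let ?s = "\<lambda>v :: complex^'r. (\<chi> i. case i of Inl k \<Rightarrow> 0 | Inr k \<Rightarrow> v $ k) :: complex^('r+'r)"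
  have bl: "bounded_linear ?f" "bounded_linear ?s"
    unfolding linear_conv_bounded_linear[symmetric]
    by (rule linearI; auto simp: vec_eq_iff split: sum.split)+
  obtain g1 g2 where g: "ac_deriv (\<lambda>x. fst_comp (y x)) g1" "ac_deriv (\<lambda>x. snd_comp (y x)) g2"
    using assms unfolding W11_iff by blast
  have y: "?f (fst_comp v) + ?s (snd_comp v) = v" for v :: "complex^('r+'r)"
    by (auto simp: vec_eq_iff fst_comp_def snd_comp_def split: sum.split)
  from ac_deriv_add[OF ac_deriv_linear[OF bl(1) g(1)] ac_deriv_linear[OF bl(2) g(2)]]
  show ?thesis unfolding y by blast
qed

lemma amat_to_col_eq_0:
  fixes v :: "complex^('r::finite+'r)"
  shows "amat ** to_col v = 0 \<longleftrightarrow> fst_comp v = snd_comp v"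
proof -
  have "(amat *v v) $ k = (fst_comp v $ k - snd_comp v $ k) / complex_of_real (sqrt 2)" for k
  proof -
    have "(amat *v v) $ k = (\<Sum>l\<in>UNIV. if l = k then v $ Inl k / complex_of_real (sqrt 2) else 0) +
       (\<Sum>l\<in>UNIV. if l = k then - v $ Inr k / complex_of_real (sqrt 2) else 0)"
      unfolding matrix_vector_mult_def vec_lambda_beta sum_UNIV_Plus
      by (intro arg_cong2[of _ _ _ _ "(+)"] sum.cong refl) (auto simp: amat_nth)
    then show ?thesis by (simp add: fst_comp_def snd_comp_def diff_divide_distrib)
  qed
  then have "amat *v v = 0 \<longleftrightarrow> (\<forall>k. fst_comp v $ k = snd_comp v $ k)"
    by (simp add: vec_eq_iff)
  then show ?thesis unfolding mult_to_col to_col_eq_0 by (simp add: vec_eq_iff)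
qed

lemma continuous_AE_zero:
  fixes y :: "real \<Rightarrow> 'a::euclidean_space"
  assumes c: "continuous_on {0..1} y" and z: "AE x in unit_leb. y x = 0" and x: "x \<in> {0..1}"
  shows "y x = 0"
proof -
  have N: "negligible {x \<in> {0..1}. y x \<noteq> 0}" using z unfolding AE_unit_leb by simp
  have "integral {0..1} (\<lambda>x. norm (y x)) = integral {0..1} (\<lambda>x::real. 0::real)"
    by (rule integral_spike[OF N]) auto
  then have "integral {0..1} (\<lambda>x. norm (y x)) = 0" by simp
  then have "\<forall>x\<in>{0..1}. norm (y x) = 0"
    by (subst (asm) integral_eq_0_iff) (auto intro!: continuous_intros c)
  then show ?thesis using x by simp
qed

text \<open>For an eigenfunction \<open>dirac_expr\<close> is known only almost everywhere, where it
  equals a continuous multiple of the eigenfunction; square integrability passes through that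
  representative.\<close>

lemma Lp_fun_2_spike:
  fixes f g :: "real \<Rightarrow> 'a::euclidean_space"
  assumes g: "continuous_on {0..1} g" and ae: "AE x in unit_leb. f x = g x"
  shows "f \<in> Lp_fun 2"
proof -
  have N: "negligible {x \<in> {0..1}. f x \<noteq> g x}" using ae unfolding AE_unit_leb .
  have "L1 f" by (rule absolutely_integrable_spike[OF L1_continuous[OF g] N]) auto
  then have "integrable unit_leb f" by (simp add: integrable_unit_leb)
  then have m: "f \<in> borel_measurable unit_leb" by (rule borel_measurable_integrable)
  have "L1 (\<lambda>x. norm (f x) powr 2)"
  proof (rule absolutely_integrable_spike[OF L1_continuous N])
    have "norm (g x) powr 2 = (norm (g x))\<^sup>2" for x by (cases "g x = 0") simp_all
    then show "continuous_on {0..1} (\<lambda>x. norm (g x) powr 2)" by (simp only:) (intro continuous_intros g)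
  qed auto
  then have "integrable unit_leb (\<lambda>x. norm (f x) powr 2)" by (simp add: integrable_unit_leb)
  with m show ?thesis unfolding Lp_fun_def by blast
qed

context
  fixes q :: "real \<Rightarrow> complex^'r::finite^'r"
  assumes q: "L1 q"
begin

text \<open>By \<open>amat_complete\<close> an initial value killed by \<open>amat\<close> lies in
  the range of \<open>JJ ** adj amat\<close>, which is the range of \<open>phi_sol\<close> at 0;
  uniqueness of solutions does the rest.\<close>

lemma lin_sol_eq_phi:
  fixes Y :: "real \<Rightarrow> complex^'m^('r+'r)"
  assumes Y: "lin_sol (Qm q) \<kappa> Y" and Y0: "amat ** Y 0 = 0"
  obtains V where "Y 0 = theta ** adj amat ** V" "\<And>x. x \<in> {0..1} \<Longrightarrow> Y x = phi_sol q x \<kappa> ** V"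
proof -
  let ?V = "cmult_mat \<i> (amat ** JJ ** Y 0)"
  have "Y 0 = (adj amat ** amat + JJ ** adj amat ** amat ** JJ) ** Y 0" unfolding amat_complete by simp
  also have "\<dots> = adj amat ** (amat ** Y 0) + JJ ** adj amat ** (amat ** JJ ** Y 0)"
    by (simp add: mm.add_left matrix_mul_assoc)
  also have "\<dots> = theta ** adj amat ** ?V"
    unfolding Y0 by (simp add: theta_eq cmult_mat_mult_left cmult_mat_mult_right cmult_mat_simps)
  finally have "\<exists>V. Y 0 = theta ** adj amat ** V" by (rule exI)
  then obtain V where 0: "Y 0 = theta ** adj amat ** V" by (rule exE)
  have "Y x = phi_sol q x \<kappa> ** V" if "x \<in> {0..1}" for x
    by (rule lin_sol_unique[OF L1_Qm[OF q] Y lin_sol_mult[OF lin_sol_phi[OF q]] _ that]) (simp only: phi_0[OF q] 0)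
  with 0 show ?thesis using that by blast
qed

text \<open>A kernel vector V of \<open>s_mat q \<mu>\<close> corresponds to the eigenfunction
  \<open>phi_sol q x \<mu> ** V\<close>: the condition at 0 is built into \<open>phi_sol\<close>,
  and the one at 1 is the kernel equation.\<close>

lemma eigenvalues_iff: "\<mu> \<in> eigenvalues q \<longleftrightarrow> det (s_mat q \<mu>) = 0"
proof
  assume "\<mu> \<in> eigenvalues q"
  then obtain y where y: "y \<in> dirac_dom q" "\<not> (AE x in unit_leb. y x = 0)"
    "AE x in unit_leb. dirac_expr q y x = \<mu> *s y x" unfolding eigenvalues_def by blast
  obtain g where "ac_deriv y g" using ac_deriv_from_comps[of y] y(1) by (auto simp: dirac_dom_def)
  then have w: "ac_deriv y (wderiv y)" by (rule ac_deriv_wderiv)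
  have N: "negligible {x \<in> {0..1}. wderiv y x \<noteq> (cmult_mat (\<i> * \<mu>) JJ + Qm q x) *v y x}"
    using y(3) unfolding AE_unit_leb dirac_expr_def dirac_eq_vec_iff Qm_def .
  have "ac_deriv y (\<lambda>x. (cmult_mat (\<i> * \<mu>) JJ + Qm q x) *v y x)"
    by (rule ac_deriv_spike[OF w N]) auto
  from ac_deriv_linear[OF bounded_linear_to_col this]
  have Y: "lin_sol (Qm q) \<mu> (\<lambda>x. to_col (y x))" by (simp add: lin_sol_def mult_to_col)
  have b: "amat ** to_col (y 0) = 0" "amat ** to_col (y 1) = 0"
    unfolding amat_to_col_eq_0 using y(1) by (auto simp: dirac_dom_def)
  obtain V where V: "\<And>x. x \<in> {0..1} \<Longrightarrow> to_col (y x) = phi_sol q x \<mu> ** V"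
    using lin_sol_eq_phi[OF Y b(1)] by blast
  have "V \<noteq> 0"
  proof
    assume "V = 0"
    then have "\<And>x. x \<in> {0..1} \<Longrightarrow> y x = 0" using V by (simp add: to_col_eq_0)
    then have e: "{x \<in> {0..1}. y x \<noteq> 0} = {}" by blast
    have "AE x in unit_leb. y x = 0" unfolding AE_unit_leb e by simp
    then show False using y(2) by blast
  qed
  moreover have "s_mat q \<mu> ** V = 0"
    using b(2) V[of 1] by (simp add: s_mat_def matrix_mul_assoc)
  ultimately show "det (s_mat q \<mu>) = 0" using det_0_iff_col by blast
next
  assume "det (s_mat q \<mu>) = 0"
  then obtain V :: "complex^unit^'r" where V: "V \<noteq> 0" "s_mat q \<mu> ** V = 0" using det_0_iff_col by blast
  let ?Y = "\<lambda>x. phi_sol q x \<mu> ** V" and ?y = "\<lambda>x. from_col (phi_sol q x \<mu> ** V)"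
  note Y = s_mat_kernel_solution[OF q V(2)]
  have y: "ac_deriv ?y (\<lambda>x. (cmult_mat (\<i> * \<mu>) JJ + Qm q x) *v ?y x)"
    using ac_deriv_linear[OF bounded_linear_from_col Y(1)[unfolded lin_sol_def]] by (simp add: from_col_mult)
  have c: "continuous_on {0..1} ?y" by (rule ac_deriv_continuous[OF y])
  have "negligible {x \<in> {0..1}. wderiv ?y x \<noteq> (cmult_mat (\<i> * \<mu>) JJ + Qm q x) *v ?y x}"
    by (rule ac_deriv_AE_unique[OF ac_deriv_wderiv[OF y] y])
  then have ae: "AE x in unit_leb. dirac_expr q ?y x = \<mu> *s ?y x"
    unfolding AE_unit_leb dirac_expr_def dirac_eq_vec_iff Qm_def .
  have cs: "continuous_on {0..1} (\<lambda>x. \<mu> *s ?y x)"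
  proof -
    have "\<mu> *s v = cmult_mat \<mu> (mat 1) *v v" for v :: "complex^('r+'r)"
      by (auto simp: vec_eq_iff matrix_vector_mult_def cmult_mat_nth mat_def if_distrib if_distribR cong: if_cong)
    then show ?thesis by (simp only:) (intro mv.continuous_on continuous_intros c)
  qed
  have "?y \<in> dirac_dom q"
    unfolding dirac_dom_def
  proof (intro CollectI conjI)
    show "(\<lambda>x. fst_comp (?y x)) \<in> W11" "(\<lambda>x. snd_comp (?y x)) \<in> W11"
      unfolding W11_iff using ac_deriv_linear[OF _ y] bounded_linear_comps by blast+
    show "dirac_expr q ?y \<in> Lp_fun 2" by (rule Lp_fun_2_spike[OF cs ae])
    show "fst_comp (?y 0) = snd_comp (?y 0)" "fst_comp (?y 1) = snd_comp (?y 1)"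
      using Y(2,3) unfolding amat_to_col_eq_0[symmetric] to_col_from_col by simp_all
  qed
  moreover have "\<not> (AE x in unit_leb. ?y x = 0)"
  proof
    assume "AE x in unit_leb. ?y x = 0"
    then have "?y 0 = 0" by (rule continuous_AE_zero[OF c]) simp
    then have "to_col (?y 0) = 0" unfolding to_col_eq_0 .
    then have "?Y 0 = 0" unfolding to_col_from_col .
    then show False using theta_adj_amat_inject V(1) unfolding phi_0[OF q] by blast
  qed
  ultimately show "\<mu> \<in> eigenvalues q"
    unfolding eigenvalues_def by (intro CollectI bexI[of _ ?y] conjI ae)
qed

text \<open>Existence and uniqueness of the enumeration resolve the description in
  \<open>eigval\<close>; from here on the eigenvalues enter as the zero set of the determinant of
  \<open>s_mat\<close>.\<close>

lemma eigval_spec: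
  "strict_mono (eigval q)" "range (\<lambda>j. complex_of_real (eigval q j)) = {\<kappa>. det (s_mat q \<kappa>) = 0}"
proof -
  define S where "S = {t :: real. det (s_mat q (complex_of_real t)) = 0}"
  have E: "eigenvalues q = complex_of_real ` S"
  proof -
    have "\<mu> \<in> complex_of_real ` S" if "det (s_mat q \<mu>) = 0" for \<mu>
    proof -
      have \<mu>: "\<mu> = complex_of_real (Re \<mu>)" using det_s_mat_real[OF q that] by (simp add: complex_eq_iff)
      have "det (s_mat q (complex_of_real (Re \<mu>))) = 0" using that by (simp only: \<mu>[symmetric])
      then show ?thesis unfolding S_def by (intro image_eqI[of _ _ "Re \<mu>"] \<mu> CollectI)
    qed
    then show ?thesis using eigenvalues_iff by (auto simp: S_def)
  qed
  have fin: "finite (S \<inter> {a..b})" for a b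
    by (rule finite_subset[OF _ det_s_mat_zeros_finite[OF q, of a b]]) (auto simp: S_def)
  obtain b0 where b0: "\<And>n :: int. b0 \<le> pi * \<bar>of_int n\<bar> \<Longrightarrow> \<exists>t :: real. det (s_mat q (of_real t)) = 0 \<and> \<bar>t - pi * of_int n\<bar> \<le> pi / 2"
    using det_s_mat_zero_in_box[OF q] by blast
  have big: "\<exists>n :: nat. c \<le> pi * real n" for c
  proof -
    obtain n where "c < real n * pi" using reals_Archimedean3[OF pi_gt_zero] by blast
    then show ?thesis by (intro exI[of _ n]) (simp add: mult.commute)
  qed
  have up: "\<exists>s\<in>S. b < s" for b
  proof -
    \<comment> \<open>Large enough to reach the boxes that contain a zero and, as the zero is within
      \<open>pi / 2\<close> of \<open>pi * n\<close>, to put it beyond b.\<close>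
    obtain n :: nat where n: "\<bar>b0\<bar> + \<bar>b\<bar> + pi \<le> pi * real n" using big by blast
    have "b0 \<le> pi * \<bar>of_int (int n)\<bar>" using n pi_gt_zero by (simp; linarith)
    then obtain t where "det (s_mat q (complex_of_real t)) = 0" "\<bar>t - pi * of_int (int n)\<bar> \<le> pi / 2" using b0 by blast
    moreover from this(2) have "b < t" using n pi_gt_zero by (simp; linarith)
    ultimately show ?thesis unfolding S_def by blast
  qed
  have dn: "\<exists>s\<in>S. s < b" for b
  proof -
    obtain n :: nat where n: "\<bar>b0\<bar> + \<bar>b\<bar> + pi \<le> pi * real n" using big by blast
    have "b0 \<le> pi * \<bar>of_int (- int n)\<bar>" using n pi_gt_zero by (simp; linarith)
    then obtain t where "det (s_mat q (complex_of_real t)) = 0" "\<bar>t - pi * of_int (- int n)\<bar> \<le> pi / 2" using b0 by blast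
    moreover from this(2) have "t < b" using n pi_gt_zero by (simp; linarith)
    ultimately show ?thesis unfolding S_def by blast
  qed
  have eqv: "range (\<lambda>j. complex_of_real (l j)) = eigenvalues q \<longleftrightarrow> range l = S" for l :: "int \<Rightarrow> real"
  proof -
    have "range (\<lambda>j. complex_of_real (l j)) = complex_of_real ` range l" by auto
    then show ?thesis unfolding E by (simp add: inj_image_eq_iff inj_on_def)
  qed
  obtain l :: "int \<Rightarrow> real" where l: "strict_mono l" "range l = S" "l 0 \<le> 0" "0 < l 1"
    using int_enumeration_exists[OF fin up dn] by blast
  have "eigval q = l"
    unfolding eigval_def eqv
  proof (rule the_equality)
    show "l' = l" if "strict_mono l' \<and> range l' = S \<and> l' 0 \<le> 0 \<and> 0 < l' 1" for l'
      using int_enumeration_unique[of l' l] that l by simp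
  qed (use l in simp)
  then show "strict_mono (eigval q)" "range (\<lambda>j. complex_of_real (eigval q j)) = {\<kappa>. det (s_mat q \<kappa>) = 0}"
    using l eqv[of l] eigenvalues_iff by auto
qed

end

section \<open>Simple poles and uniqueness of the Weyl function\<close>

lemma mholo_tendsto:
  assumes "mholo F UNIV" "\<kappa>s \<longlonglongrightarrow> \<kappa>0"
  shows "(\<lambda>n. F (\<kappa>s n)) \<longlonglongrightarrow> F \<kappa>0"
proof (intro vec_tendstoI)
  fix i j
  have "continuous_on UNIV (\<lambda>\<kappa>. F \<kappa> $ i $ j)"
    using assms(1) by (auto simp: mholo_def intro: holomorphic_on_imp_continuous_on)
  then show "(\<lambda>n. F (\<kappa>s n) $ i $ j) \<longlonglongrightarrow> F \<kappa>0 $ i $ j"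
    by (rule continuous_on_tendsto_compose[OF _ assms(2)]) auto
qed

context
  fixes q :: "real \<Rightarrow> complex^'r::finite^'r"
  assumes q: "L1 q"
begin

text \<open>If the estimate failed along some sequence, a limit vector \<open>V\<close> would lie in the kernel of
  \<open>s_mat q \<kappa>0\<close>, and the pairing of the corresponding eigenfunction with the approximating
  solutions would force its \<open>L\<^sub>2\<close> norm to vanish.\<close>

lemma s_mat_linear_lower_bound:
  assumes real: "Im \<kappa>0 = 0"
  obtains c d where "c > 0" "d > 0"
    "\<And>\<kappa> (V :: complex^'m^'r). norm (\<kappa> - \<kappa>0) < d \<Longrightarrow> c * norm (\<kappa> - \<kappa>0) * norm V \<le> norm (s_mat q \<kappa> ** V)"
proof -
  have "\<exists>n :: nat. \<forall>\<kappa> (V :: complex^'m^'r). norm (\<kappa> - \<kappa>0) < 1 / real (Suc n) \<longrightarrow>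
    1 / real (Suc n) * norm (\<kappa> - \<kappa>0) * norm V \<le> norm (s_mat q \<kappa> ** V)"
  proof (rule ccontr)
    assume neg: "\<not> ?thesis"
    \<comment> \<open>Failure for every n, after normalisation of V, gives one sequence along which
      the distance to \<open>\<kappa>0\<close> and the constant in the bound both tend to 0.\<close>
    have "\<exists>\<kappa> (V :: complex^'m^'r). norm V = 1 \<and> norm (\<kappa> - \<kappa>0) < 1 / real (Suc n) \<and>
      norm (s_mat q \<kappa> ** V) < 1 / real (Suc n) * norm (\<kappa> - \<kappa>0)" for n
    proof -
      obtain \<kappa> and V :: "complex^'m^'r" where kV: "norm (\<kappa> - \<kappa>0) < 1 / real (Suc n)"
         "norm (s_mat q \<kappa> ** V) < 1 / real (Suc n) * norm (\<kappa> - \<kappa>0) * norm V"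
        using neg unfolding not_ex not_all not_imp not_le by blast
      have V0: "norm V > 0" using kV(2) by (cases "V = 0") auto
      let ?W = "(1 / norm V) *\<^sub>R V"
      have "norm (s_mat q \<kappa> ** ?W) = norm (s_mat q \<kappa> ** V) / norm V" by (simp add: mm.scaleR_right divide_inverse_commute)
      also have "\<dots> < 1 / real (Suc n) * norm (\<kappa> - \<kappa>0)" using kV(2) V0 by (simp add: pos_divide_less_eq)
      finally show ?thesis using kV(1) V0 by (intro exI[of _ \<kappa>] exI[of _ ?W]) simp
    qed
    then obtain \<kappa>s and Vs :: "nat \<Rightarrow> complex^'m^'r" where s:
      "\<And>n. norm (Vs n) = 1" "\<And>n. norm (\<kappa>s n - \<kappa>0) < 1 / real (Suc n)"
      "\<And>n. norm (s_mat q (\<kappa>s n) ** Vs n) < 1 / real (Suc n) * norm (\<kappa>s n - \<kappa>0)"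
      by metis
    have "compact (sphere (0 :: complex^'m^'r) 1)" by simp
    then have "seq_compact (sphere (0 :: complex^'m^'r) 1)" by (simp add: compact_eq_seq_compact_metric)
    then obtain V r where V: "V \<in> sphere (0 :: complex^'m^'r) 1" and r: "strict_mono r" and lim: "(Vs \<circ> r) \<longlonglongrightarrow> V"
      using s(1) unfolding seq_compact_def by (metis mem_sphere_0)
    have V1: "norm V = 1" using V by simp
    define \<epsilon> where "\<epsilon> n = 1 / real (Suc (r n))" for n
    define k where "k n = \<kappa>s (r n)" for n
    define W where "W n = Vs (r n)" for n
    have \<epsilon>0: "\<epsilon> \<longlonglongrightarrow> 0" unfolding \<epsilon>_def using LIMSEQ_subseq_LIMSEQ[OF LIMSEQ_Suc[OF lim_1_over_n] r] by (simp add: o_def)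
    have kb: "norm (k n - \<kappa>0) < \<epsilon> n" and Wb: "norm (W n) = 1" and sb: "norm (s_mat q (k n) ** W n) < \<epsilon> n * norm (k n - \<kappa>0)" for n
      using s[of "r n"] by (simp_all add: k_def W_def \<epsilon>_def)
    have W: "W \<longlonglongrightarrow> V" using lim by (simp add: W_def[abs_def] o_def)
    have k: "k \<longlonglongrightarrow> \<kappa>0"
    proof (rule LIM_zero_cancel, rule Lim_null_comparison[OF _ \<epsilon>0])
      show "\<forall>\<^sub>F n in sequentially. norm (k n - \<kappa>0) \<le> \<epsilon> n" using kb by (intro always_eventually allI less_imp_le)
    qed
    have \<epsilon>1: "\<epsilon> n \<le> 1" for n by (simp add: \<epsilon>_def)
    have sV: "s_mat q \<kappa>0 ** V = 0"
    proof (rule LIMSEQ_unique)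
      show "(\<lambda>n. s_mat q (k n) ** W n) \<longlonglongrightarrow> s_mat q \<kappa>0 ** V"
        by (intro mm.tendsto mholo_tendsto[OF mholo_s_mat[OF q] k] W)
      show "(\<lambda>n. s_mat q (k n) ** W n) \<longlonglongrightarrow> 0"
      proof (rule Lim_null_comparison[OF _ \<epsilon>0], intro always_eventually allI)
        fix n
        have "norm (k n - \<kappa>0) \<le> 1" using kb[of n] \<epsilon>1[of n] by simp
        then have "\<epsilon> n * norm (k n - \<kappa>0) \<le> \<epsilon> n" by (intro mult_left_le) (auto simp: \<epsilon>_def)
        then show "norm (s_mat q (k n) ** W n) \<le> \<epsilon> n" using sb[of n] by simp
      qed
    qed
    let ?Y = "\<lambda>x. phi_sol q x \<kappa>0 ** V" and ?Z = "\<lambda>n x. phi_sol q x (k n) ** W n"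
    note Y = s_mat_kernel_solution[OF q sV]
    have Yc: "continuous_on {0..1} ?Y" by (rule lin_sol_continuous[OF Y(1)])
    have Z: "lin_sol (Qm q) (k n) (?Z n)" for n by (rule lin_sol_mult[OF lin_sol_phi[OF q]])
    let ?I = "\<lambda>n. integral {0..1} (\<lambda>t. adj (?Y t) ** ?Z n t)"
    let ?B = "norm (adj (amat ** JJ ** ?Y 1))"
    \<comment> \<open>For real \<open>\<kappa>0\<close> the factor in the pairing identity is
      \<open>k n - \<kappa>0\<close>. Only the boundary term with
      \<open>s_mat q (k n) ** W n\<close> survives, and it is small compared with this
      factor.\<close>
    have cnj0: "cnj \<kappa>0 = \<kappa>0" using real by (simp add: complex_eq_iff)
    have Ib: "norm (?I n) \<le> ?B * \<epsilon> n" for n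
    proof -
      have "adj (?Y 1) ** JJ ** ?Z n 1 = adj (?Y 0) ** JJ ** ?Z n 0 + cmult_mat (\<i> * (k n - cnj \<kappa>0)) (?I n)"
        by (rule pairing_eq[OF Y(1) Z]) simp
      moreover have "amat ** ?Z n 0 = 0" "amat ** ?Z n 1 = s_mat q (k n) ** W n"
        by (simp_all add: matrix_mul_assoc amat_phi_0[OF q] s_mat_def)
      ultimately have "cmult_mat (\<i> * (k n - \<kappa>0)) (?I n) = adj (amat ** JJ ** ?Y 1) ** (s_mat q (k n) ** W n)"
        unfolding boundary_form cnj0 by (simp add: Y(2,3) adj_simps)
      then have "norm (cmult_mat (\<i> * (k n - \<kappa>0)) (?I n)) \<le> ?B * norm (s_mat q (k n) ** W n)"
        by (simp only: norm_matrix_mult)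
      also have "\<dots> \<le> ?B * (\<epsilon> n * norm (k n - \<kappa>0))" by (rule mult_left_mono) (use sb[of n] in auto)
      finally have "norm (k n - \<kappa>0) * norm (?I n) \<le> norm (k n - \<kappa>0) * (?B * \<epsilon> n)"
        by (simp add: norm_cmult_mat norm_mult mult_ac)
      \<comment> \<open>The strict inequality in \<open>sb\<close> excludes
        \<open>k n = \<kappa>0\<close>, so the factor may be cancelled.\<close>
      moreover have "norm (k n - \<kappa>0) > 0"
        using sb[of n] norm_ge_zero[of "s_mat q (k n) ** W n"] by (cases "k n = \<kappa>0") (auto simp del: norm_ge_zero)
      ultimately show ?thesis by simp
    qed
    have "?I \<longlonglongrightarrow> 0"
    proof (rule Lim_null_comparison)
      show "\<forall>\<^sub>F n in sequentially. norm (?I n) \<le> ?B * \<epsilon> n" using Ib by simp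
      show "(\<lambda>n. ?B * \<epsilon> n) \<longlonglongrightarrow> 0" using tendsto_mult_left[OF \<epsilon>0, of ?B] by simp
    qed
    moreover have "?I \<longlonglongrightarrow> integral {0..1} (\<lambda>t. adj (?Y t) ** ?Y t)"
    proof -
      obtain L where L: "L > 0" "\<And>\<mu> x. norm (\<mu> - \<kappa>0) \<le> 1 \<Longrightarrow> x \<in> {0..1} \<Longrightarrow>
          norm (fund_sol q \<mu> x - fund_sol q \<kappa>0 x) \<le> L * norm (\<mu> - \<kappa>0)"
        using fund_sol_lipschitz[OF q] by blast
      let ?T = "norm (theta ** adj (amat :: complex^('r+'r)^'r))"
      have pc: "continuous_on {0..1} (\<lambda>x. phi_sol q x \<kappa>0)" by (rule lin_sol_continuous[OF lin_sol_phi[OF q]])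
      have "bounded ((\<lambda>x. phi_sol q x \<kappa>0) ` {0..1})" "bounded (?Y ` {0..1})"
        by (rule compact_imp_bounded[OF compact_continuous_image[OF pc]], simp)
           (rule compact_imp_bounded[OF compact_continuous_image[OF Yc]], simp)
      then obtain M N where M: "\<And>x. x \<in> {0..1} \<Longrightarrow> norm (phi_sol q x \<kappa>0) \<le> M" and N: "\<And>x. x \<in> {0..1} \<Longrightarrow> norm (?Y x) \<le> N"
        unfolding bounded_iff by blast
      \<comment> \<open>The first summand pays for moving the spectral parameter, the second for
        moving the vector.\<close>
      define \<delta> where "\<delta> n = L * norm (k n - \<kappa>0) * ?T + M * norm (W n - V)" for n
      have Zb: "norm (?Z n x - ?Y x) \<le> \<delta> n" if x: "x \<in> {0..1}" for n x
      proof -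
        have k1: "norm (k n - \<kappa>0) \<le> 1" using kb[of n] \<epsilon>1[of n] by simp
        have "phi_sol q x (k n) - phi_sol q x \<kappa>0 = (fund_sol q (k n) x - fund_sol q \<kappa>0 x) ** (theta ** adj amat)"
          by (simp add: phi_sol_def mm.diff_left matrix_mul_assoc)
        then have a: "norm (phi_sol q x (k n) - phi_sol q x \<kappa>0) \<le> L * norm (k n - \<kappa>0) * ?T"
          using order_trans[OF norm_matrix_mult mult_right_mono[OF L(2)[OF k1 x], of ?T]] by simp
        have "?Z n x - ?Y x = (phi_sol q x (k n) - phi_sol q x \<kappa>0) ** W n + phi_sol q x \<kappa>0 ** (W n - V)"
          by (simp add: mm.diff_left mm.diff_right)
        also have "norm \<dots> \<le> norm (phi_sol q x (k n) - phi_sol q x \<kappa>0) * norm (W n) + norm (phi_sol q x \<kappa>0) * norm (W n - V)"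
          by (intro order_trans[OF norm_triangle_ineq] add_mono norm_matrix_mult)
        also have "\<dots> \<le> \<delta> n" unfolding \<delta>_def Wb by (intro add_mono mult_right_mono M x) (use a in auto)
        finally show ?thesis .
      qed
      have \<delta>0: "\<delta> \<longlonglongrightarrow> 0"
      proof -
        have "(\<lambda>n. L * norm (k n - \<kappa>0) * ?T + M * norm (W n - V)) \<longlonglongrightarrow> L * 0 * ?T + M * 0"
          by (intro tendsto_intros tendsto_norm_zero LIM_zero k W)
        then show ?thesis by (simp add: \<delta>_def[abs_def])
      qed
      have Zc: "continuous_on {0..1} (?Z n)" for n by (rule lin_sol_continuous[OF Z])
      have ii: "(\<lambda>t. adj (?Y t) ** F t) integrable_on {0..1}" if "continuous_on {0..1} F" for F :: "real \<Rightarrow> complex^'m^('r+'r)"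
        by (intro L1_integrable_01[OF L1_continuous] mm.continuous_on that bounded_linear.continuous_on[OF bounded_linear_adj] Yc)
      show ?thesis
      proof (rule LIM_zero_cancel, rule Lim_null_comparison)
        show "\<forall>\<^sub>F n in sequentially. norm (?I n - integral {0..1} (\<lambda>t. adj (?Y t) ** ?Y t)) \<le> N * \<delta> n"
        proof (intro always_eventually allI)
          fix n
          have "?I n - integral {0..1} (\<lambda>t. adj (?Y t) ** ?Y t) = integral {0..1} (\<lambda>t. adj (?Y t) ** (?Z n t - ?Y t))"
            unfolding mm.diff_right[of "adj _"] by (rule integral_diff[OF ii[OF Zc] ii[OF Yc], symmetric])
          also have "norm \<dots> \<le> N * \<delta> n"
            by (rule integral_adj_mult_bound[OF Yc _ _ N Zb]) (auto intro!: continuous_intros Zc Yc)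
          finally show "norm (?I n - integral {0..1} (\<lambda>t. adj (?Y t) ** ?Y t)) \<le> N * \<delta> n" .
        qed
        show "(\<lambda>n. N * \<delta> n) \<longlonglongrightarrow> 0" using tendsto_mult_left[OF \<delta>0, of N] by simp
      qed
    qed
    ultimately have "integral {0..1} (\<lambda>t. adj (?Y t) ** ?Y t) = 0" by (rule LIMSEQ_unique[symmetric])
    moreover have "?Y 0 \<noteq> 0"
    proof
      assume "?Y 0 = 0"
      then have "V = 0" using theta_adj_amat_inject unfolding phi_0[OF q] by blast
      then show False using V1 by simp
    qed
    ultimately show False using integral_adj_self_pos[OF Yc] by blast
  qed
  then obtain n :: nat where n: "\<And>\<kappa> (V :: complex^'m^'r). norm (\<kappa> - \<kappa>0) < 1 / real (Suc n) \<Longrightarrow>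
    1 / real (Suc n) * norm (\<kappa> - \<kappa>0) * norm V \<le> norm (s_mat q \<kappa> ** V)" by blast
  show ?thesis by (rule that[of "1 / real (Suc n)" "1 / real (Suc n)"]) (use n in auto)
qed

lemma det_s_mat_zeros_finite_cbox: "finite ({\<kappa>. det (s_mat q \<kappa>) = 0} \<inter> cbox a b)"
proof (rule finite_subset)
  show "{\<kappa>. det (s_mat q \<kappa>) = 0} \<inter> cbox a b \<subseteq> complex_of_real ` {t \<in> {Re a..Re b}. det (s_mat q (complex_of_real t)) = 0}"
  proof
    fix \<kappa> assume \<kappa>: "\<kappa> \<in> {\<kappa>. det (s_mat q \<kappa>) = 0} \<inter> cbox a b"
    then have r: "\<kappa> = complex_of_real (Re \<kappa>)" using det_s_mat_real[OF q, of \<kappa>] by (simp add: complex_eq_iff)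
    then have "det (s_mat q (complex_of_real (Re \<kappa>))) = 0" using \<kappa> by simp
    then show "\<kappa> \<in> complex_of_real ` {t \<in> {Re a..Re b}. det (s_mat q (complex_of_real t)) = 0}"
      using \<kappa> by (intro image_eqI[of _ _ "Re \<kappa>"] r) (auto simp: in_cbox_complex_iff)
  qed
qed (intro finite_imageI det_s_mat_zeros_finite[OF q])

lemma det_s_mat_zeros_isolated:
  obtains d where "d > 0" "\<And>\<kappa>. \<kappa> \<in> ball \<kappa>0 d - {\<kappa>0} \<Longrightarrow> det (s_mat q \<kappa>) \<noteq> 0"
proof -
  let ?X = "{\<kappa>. det (s_mat q \<kappa>) = 0} \<inter> cbox (\<kappa>0 - Complex 1 1) (\<kappa>0 + Complex 1 1)"
  obtain d where d: "d > 0" "\<forall>x\<in>?X. x \<noteq> \<kappa>0 \<longrightarrow> d \<le> dist \<kappa>0 x"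
    using finite_set_avoid[OF det_s_mat_zeros_finite_cbox] by blast
  show ?thesis
  proof (rule that[of "min d 1"])
    fix \<kappa> assume \<kappa>: "\<kappa> \<in> ball \<kappa>0 (min d 1) - {\<kappa>0}"
    then have "norm (\<kappa> - \<kappa>0) < 1" by (simp add: dist_norm norm_minus_commute)
    then have "\<bar>Re \<kappa> - Re \<kappa>0\<bar> \<le> 1" "\<bar>Im \<kappa> - Im \<kappa>0\<bar> \<le> 1"
      using abs_Re_le_cmod[of "\<kappa> - \<kappa>0"] abs_Im_le_cmod[of "\<kappa> - \<kappa>0"] by auto
    then have "\<kappa> \<in> cbox (\<kappa>0 - Complex 1 1) (\<kappa>0 + Complex 1 1)"
      unfolding in_cbox_complex_iff by simp linarith
    then show "det (s_mat q \<kappa>) \<noteq> 0" using \<kappa> d(2) by fastforce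
  qed (use d in simp)
qed

text \<open>The linear lower bound for \<open>s_mat\<close>, applied to the columns of the Weyl
  function itself, bounds \<open>weyl q \<kappa>\<close> times \<open>\<kappa> - \<kappa>0\<close>
  near \<open>\<kappa>0\<close>. By Riemann's theorem this product extends holomorphically, and its
  value at \<open>\<kappa>0\<close> is the residue.\<close>

lemma weyl_simple_pole:
  assumes "det (s_mat q \<kappa>0) = 0"
  shows "((\<lambda>\<kappa>. weyl q \<kappa> $ k $ l * (\<kappa> - \<kappa>0)) \<longlongrightarrow> residue (\<lambda>\<kappa>. weyl q \<kappa> $ k $ l) \<kappa>0) (at \<kappa>0)"
proof -
  let ?f = "\<lambda>\<kappa>. weyl q \<kappa> $ k $ l"
  obtain d where d: "d > 0" "\<And>\<kappa>. \<kappa> \<in> ball \<kappa>0 d - {\<kappa>0} \<Longrightarrow> det (s_mat q \<kappa>) \<noteq> 0"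
    using det_s_mat_zeros_isolated by blast
  have sub: "ball \<kappa>0 d - {\<kappa>0} \<subseteq> {\<kappa>. det (s_mat q \<kappa>) \<noteq> 0}" using d(2) by blast
  have hol: "?f holomorphic_on ball \<kappa>0 d - {\<kappa>0}"
    using mholo_subset[OF mholo_weyl[OF q] sub] by (simp add: mholo_def)
  obtain c d' where c: "c > 0" "d' > 0" "\<And>\<kappa> (V :: complex^'r^'r). norm (\<kappa> - \<kappa>0) < d' \<Longrightarrow> c * norm (\<kappa> - \<kappa>0) * norm V \<le> norm (s_mat q \<kappa> ** V)"
    using s_mat_linear_lower_bound[where 'm='r, of \<kappa>0] det_s_mat_real[OF q assms] by blast
  have "isCont (\<lambda>\<kappa>. c_mat q \<kappa>) \<kappa>0"
    unfolding continuous_at_sequentially o_def using mholo_tendsto[OF mholo_c_mat[OF q]] by blast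
  then have "\<forall>\<^sub>F \<kappa> in at \<kappa>0. dist (c_mat q \<kappa>) (c_mat q \<kappa>0) < 1" by (simp add: isCont_def tendsto_iff)
  then have cb: "\<forall>\<^sub>F \<kappa> in at \<kappa>0. norm (c_mat q \<kappa>) \<le> norm (c_mat q \<kappa>0) + 1"
  proof eventually_elim
    case (elim \<kappa>)
    then show ?case
      using norm_triangle_sub[of "c_mat q \<kappa>" "c_mat q \<kappa>0"] by (simp add: dist_norm)
  qed
  have e1: "\<forall>\<^sub>F \<kappa> in at \<kappa>0. \<kappa> \<in> ball \<kappa>0 (min d d') - {\<kappa>0}"
    using d(1) c(2) by (intro eventually_at_in_open) auto
  have "\<forall>\<^sub>F \<kappa> in at \<kappa>0. norm (?f \<kappa> * (\<kappa> - \<kappa>0)) \<le> (norm (c_mat q \<kappa>0) + 1) / c"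
    using cb e1
  proof eventually_elim
    case (elim \<kappa>)
    have dk: "det (s_mat q \<kappa>) \<noteq> 0" by (rule d(2)) (use elim in auto)
    have kd: "norm (\<kappa> - \<kappa>0) < d'" using elim by (simp add: dist_norm norm_minus_commute)
    have "s_mat q \<kappa> ** weyl q \<kappa> = - c_mat q \<kappa>"
      by (simp add: weyl_def mm.minus_right matrix_mul_assoc matrix_inv_det[OF dk])
    then have "c * norm (\<kappa> - \<kappa>0) * norm (weyl q \<kappa>) \<le> norm (c_mat q \<kappa>0) + 1"
      using c(3)[OF kd, of "weyl q \<kappa>"] elim(1) by simp
    moreover have "c * norm (?f \<kappa> * (\<kappa> - \<kappa>0)) \<le> c * norm (\<kappa> - \<kappa>0) * norm (weyl q \<kappa>)"
      using norm_matrix_nth[of "weyl q \<kappa>" k l] c(1) by (simp add: norm_mult mult.commute mult_left_mono)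
    ultimately have "c * norm (?f \<kappa> * (\<kappa> - \<kappa>0)) \<le> norm (c_mat q \<kappa>0) + 1" by (rule order_trans[rotated])
    then show ?case unfolding pos_le_divide_eq[OF c(1)] by (simp only: mult.commute)
  qed
  then have "\<exists>B. \<forall>\<^sub>F \<kappa> in at \<kappa>0. norm (?f \<kappa> * (\<kappa> - \<kappa>0)) \<le> B" by blast
  moreover have "(\<lambda>\<kappa>. ?f \<kappa> * (\<kappa> - \<kappa>0)) holomorphic_on ball \<kappa>0 d - {\<kappa>0}" by (intro holomorphic_intros hol)
  ultimately obtain g where g: "g holomorphic_on ball \<kappa>0 d" "\<And>\<kappa>. \<kappa> \<in> ball \<kappa>0 d - {\<kappa>0} \<Longrightarrow> g \<kappa> = ?f \<kappa> * (\<kappa> - \<kappa>0)"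
    using holomorphic_on_extend_bounded[of "\<lambda>\<kappa>. ?f \<kappa> * (\<kappa> - \<kappa>0)" "ball \<kappa>0 d" \<kappa>0] d(1) by auto
  have "isCont g \<kappa>0"
    using holomorphic_on_imp_continuous_on[OF g(1)] d(1) by (simp add: continuous_on_eq_continuous_at)
  then have "(g \<longlongrightarrow> g \<kappa>0) (at \<kappa>0)" by (simp add: isCont_def)
  then have lim: "((\<lambda>\<kappa>. ?f \<kappa> * (\<kappa> - \<kappa>0)) \<longlongrightarrow> g \<kappa>0) (at \<kappa>0)"
    by (rule Lim_transform_within_open[of _ _ _ _ "ball \<kappa>0 d"]) (use d(1) g(2) in auto)
  moreover have "residue ?f \<kappa>0 = g \<kappa>0"
    by (rule residue_simple'[OF open_ball _ hol lim]) (use d(1) in simp)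
  ultimately show ?thesis by simp
qed

end

text \<open>Good points fill the boundaries of arbitrarily large squares: on the vertical sides
  \<open>cos (2 * R) = -1\<close>, on the horizontal ones \<open>\<bar>Im z\<bar>\<close> is at
  least 1. The maximum principle carries the bound inwards. With empty X this is a statement about
  entire functions.\<close>

lemma bounded_by_good_bound:
  fixes f :: "complex \<Rightarrow> complex"
  assumes hol: "f holomorphic_on - X" and fin: "\<And>a b. finite (X \<inter> cbox a b)"
    and rem: "\<And>z. z \<in> X \<Longrightarrow> f \<in> O[at z](\<lambda>_. 1)"
    and ev: "\<forall>\<^sub>F \<kappa> in at_infinity. good \<kappa> \<longrightarrow> \<kappa> \<notin> X \<and> norm (f \<kappa>) \<le> B"
    and \<kappa>: "\<kappa> \<notin> X"
  shows "norm (f \<kappa>) \<le> B"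
proof -
  obtain b where b: "\<And>\<kappa>. b \<le> norm \<kappa> \<Longrightarrow> good \<kappa> \<Longrightarrow> \<kappa> \<notin> X \<and> norm (f \<kappa>) \<le> B"
    using ev unfolding eventually_at_infinity by blast
  obtain n :: nat where n: "\<bar>b\<bar> + norm \<kappa> + 1 < real n * pi" using reals_Archimedean3[OF pi_gt_zero] by blast
  define R where "R = pi * real n + pi / 2"
  have R: "R \<ge> 1" "R \<ge> b" "R > norm \<kappa>"
    using n pi_gt_zero norm_ge_zero[of \<kappa>] unfolding R_def mult.commute[of pi] by linarith+
  have cosR: "cos (2 * R) = -1" using cos_odd_pi(1)[of "int n"] by (simp add: R_def)
  let ?S = "cbox (Complex (- R) (- R)) (Complex R R)"
  have fr: "good z \<and> b \<le> norm z" if "z \<in> frontier ?S" for z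
  proof -
    have z: "z \<in> ?S" "z \<notin> box (Complex (- R) (- R)) (Complex R R)" using that unfolding frontier_cbox by auto
    then have "\<bar>Re z\<bar> = R \<or> \<bar>Im z\<bar> = R"
      unfolding in_box_complex_iff in_cbox_complex_iff complex.sel greaterThanLessThan_iff atLeastAtMost_iff by linarith
    then show ?thesis
    proof
      assume h: "\<bar>Re z\<bar> = R"
      have "cos (2 * Re z) = cos \<bar>2 * Re z\<bar>" by simp
      also have "\<dots> = -1" using h cosR by (simp only: abs_mult abs_numeral)
      finally have "good z" by (intro goodI) simp
      then show ?thesis using h R abs_Re_le_cmod[of z] by simp
    next
      assume h: "\<bar>Im z\<bar> = R"
      then have "good z" using R by (intro goodI) simp
      then show ?thesis using h R abs_Im_le_cmod[of z] by simp
    qed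
  qed
  let ?X = "X \<inter> ?S"
  \<comment> \<open>The boundary consists of good points of large modulus, which avoid X, so all
    singularities to be removed lie inside.\<close>
  have "?X \<subseteq> interior ?S"
  proof
    fix z assume z: "z \<in> ?X"
    then have "z \<notin> frontier ?S" using fr[of z] b[of z] by blast
    then show "z \<in> interior ?S" using z by (auto simp: frontier_def)
  qed
  moreover have "f holomorphic_on (?S - ?X)" by (rule holomorphic_on_subset[OF hol]) auto
  ultimately obtain g where g: "g holomorphic_on ?S" "\<And>z. z \<in> ?S - ?X \<Longrightarrow> g z = f z"
    using removable_singularities[OF fin[of "Complex (- R) (- R)" "Complex R R"], of ?S f] rem by blast
  have \<kappa>S: "\<kappa> \<in> ?S" using R abs_Re_le_cmod[of \<kappa>] abs_Im_le_cmod[of \<kappa>] unfolding in_cbox_complex_iff by auto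
  have "norm (g \<kappa>) \<le> B"
  proof (rule maximum_modulus_frontier[of g ?S])
    show "g holomorphic_on interior ?S" by (rule holomorphic_on_subset[OF g(1) interior_subset])
    show "continuous_on (closure ?S) g" using holomorphic_on_imp_continuous_on[OF g(1)] by simp
    fix z assume z: "z \<in> frontier ?S"
    then have "z \<in> ?S" unfolding frontier_cbox by auto
    then show "norm (g z) \<le> B" using g(2)[of z] fr[OF z] b[of z] by auto
  qed (use \<kappa>S in auto)
  then show ?thesis using g(2)[of \<kappa>] \<kappa>S \<kappa> by simp
qed

lemma weyl_determined:
  fixes q1 q2 :: "real \<Rightarrow> complex^'r::finite^'r"
  assumes q1: "L1 q1" and q2: "L1 q2" and sd: "spectral_data q1 = spectral_data q2"
    and \<kappa>: "det (s_mat q1 \<kappa>) \<noteq> 0"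
  shows "weyl q1 \<kappa> = weyl q2 \<kappa>"
proof -
  have ev: "eigval q1 = eigval q2" and nm: "norming q1 = norming q2"
    using sd by (auto simp: spectral_data_def fun_eq_iff)
  define X where "X = {\<kappa>. det (s_mat q1 \<kappa>) = 0}"
  have X2: "X = {\<kappa>. det (s_mat q2 \<kappa>) = 0}"
    unfolding X_def eigval_spec(2)[OF q1, symmetric] eigval_spec(2)[OF q2, symmetric] ev ..
  have "weyl q1 \<kappa> $ k $ l = weyl q2 \<kappa> $ k $ l" for k l
  proof -
    let ?f = "\<lambda>\<kappa>. weyl q1 \<kappa> $ k $ l - weyl q2 \<kappa> $ k $ l"
    have hol: "?f holomorphic_on - X"
    proof -
      have "- X = {\<kappa>. det (s_mat q1 \<kappa>) \<noteq> 0}" unfolding X_def by blast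
      moreover have "- X = {\<kappa>. det (s_mat q2 \<kappa>) \<noteq> 0}" unfolding X2 by blast
      ultimately have "mholo (weyl q1) (- X)" "mholo (weyl q2) (- X)" using mholo_weyl[OF q1] mholo_weyl[OF q2] by simp_all
      then show ?thesis unfolding mholo_def by (intro holomorphic_intros) auto
    qed
    have rem: "?f \<in> O[at z](\<lambda>_. 1)" if z: "z \<in> X" for z
    proof -
      have "z \<in> range (\<lambda>j. complex_of_real (eigval q1 j))" using z unfolding X_def eigval_spec(2)[OF q1] .
      then obtain j where j: "z = complex_of_real (eigval q1 j)" by blast
      have "norming q1 j $ k $ l = norming q2 j $ k $ l" using nm by simp
      then have res: "residue (\<lambda>\<kappa>. weyl q1 \<kappa> $ k $ l) z = residue (\<lambda>\<kappa>. weyl q2 \<kappa> $ k $ l) z"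
        by (simp add: norming_def j ev)
      have "((\<lambda>\<kappa>. weyl q1 \<kappa> $ k $ l * (\<kappa> - z) - weyl q2 \<kappa> $ k $ l * (\<kappa> - z)) \<longlongrightarrow>
          residue (\<lambda>\<kappa>. weyl q1 \<kappa> $ k $ l) z - residue (\<lambda>\<kappa>. weyl q2 \<kappa> $ k $ l) z) (at z)"
        by (intro tendsto_diff weyl_simple_pole q1 q2) (use z X2 in \<open>auto simp: X_def\<close>)
      \<comment> \<open>The equal residues cancel, and a limit 0 of the function times
        \<open>\<kappa> - z\<close> is Riemann's criterion for a removable singularity.\<close>
      then have lim: "((\<lambda>\<kappa>. (\<kappa> - z) * ?f \<kappa>) \<longlongrightarrow> 0) (at z)" by (simp add: res algebra_simps)
      obtain d where d: "d > 0" "\<And>\<kappa>. \<kappa> \<in> ball z d - {z} \<Longrightarrow> det (s_mat q1 \<kappa>) \<noteq> 0"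
        using det_s_mat_zeros_isolated[OF q1] by blast
      have h: "?f holomorphic_on ball z d - {z}"
        by (rule holomorphic_on_subset[OF hol]) (use d(2) in \<open>auto simp: X_def\<close>)
      have zi: "z \<in> interior (ball z d)" using d(1) by simp
      obtain B where "\<forall>\<^sub>F \<kappa> in at z. norm (?f \<kappa>) \<le> B"
        using lim unfolding holomorphic_on_extend_lim[OF h zi, symmetric] holomorphic_on_extend_bounded[OF h zi] by blast
      then show ?thesis by (intro bigoI[of _ B]) simp
    qed
    \<comment> \<open>The common leading term \<open>- cot \<kappa>\<close> drops out of the
      difference, so the bound on the boundary may be taken arbitrarily small.\<close>
    have "norm (?f \<kappa>) \<le> e" if e: "e > 0" for e
    proof (rule bounded_by_good_bound[OF hol _ rem])
      show "finite (X \<inter> cbox a b)" for a b unfolding X_def by (rule det_s_mat_zeros_finite_cbox[OF q1])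
      show "\<kappa> \<notin> X" using \<kappa> by (simp add: X_def)
      have e2: "e / 2 > 0" using e by simp
      show "\<forall>\<^sub>F \<kappa> in at_infinity. good \<kappa> \<longrightarrow> \<kappa> \<notin> X \<and> norm (?f \<kappa>) \<le> e"
        using weyl_asymptotics[OF q1 e2] weyl_asymptotics[OF q2 e2] good_det[OF q1]
      proof (eventually_elim, intro impI conjI)
        fix \<kappa>
        assume 1: "good \<kappa> \<longrightarrow> norm (weyl q1 \<kappa> + cmult_mat (cot \<kappa>) (mat 1)) \<le> e / 2"
          and 2: "good \<kappa> \<longrightarrow> norm (weyl q2 \<kappa> + cmult_mat (cot \<kappa>) (mat 1)) \<le> e / 2"
          and 3: "good \<kappa> \<longrightarrow> det (s_mat q1 \<kappa>) \<noteq> 0" and g: "good \<kappa>"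
        show "\<kappa> \<notin> X" using 3 g by (simp add: X_def)
        have "?f \<kappa> = (weyl q1 \<kappa> + cmult_mat (cot \<kappa>) (mat 1)) $ k $ l - (weyl q2 \<kappa> + cmult_mat (cot \<kappa>) (mat 1)) $ k $ l"
          by simp
        also have "norm \<dots> \<le> norm (weyl q1 \<kappa> + cmult_mat (cot \<kappa>) (mat 1)) + norm (weyl q2 \<kappa> + cmult_mat (cot \<kappa>) (mat 1))"
          by (intro order_trans[OF norm_triangle_ineq4] add_mono norm_matrix_nth)
        also have "\<dots> \<le> e" using 1 2 g by simp
        finally show "norm (?f \<kappa>) \<le> e" .
      qed
    qed
    then have "norm (?f \<kappa>) \<le> 0" by (rule field_le_epsilon) simp
    then show ?thesis by simp
  qed
  then show ?thesis by (simp add: vec_eq_iff)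
qed

section \<open>Uniqueness of the potential\<close>

lemma eventually_at_infinity_cnj:
  assumes "\<forall>\<^sub>F \<kappa> in at_infinity. P \<kappa>" shows "\<forall>\<^sub>F \<kappa> in at_infinity. P (cnj \<kappa>)"
proof -
  obtain b where "\<And>\<kappa>. b \<le> norm \<kappa> \<Longrightarrow> P \<kappa>" using assms unfolding eventually_at_infinity by blast
  then show ?thesis unfolding eventually_at_infinity by (intro exI[of _ b]) simp
qed

text \<open>The decomposition \<open>amat_complete\<close> inserted on the right:
  \<open>psi_sol\<close> and \<open>phi_sol\<close> carry the two complementary halves of the
  initial data.\<close>

lemma fund_sol_split:
  "fund_sol q \<kappa> x = psi_sol q x \<kappa> ** amat + cmult_mat \<i> (phi_sol q x \<kappa>) ** amat ** JJ"
proof -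
  have phi: "cmult_mat \<i> (phi_sol q x \<kappa>) = fund_sol q \<kappa> x ** JJ ** adj amat"
    by (simp add: phi_sol_def theta_eq cmult_mat_mult_left cmult_mat_mult_right cmult_mat_simps)
  have "fund_sol q \<kappa> x = fund_sol q \<kappa> x ** (adj amat ** amat + JJ ** adj amat ** amat ** JJ)"
    unfolding amat_complete by simp
  then show ?thesis
    unfolding phi psi_sol_def by (simp only: mm.add_right matrix_mul_assoc)
qed

text \<open>Equality of the Weyl functions cancels the terms containing two growing factors.\<close>

lemma transfer_matrix_eq:
  fixes q1 q2 :: "real \<Rightarrow> complex^'r::finite^'r"
  assumes m: "weyl q1 \<kappa> = weyl q2 \<kappa>" and sym: "adj (weyl q2 (cnj \<kappa>)) = weyl q2 \<kappa>"
  shows "fund_sol q1 \<kappa> x ** (JJ ** adj (fund_sol q2 (cnj \<kappa>) x) ** JJ) =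
    cmult_mat \<i> (phi_sol q1 x \<kappa> ** adj (chi_sol q2 x (cnj \<kappa>)) - chi_sol q1 x \<kappa> ** adj (phi_sol q2 x (cnj \<kappa>))) ** JJ"
proof -
  let ?p1 = "phi_sol q1 x \<kappa>" and ?p2 = "adj (phi_sol q2 x (cnj \<kappa>))"
    and ?s1 = "psi_sol q1 x \<kappa>" and ?s2 = "adj (psi_sol q2 x (cnj \<kappa>))" and ?a = "amat :: complex^('r+'r)^'r"
  have aJa: "Z ** ?a ** JJ ** adj ?a = 0" and aa: "Z ** ?a ** adj ?a = Z" for Z :: "complex^'r^('r+'r)"
    by (simp_all add: amat_JJ_adj amat_adj flip: matrix_mul_assoc[of Z] matrix_mul_assoc[of Z ?a])
  have JJ2: "Z ** JJ ** JJ = Z" for Z :: "complex^('r+'r)^'k" by (simp add: JJ_JJ flip: matrix_mul_assoc)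
  have "fund_sol q1 \<kappa> x ** JJ ** adj (fund_sol q2 (cnj \<kappa>) x) =
     (?s1 ** ?a + cmult_mat \<i> ?p1 ** ?a ** JJ) ** JJ ** (adj ?a ** ?s2 + JJ ** adj ?a ** cmult_mat (- \<i>) ?p2)"
    unfolding fund_sol_split[of q1] fund_sol_split[of q2]
    by (simp add: adj_simps adj_mult adj_JJ matrix_mul_assoc)
  also have "\<dots> = cmult_mat \<i> (?p1 ** ?s2 - ?s1 ** ?p2)"
    by (simp add: mm.add_left mm.add_right matrix_mul_assoc aJa aa JJ2 cmult_mat_mult_left cmult_mat_mult_right cmult_mat_simps
        cmult_mat_minus_left mm.minus_right mm.diff_right)
  also have "?s1 = chi_sol q1 x \<kappa> - ?p1 ** weyl q2 \<kappa>" by (simp add: chi_sol_def m)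
  also have "?s2 = adj (chi_sol q2 x (cnj \<kappa>)) - weyl q2 \<kappa> ** ?p2" by (simp add: chi_sol_def adj_simps adj_mult sym)
  also have "?p1 ** (adj (chi_sol q2 x (cnj \<kappa>)) - weyl q2 \<kappa> ** ?p2) - (chi_sol q1 x \<kappa> - ?p1 ** weyl q2 \<kappa>) ** ?p2 =
      ?p1 ** adj (chi_sol q2 x (cnj \<kappa>)) - chi_sol q1 x \<kappa> ** ?p2"
    by (simp add: mm.diff_left mm.diff_right matrix_mul_assoc)
  finally show ?thesis by (simp add: matrix_mul_assoc)
qed

lemma fund_sol_determined:
  fixes q1 q2 :: "real \<Rightarrow> complex^'r::finite^'r"
  assumes q1: "L1 q1" and q2: "L1 q2" and sd: "spectral_data q1 = spectral_data q2" and x: "x \<in> {0..1}"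
  shows "fund_sol q1 \<kappa> x = fund_sol q2 \<kappa> x"
proof -
  let ?T = "norm (theta ** adj (amat :: complex^('r+'r)^'r))" and ?N = "norm (JJ :: complex^('r+'r)^('r+'r))"
  \<comment> \<open>The fundamental matrix of the first system times the inverse of the second, the
    inverse being written so that P is visibly entire.\<close>
  define P where "P \<kappa> = fund_sol q1 \<kappa> x ** (JJ ** adj (fund_sol q2 (cnj \<kappa>) x) ** JJ)" for \<kappa>
  have Ph: "mholo P UNIV"
    unfolding P_def by (intro mholo_mult mholo_const mholo_fund_sol q1 x mholo_adj_cnj[OF mholo_fund_sol[OF q2 x]])
  obtain C1 where C1: "C1 > 0" "\<And>\<kappa> x. x \<in> {0..1} \<Longrightarrow> norm (fund_sol q1 \<kappa> x) \<le> C1 * exp (\<bar>Im \<kappa>\<bar> * x)"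
    using fund_sol_bound[OF q1] by blast
  obtain C2 where C2: "C2 > 0" "\<And>\<kappa> x. x \<in> {0..1} \<Longrightarrow> norm (fund_sol q2 \<kappa> x) \<le> C2 * exp (\<bar>Im \<kappa>\<bar> * x)"
    using fund_sol_bound[OF q2] by blast
  obtain C3 where C3: "C3 > 0" "\<forall>\<^sub>F \<kappa> in at_infinity. good \<kappa> \<longrightarrow> (\<forall>x\<in>{0..1}. norm (chi_sol q1 x \<kappa>) \<le> C3 * exp (- (\<bar>Im \<kappa>\<bar> * x)))"
    using chi_bound[OF q1] by blast
  obtain C4 where C4: "C4 > 0" "\<forall>\<^sub>F \<kappa> in at_infinity. good \<kappa> \<longrightarrow> (\<forall>x\<in>{0..1}. norm (chi_sol q2 x \<kappa>) \<le> C4 * exp (- (\<bar>Im \<kappa>\<bar> * x)))"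
    using chi_bound[OF q2] by blast
  have p1: "norm (phi_sol q1 x \<kappa>) \<le> C1 * ?T * exp (\<bar>Im \<kappa>\<bar> * x)" for \<kappa>
    using order_trans[OF norm_matrix_mult mult_right_mono[OF C1(2)[OF x], of ?T]]
    by (simp add: phi_sol_def mult_ac flip: matrix_mul_assoc)
  have p2: "norm (phi_sol q2 x \<kappa>) \<le> C2 * ?T * exp (\<bar>Im \<kappa>\<bar> * x)" for \<kappa>
    using order_trans[OF norm_matrix_mult mult_right_mono[OF C2(2)[OF x], of ?T]]
    by (simp add: phi_sol_def mult_ac flip: matrix_mul_assoc)
  \<comment> \<open>One summand for each product of a growing with a decaying solution;
    \<open>?N\<close> accounts for the final factor \<open>JJ\<close>.\<close>
  define B where "B = (C1 * ?T * C4 + C3 * (C2 * ?T)) * ?N"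
  have ev: "\<forall>\<^sub>F \<kappa> in at_infinity. good \<kappa> \<longrightarrow> norm (P \<kappa>) \<le> B"
    using C3(2) eventually_at_infinity_cnj[OF C4(2)] good_det[OF q1] good_det[OF q2] eventually_at_infinity_cnj[OF good_det[OF q2]]
  proof (eventually_elim, intro impI)
    fix \<kappa>
    assume c1: "good \<kappa> \<longrightarrow> (\<forall>x\<in>{0..1}. norm (chi_sol q1 x \<kappa>) \<le> C3 * exp (- (\<bar>Im \<kappa>\<bar> * x)))"
      and c2: "good (cnj \<kappa>) \<longrightarrow> (\<forall>x\<in>{0..1}. norm (chi_sol q2 x (cnj \<kappa>)) \<le> C4 * exp (- (\<bar>Im (cnj \<kappa>)\<bar> * x)))"
      and d: "good \<kappa> \<longrightarrow> det (s_mat q1 \<kappa>) \<noteq> 0" "good \<kappa> \<longrightarrow> det (s_mat q2 \<kappa>) \<noteq> 0" "good (cnj \<kappa>) \<longrightarrow> det (s_mat q2 (cnj \<kappa>)) \<noteq> 0"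
      and g: "good \<kappa>"
    have g': "good (cnj \<kappa>)" using g by (simp add: good_cnj)
    have m: "weyl q1 \<kappa> = weyl q2 \<kappa>" by (rule weyl_determined[OF q1 q2 sd]) (use d g in blast)
    have sym: "adj (weyl q2 (cnj \<kappa>)) = weyl q2 \<kappa>" by (rule weyl_symmetric[OF q2]) (use d g g' in blast)+
    let ?X = "exp (\<bar>Im \<kappa>\<bar> * x)" and ?Y = "exp (- (\<bar>Im \<kappa>\<bar> * x))"
    have XY: "?X * ?Y = 1" by (simp flip: exp_add)
    have x1: "norm (chi_sol q1 x \<kappa>) \<le> C3 * ?Y" using c1 g x by blast
    have x2: "norm (chi_sol q2 x (cnj \<kappa>)) \<le> C4 * ?Y" using c2 g' x by simp
    have y2: "norm (phi_sol q2 x (cnj \<kappa>)) \<le> C2 * ?T * ?X" using p2[of "cnj \<kappa>"] by simp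
    have "norm (P \<kappa>) \<le> norm (phi_sol q1 x \<kappa> ** adj (chi_sol q2 x (cnj \<kappa>)) - chi_sol q1 x \<kappa> ** adj (phi_sol q2 x (cnj \<kappa>))) * ?N"
      unfolding P_def transfer_matrix_eq[OF m sym]
      by (rule order_trans[OF norm_matrix_mult]) (simp add: norm_cmult_mat)
    also have "\<dots> \<le> ((C1 * ?T * ?X) * (C4 * ?Y) + (C3 * ?Y) * (C2 * ?T * ?X)) * ?N"
    proof (rule mult_right_mono, rule order_trans[OF norm_triangle_ineq4], rule add_mono)
      show "norm (phi_sol q1 x \<kappa> ** adj (chi_sol q2 x (cnj \<kappa>))) \<le> (C1 * ?T * ?X) * (C4 * ?Y)"
        by (rule order_trans[OF norm_matrix_mult], rule mult_mono) (use p1 x2 C1(1) in \<open>auto simp: norm_adj\<close>)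
      show "norm (chi_sol q1 x \<kappa> ** adj (phi_sol q2 x (cnj \<kappa>))) \<le> (C3 * ?Y) * (C2 * ?T * ?X)"
        by (rule order_trans[OF norm_matrix_mult], rule mult_mono) (use x1 y2 C3(1) in \<open>auto simp: norm_adj\<close>)
    qed simp
    also have "\<dots> = (C1 * ?T * C4 + C3 * (C2 * ?T)) * (?X * ?Y) * ?N" by (simp only: algebra_simps)
    also have "\<dots> = B" unfolding XY B_def by simp
    finally show "norm (P \<kappa>) \<le> B" .
  qed
  have const: "P \<kappa> = P 0" for \<kappa>
  proof -
    have "P \<kappa> $ i $ j = P 0 $ i $ j" for i j
    proof -
      let ?f = "\<lambda>\<kappa>. P \<kappa> $ i $ j"
      have hol: "?f holomorphic_on UNIV" using Ph by (simp add: mholo_def)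
      \<comment> \<open>So far the bound holds at distant good points; the maximum principle on the
        squares, with no singularities, spreads it over the plane before Liouville applies.\<close>
      have "norm (?f \<kappa>) \<le> B" for \<kappa>
      proof (rule bounded_by_good_bound[where X = "{}" and f = ?f])
        show "\<forall>\<^sub>F \<kappa> in at_infinity. good \<kappa> \<longrightarrow> \<kappa> \<notin> {} \<and> norm (?f \<kappa>) \<le> B"
          using ev by eventually_elim (meson empty_iff norm_matrix_nth order_trans)
      qed (use hol in auto)
      then have "bounded (range ?f)" unfolding bounded_iff by blast
      then have "?f constant_on UNIV" by (rule Liouville_theorem[OF hol])
      then show ?thesis unfolding constant_on_def by auto
    qed
    then show ?thesis by (simp add: vec_eq_iff)
  qed
  have PU: "P 0 ** fund_sol q2 \<kappa> x = fund_sol q1 \<kappa> x" for \<kappa>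
  proof -
    have "P 0 ** fund_sol q2 \<kappa> x = P \<kappa> ** fund_sol q2 \<kappa> x" by (subst const[of \<kappa>]) (rule refl)
    also have "\<dots> = fund_sol q1 \<kappa> x ** (JJ ** (adj (fund_sol q2 (cnj \<kappa>) x) ** JJ ** fund_sol q2 \<kappa> x))"
      by (simp add: P_def matrix_mul_assoc)
    also have "\<dots> = fund_sol q1 \<kappa> x" unfolding fund_sol_inverse(1)[OF q2 x] by (simp add: JJ_JJ)
    finally show ?thesis .
  qed
  \<comment> \<open>At a real spectral parameter the free solution and its inverse do not increase
    norms, and \<open>(P 0 - mat 1) ** ?E\<close> is the error of the first system minus
    \<open>P 0\<close> times that of the second. The factor \<open>1 + norm (P 0)\<close> is
    absorbed in \<delta>.\<close>
  have "norm (P 0 - mat 1) \<le> e" if e: "e > 0" for e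
  proof -
    define \<delta> where "\<delta> = e / (1 + norm (P 0))"
    have n1: "1 + norm (P 0) > 0" by (simp add: add_pos_nonneg)
    have \<delta>: "\<delta> > 0" using e n1 by (simp add: \<delta>_def)
    have "\<forall>\<^sub>F \<kappa> in at_infinity. norm (fund_sol q1 \<kappa> x - Edg (\<i> * \<kappa> * of_real x)) \<le> \<delta> * exp (\<bar>Im \<kappa>\<bar> * x) \<and>
       norm (fund_sol q2 \<kappa> x - Edg (\<i> * \<kappa> * of_real x)) \<le> \<delta> * exp (\<bar>Im \<kappa>\<bar> * x)"
      using fund_sol_asymptotics[OF q1 \<delta>] fund_sol_asymptotics[OF q2 \<delta>] by eventually_elim (use x in blast)
    then obtain b where b: "\<And>\<kappa>. b \<le> norm \<kappa> \<Longrightarrow> norm (fund_sol q1 \<kappa> x - Edg (\<i> * \<kappa> * of_real x)) \<le> \<delta> * exp (\<bar>Im \<kappa>\<bar> * x) \<and>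
       norm (fund_sol q2 \<kappa> x - Edg (\<i> * \<kappa> * of_real x)) \<le> \<delta> * exp (\<bar>Im \<kappa>\<bar> * x)"
      unfolding eventually_at_infinity by blast
    define \<kappa> where "\<kappa> = complex_of_real \<bar>b\<bar>"
    let ?E = "Edg (\<i> * \<kappa> * of_real x) :: complex^('r+'r)^('r+'r)"
    have "b \<le> norm \<kappa>" by (simp add: \<kappa>_def)
    from b[OF this] have b1: "norm (fund_sol q1 \<kappa> x - ?E) \<le> \<delta>" and b2: "norm (fund_sol q2 \<kappa> x - ?E) \<le> \<delta>"
      by (simp_all add: \<kappa>_def)
    have "P 0 - mat 1 = ((P 0 - mat 1) ** ?E) ** Edg (- (\<i> * \<kappa> * of_real x))"
      by (simp add: Edg_minus flip: matrix_mul_assoc)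
    also have "norm \<dots> \<le> exp \<bar>Re (- (\<i> * \<kappa> * of_real x))\<bar> * norm ((P 0 - mat 1) ** ?E)" by (rule norm_mult_Edg)
    also have "\<dots> = norm ((P 0 - mat 1) ** ?E)" by (simp add: \<kappa>_def)
    also have "(P 0 - mat 1) ** ?E = (fund_sol q1 \<kappa> x - ?E) - P 0 ** (fund_sol q2 \<kappa> x - ?E)"
      by (simp add: mm.diff_left mm.diff_right PU)
    also have "norm \<dots> \<le> \<delta> + norm (P 0) * \<delta>"
      by (intro order_trans[OF norm_triangle_ineq4] add_mono b1) (rule order_trans[OF norm_matrix_mult mult_left_mono[OF b2 norm_ge_zero]])
    also have "\<dots> = (1 + norm (P 0)) * \<delta>" by (simp add: algebra_simps)
    also have "\<dots> = e" using n1 by (simp add: \<delta>_def)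
    finally show ?thesis .
  qed
  then have "norm (P 0 - mat 1) \<le> 0" by (rule field_le_epsilon) simp
  then have "P 0 = mat 1" by simp
  then show ?thesis using PU[of \<kappa>] by simp
qed

lemma Qm_inject: assumes "Qm q1 x = Qm q2 x" shows "q1 x = q2 x"
proof -
  have "cmult_mat \<i> JJ ** Qm q x = bold (q x)" for q :: "real \<Rightarrow> complex^'r^'r::finite"
    by (simp add: Qm_def mm.minus_right cmult_mat_mult_left cmult_mat_mult_right cmult_mat_simps matrix_mul_assoc JJ_JJ cmult_mat_minus_left)
  then have "bold (q1 x) = bold (q2 x)" using assms by metis
  then show ?thesis by (rule bold_inject)
qed

text \<open>At spectral parameter 0 the equation is U' = Qm U. A solution common to both systems is
  invertible at every point, so almost everywhere equality of the two densities can be multiplied by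
  its inverse.\<close>

lemma potential_determined:
  fixes q1 q2 :: "real \<Rightarrow> complex^'r::finite^'r"
  assumes q1: "L1 q1" and q2: "L1 q2" and sd: "spectral_data q1 = spectral_data q2"
  shows "AE x in unit_leb. q1 x = q2 x"
proof -
  let ?U = "fund_sol q1 0"
  have u1: "ac_deriv ?U (\<lambda>x. Qm q1 x ** ?U x)"
    using lin_sol_fund_sol[OF q1, of 0] by (simp add: lin_sol_def cmult_mat_simps)
  have "ac_deriv (fund_sol q2 0) (\<lambda>x. Qm q2 x ** fund_sol q2 0 x)"
    using lin_sol_fund_sol[OF q2, of 0] by (simp add: lin_sol_def cmult_mat_simps)
  then have u2: "ac_deriv ?U (\<lambda>x. Qm q2 x ** ?U x)"
    by (rule ac_deriv_cong) (simp_all add: fund_sol_determined[OF q1 q2 sd])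
  have "q1 x = q2 x" if x: "x \<in> {0..1}" and e: "Qm q1 x ** ?U x = Qm q2 x ** ?U x" for x
  proof (rule Qm_inject)
    let ?V = "JJ ** adj (fund_sol q1 (cnj 0) x) ** JJ"
    have "Qm q1 x ** (?U x ** ?V) = Qm q2 x ** (?U x ** ?V)" using e by (simp only: matrix_mul_assoc)
    then show "Qm q1 x = Qm q2 x" unfolding fund_sol_inverse(2)[OF q1 x] by simp
  qed
  then have "{x \<in> {0..1}. q1 x \<noteq> q2 x} \<subseteq> {x \<in> {0..1}. Qm q1 x ** ?U x \<noteq> Qm q2 x ** ?U x}" by blast
  then show ?thesis
    unfolding AE_unit_leb by (rule negligible_subset[OF ac_deriv_AE_unique[OF u1 u2]])
qed

section \<open>Passage to classes modulo equality almost everywhere\<close>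

lemma spectral_map_class:
  fixes f :: "real \<Rightarrow> complex^'r::finite^'r"
  assumes "f \<in> Lp_fun p"
  shows "spectral_map (Lp_rel p `` {f}) = spectral_data f"
proof -
  have "spectral_data ` (Lp_rel p `` {f}) = {spectral_data f}"
  proof
    show "spectral_data ` (Lp_rel p `` {f}) \<subseteq> {spectral_data f}"
    proof
      fix d assume "d \<in> spectral_data ` (Lp_rel p `` {f})"
      then obtain g where g: "(f, g) \<in> Lp_rel p" "d = spectral_data g" by blast
      then show "d \<in> {spectral_data f}" using congruentD[OF spectral_data_respects g(1)] by simp
    qed
    have "(f, f) \<in> Lp_rel p" using assms by (simp add: Lp_rel_def)
    then show "{spectral_data f} \<subseteq> spectral_data ` (Lp_rel p `` {f})" by blast
  qed
  then show ?thesis by (simp add: spectral_map_def)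
qed

theorem theorem1p2:
  fixes p :: real
  assumes "1 \<le> p"
  shows "bij_betw (spectral_map :: (real \<Rightarrow> complex^'r::finite^'r) set \<Rightarrow> int \<Rightarrow> real \<times> (complex^'r^'r))
           (Lp p) (Ap p)"
proof (rule bij_betw_imageI)
  show "inj_on (spectral_map :: (real \<Rightarrow> complex^'r::finite^'r) set \<Rightarrow> int \<Rightarrow> real \<times> (complex^'r^'r)) (Lp p)"
  proof (rule inj_onI)
    fix F G :: "(real \<Rightarrow> complex^'r^'r) set"
    assume F: "F \<in> Lp p" and G: "G \<in> Lp p" and eq: "spectral_map F = spectral_map G"
    obtain f where f: "f \<in> Lp_fun p" "F = Lp_rel p `` {f}" using F unfolding Lp_def by (rule quotientE)
    obtain g where g: "g \<in> Lp_fun p" "G = Lp_rel p `` {g}" using G unfolding Lp_def by (rule quotientE)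
    have "spectral_data f = spectral_data g"
      using eq unfolding f(2) g(2) spectral_map_class[OF f(1)] spectral_map_class[OF g(1)] .
    then have ae: "AE x in unit_leb. f x = g x"
      by (rule potential_determined[OF Lp_fun_L1[OF assms f(1)] Lp_fun_L1[OF assms g(1)]])
    have iff: "(AE x in unit_leb. f x = h x) \<longleftrightarrow> (AE x in unit_leb. g x = h x)" for h
      by (rule eventually_subst) (use ae in eventually_elim, simp)
    show "F = G" unfolding f(2) g(2) using f(1) g(1) iff by (auto simp: Lp_rel_def)
  qed
  show "(spectral_map :: (real \<Rightarrow> complex^'r::finite^'r) set \<Rightarrow> int \<Rightarrow> real \<times> (complex^'r^'r)) ` Lp p = Ap p"
  proof
    show "(spectral_map :: (real \<Rightarrow> complex^'r^'r) set \<Rightarrow> _) ` Lp p \<subseteq> Ap p"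
      unfolding Lp_def Ap_def by (auto elim!: quotientE simp: spectral_map_class)
    show "Ap p \<subseteq> (spectral_map :: (real \<Rightarrow> complex^'r^'r) set \<Rightarrow> _) ` Lp p"
    proof
      fix d :: "int \<Rightarrow> real \<times> (complex^'r^'r)" assume "d \<in> Ap p"
      then obtain f where f: "f \<in> Lp_fun p" "d = spectral_data f" unfolding Ap_def by blast
      then have "d = spectral_map (Lp_rel p `` {f})" by (simp add: spectral_map_class)
      moreover have "Lp_rel p `` {f} \<in> Lp p" unfolding Lp_def by (rule quotientI[OF f(1)])
      ultimately show "d \<in> spectral_map ` Lp p" by blast
    qed
  qed
qed

end
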